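(* Let $1<p<2<q<\infty$ be real numbers with $\frac1p-\frac1q=\frac12$. Let $V\in L^2(\mathbb{R}^2)$ and let $u\in L^p(\mathbb{R}^2)\cap L^q(\mathbb{R}^2)$ satisfy the differential inequality $$|\overline{\partial}u|\leq |Vu| \quad\text{almost everywhere on } \mathbb{R}^2 .$$ If $u$ vanishes (almost everywhere) in a non-empty open subset of $\mathbb{R}^2$, then $u$ is identically zero (that is, $u=0$ almost everywhere on $\mathbb{R}^2$).
   Context: Functions on $\mathbb{R}^2$ are complex-valued, and points of $\mathbb{R}^2$ are written $(x,y)$. The Cauchy-Riemann operator is $\overline{\partial}=\frac12\left(\partial_x+i\,\partial_y\right)$. For $u\in L^p(\mathbb{R}^2)\cap L^q(\mathbb{R}^2)$, $\overline{\partial}u$ is understood in the sense of distributions; to say that $u$ satisfies $|\overline{\partial}u|\le|Vu|$ means that the distribution $\overline{\partial}u$ is represented by a locally integrable function for which the inequality holds almost everywhere. *)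

theory Defs
  imports "HOL-Analysis.Analysis"
begin

text \<open>Functions are not identified up to null sets; membership in \<open>L\<^sup>p\<close> (for finite \<open>p > 0\<close>)
  is a property of a representative.\<close>

definition memLp :: "real \<Rightarrow> (real \<times> real \<Rightarrow> complex) \<Rightarrow> bool" where
  "memLp p f \<longleftrightarrow>
     f \<in> borel_measurable lebesgue \<and> integrable lebesgue (\<lambda>z. norm (f z) powr p)"

definition locally_integrable :: "(real \<times> real \<Rightarrow> complex) \<Rightarrow> bool" where
  "locally_integrable f \<longleftrightarrow> (\<forall>K. compact K \<longrightarrow> f absolutely_integrable_on K)"

primrec Ck :: "nat \<Rightarrow> ('a::real_normed_vector \<Rightarrow> 'b::real_normed_vector) \<Rightarrow> bool" where
  "Ck 0 f \<longleftrightarrow> continuous_on UNIV f"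
| "Ck (Suc k) f \<longleftrightarrow>
     (\<forall>z. f differentiable (at z)) \<and> (\<forall>v. Ck k (\<lambda>z. frechet_derivative f (at z) v))"

definition smooth :: "('a::real_normed_vector \<Rightarrow> 'b::real_normed_vector) \<Rightarrow> bool" where
  "smooth f \<longleftrightarrow> (\<forall>k. Ck k f)"

definition test_function :: "(real \<times> real \<Rightarrow> complex) \<Rightarrow> bool" where
  "test_function \<phi> \<longleftrightarrow> smooth \<phi> \<and> compact (closure {z. \<phi> z \<noteq> 0})"

text \<open>The classical Cauchy-Riemann operator, for differentiable \<open>f\<close>: the derivative in direction
  \<open>(1, 0)\<close> is the partial derivative in \<open>x\<close>, the one in direction \<open>(0, 1)\<close> that in \<open>y\<close>.\<close>

definition dbar :: "(real \<times> real \<Rightarrow> complex) \<Rightarrow> real \<times> real \<Rightarrow> complex" where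
  "dbar f z = (1 / 2) *
     (frechet_derivative f (at z) (1, 0) + \<i> * frechet_derivative f (at z) (0, 1))"

text \<open>For locally integrable \<open>u\<close>: the distribution \<open>dbar u\<close> is represented by the locally
  integrable function \<open>g\<close>.  The sign comes from integration by parts; the pairing is bilinear
  (no complex conjugation).\<close>

definition has_distributional_dbar ::
    "(real \<times> real \<Rightarrow> complex) \<Rightarrow> (real \<times> real \<Rightarrow> complex) \<Rightarrow> bool" where
  "has_distributional_dbar u g \<longleftrightarrow>
     locally_integrable g \<and>
     (\<forall>\<phi>. test_function \<phi> \<longrightarrow>
        (LINT z|lebesgue. g z * \<phi> z) = - (LINT z|lebesgue. u z * dbar \<phi> z))"

end

theory Submission
  imports Defs "HOL-Real_Asymp.Real_Asymp"
begin

text \<open>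
  The argument is a Carleman estimate with the weights \<open>|z - a|\<^sup>-\<^sup>N\<close>, where \<open>u\<close> vanishes near \<open>a\<close>.
  Since \<open>(z - a)\<^sup>-\<^sup>N\<close> is holomorphic where \<open>u\<close> lives, the function \<open>F = (z - a)\<^sup>-\<^sup>N u\<close> satisfies
  \<open>|\<partial>F| \<le> |V F|\<close>, for the Cauchy-Riemann operator \<open>\<partial>\<close>, and is dominated almost everywhere by
  the potential of \<open>|V F|\<close> with kernel \<open>1 / |x - y|\<close>, up to a constant independent of \<open>N\<close>.
  By the Hardy--Littlewood--Sobolev inequality and Hoelder's inequality, the \<open>L\<^sup>q\<close> norm of \<open>F\<close>
  on a disc of radius \<open>R\<^sub>1\<close> is bounded by a constant times the \<open>L\<^sup>p\<close> norm of \<open>V F\<close>.  If \<open>u\<close> vanishes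
  on the disc of radius \<open>R < R\<^sub>1\<close> and \<open>R\<^sub>1 - R\<close> is small, then \<open>V\<close> has small \<open>L\<^sup>2\<close> norm on the annulus
  in between, so that the contribution of the annulus is absorbed and what remains is
  \<open>O(R\<^sub>1\<^sup>-\<^sup>N)\<close>.  Letting \<open>N\<close> tend to infinity shows that \<open>u\<close> vanishes on every smaller disc,
  and a supremum argument exhausts the plane.
\<close>

section \<open>Iterated differentiability\<close>

text \<open>The relation 1/p - 1/q = 1/2 is used twice: it is the gain in integrability from the
  kernel 1/|x| in the plane, and the loss in Hoelder's inequality for a factor in L^2. Gain and loss
  cancel exactly, so no power of a small length is left over, and smallness can come only from the
  norm of \<open>V\<close> on a thin annulus. How thin it must be depends on the radius; the steps
  have no lower bound, which is why a supremum replaces an iteration. Since \<open>u\<close> has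
  only a weak derivative, \<open>F\<close> is never differentiated. A truncated Cauchy kernel is
  inserted as a test function, and the truncation is chosen so that its image under
  \<open>dbar\<close> is a mollifier; the potential bound is thus obtained for mollifications of
  \<open>F\<close>, uniformly in the scale, and then almost everywhere. Absorbing a multiple of a
  norm requires that norm to be finite beforehand. The singular weight is therefore replaced by a
  smooth one that is bounded for each fixed \<open>N\<close> and agrees with it wherever
  \<open>u\<close> is nonzero.\<close>

lemma Ck_SucI:
  assumes "\<And>z. (f has_derivative f' z) (at z)" "\<And>v. Ck k (\<lambda>z. f' z v)"
  shows "Ck (Suc k) f"
proof -
  have "frechet_derivative f (at z) = f' z" for z
    using frechet_derivative_at[OF assms(1)[of z]] by simp
  then show ?thesis using assms by (auto simp: differentiable_def)
qed

lemma Ck_SucD: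
  assumes "Ck (Suc k) f"
  shows "(f has_derivative frechet_derivative f (at z)) (at z)"
    "Ck k (\<lambda>z. frechet_derivative f (at z) v)"
  using assms frechet_derivative_works by auto

text \<open>Only the bottom level of \<open>Ck\<close> mentions continuity, so the content is that
  differentiability everywhere gives continuity. Product and chain rules need it to lower the order
  of their undifferentiated factors.\<close>

lemma Ck_Suc_lower: "Ck (Suc k) f \<Longrightarrow> Ck k f"
proof (induction k arbitrary: f)
  case 0
  then show ?case
    by (auto simp: continuous_on_eq_continuous_at intro: differentiable_imp_continuous_within)
next
  case (Suc k)
  have "Ck k (\<lambda>z. frechet_derivative f (at z) v)" for v
    by (rule Suc.IH) (use Suc.prems in simp)
  moreover have "f differentiable (at z)" for z using Suc.prems by simp
  ultimately show ?case by simp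
qed

lemma Ck_const [simp]: "Ck k (\<lambda>z. c)"
proof (induction k arbitrary: c)
  case (Suc k)
  show ?case by (rule Ck_SucI[where f' = "\<lambda>z v. 0"]) (auto simp: Suc)
qed auto

lemma Ck_bounded_linear: "bounded_linear L \<Longrightarrow> Ck k L"
proof (induction k arbitrary: L)
  case 0
  then show ?case by (simp add: linear_continuous_on)
next
  case (Suc k)
  show ?case
    by (rule Ck_SucI[where f' = "\<lambda>z. L"]) (auto intro: bounded_linear_imp_has_derivative Suc.prems)
qed

lemma Ck_add: "Ck k f \<Longrightarrow> Ck k g \<Longrightarrow> Ck k (\<lambda>z. f z + g z)"
proof (induction k arbitrary: f g)
  case 0
  then show ?case by (auto intro: continuous_intros)
next
  case (Suc k)
  show ?case
    by (rule Ck_SucI[OF has_derivative_add[OF Ck_SucD(1)[OF Suc.prems(1)] Ck_SucD(1)[OF Suc.prems(2)]]])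
      (intro Suc.IH Ck_SucD(2) Suc.prems)
qed

lemma Ck_bounded_bilinear:
  assumes B: "bounded_bilinear pr"
  shows "Ck k f \<Longrightarrow> Ck k g \<Longrightarrow> Ck k (\<lambda>z. pr (f z) (g z))"
proof (induction k arbitrary: f g)
  case 0
  then show ?case using bounded_bilinear.continuous_on[OF B, of UNIV f g] by simp
next
  case (Suc k)
  show ?case
    by (rule Ck_SucI[OF bounded_bilinear.FDERIV[OF B Ck_SucD(1)[OF Suc.prems(1)] Ck_SucD(1)[OF Suc.prems(2)]]])
      (intro Ck_add Suc.IH Ck_SucD(2) Ck_Suc_lower[OF Suc.prems(1)] Ck_Suc_lower[OF Suc.prems(2)] Suc.prems)
qed

lemma Ck_mult: "Ck k f \<Longrightarrow> Ck k g \<Longrightarrow> Ck k (\<lambda>z. f z * g z)"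
  for f :: "'a::real_normed_vector \<Rightarrow> 'b::real_normed_algebra"
  by (rule Ck_bounded_bilinear[OF bounded_bilinear_mult])

lemma Ck_power: "Ck k f \<Longrightarrow> Ck k (\<lambda>z. f z ^ n)"
  for f :: "'a::real_normed_vector \<Rightarrow> 'b::real_normed_algebra_1"
  by (induction n) (simp_all add: Ck_mult)

lemma Ck_compose_bounded_linear:
  "bounded_linear L \<Longrightarrow> Ck k f \<Longrightarrow> Ck k (\<lambda>z. L (f z))"
proof (induction k arbitrary: f)
  case 0
  then show ?case using bounded_linear.continuous_on[of L UNIV f] by simp
next
  case (Suc k)
  show ?case
    by (rule Ck_SucI[OF bounded_linear.has_derivative[OF Suc.prems(1) Ck_SucD(1)[OF Suc.prems(2)]]])
      (intro Suc.IH Ck_SucD(2) Suc.prems)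
qed

lemma Ck_compose_real:
  fixes h :: "real \<Rightarrow> real"
  shows "Ck k h \<Longrightarrow> Ck k s \<Longrightarrow> Ck k (\<lambda>z. h (s z))"
proof (induction k arbitrary: h)
  case 0
  then have "continuous_on UNIV h" "continuous_on UNIV s" by simp_all
  then have "continuous_on UNIV (\<lambda>z. h (s z))" by (rule continuous_on_compose2) simp
  then show ?case by simp
next
  case (Suc k)
  have D: "((\<lambda>z. h (s z)) has_derivative
      (\<lambda>v. frechet_derivative h (at (s z)) (frechet_derivative s (at z) v))) (at z)" for z
    using diff_chain_at[OF Ck_SucD(1)[OF Suc.prems(2), of z] Ck_SucD(1)[OF Suc.prems(1), of "s z"]]
    by (simp add: o_def)
  \<comment> \<open>On the line a derivative is multiplication by its value at 1. The chain rule
    thus becomes a product of two factors of order \<open>k\<close>, and the induction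
    closes.\<close>
  have scale: "frechet_derivative h (at t) w = w * frechet_derivative h (at t) 1" for t w
  proof -
    interpret bounded_linear "frechet_derivative h (at t)"
      by (rule has_derivative_bounded_linear[OF Ck_SucD(1)[OF Suc.prems(1)]])
    show ?thesis using scaleR[of w 1] by simp
  qed
  have D': "((\<lambda>z. h (s z)) has_derivative
      (\<lambda>v. frechet_derivative s (at z) v * frechet_derivative h (at (s z)) 1)) (at z)" for z
    by (rule has_derivative_eq_rhs[OF D]) (rule ext, rule scale)
  show ?case
    by (rule Ck_SucI[OF D']) (rule Ck_mult[OF Ck_SucD(2)[OF Suc.prems(2)] Suc.IH[OF Ck_SucD(2)[OF Suc.prems(1)] Ck_Suc_lower[OF Suc.prems(2)]]])
qed

lemma Ck_realI:
  fixes h :: "real \<Rightarrow> real"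
  assumes "\<And>t. (h has_real_derivative h' t) (at t)" "Ck k h'"
  shows "Ck (Suc k) h"
proof (rule Ck_SucI)
  show "(h has_derivative (\<lambda>v. h' t * v)) (at t)" for t
    using assms(1)[of t] by (simp add: has_field_derivative_def)
  show "Ck k (\<lambda>t. h' t * v)" for v
    by (intro Ck_mult Ck_const assms(2))
qed

text \<open>The derivative of h(t)/t is h'(t)/t - (h(t)/t)/t. Every numerator here again vanishes
  below \<open>\<delta>\<close>, so the induction hypothesis applies once to the derivative and
  twice in succession for the last term. At 0 the quotient has the default value 0, which is the
  right one.\<close>

lemma Ck_divide_id:
  fixes h :: "real \<Rightarrow> real"
  assumes "\<delta> > 0"
  shows "Ck k h \<Longrightarrow> (\<And>t. t < \<delta> \<Longrightarrow> h t = 0) \<Longrightarrow> Ck k (\<lambda>t. h t / t)"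
proof (induction k arbitrary: h)
  case 0
  have "isCont (\<lambda>t. h t / t) t" for t
  proof (cases "t < \<delta>")
    case True
    have "\<forall>\<^sub>F s in nhds t. h s / s = 0"
      using eventually_nhds_in_open[of "{..<\<delta>}" t] True
      by (auto elim!: eventually_mono simp: 0)
    then show ?thesis using isCont_cong[of "\<lambda>t. h t / t" "\<lambda>t. 0" t] by simp
  next
    case False
    then show ?thesis using 0 assms
      by (intro continuous_intros) (auto simp: continuous_on_eq_continuous_at)
  qed
  then show ?case by (simp add: continuous_at_imp_continuous_on)
next
  case (Suc k)
  let ?h' = "\<lambda>t. frechet_derivative h (at t) 1"
  have dh: "(h has_real_derivative ?h' t) (at t)" for t
  proof -
    interpret bounded_linear "frechet_derivative h (at t)"
      by (rule has_derivative_bounded_linear[OF Ck_SucD(1)[OF Suc.prems(1)]])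
    have "frechet_derivative h (at t) = (*) (?h' t)"
    proof
      fix w show "frechet_derivative h (at t) w = ?h' t * w" using scaleR[of w 1] by simp
    qed
    then show ?thesis using Ck_SucD(1)[OF Suc.prems(1), of t]
      by (simp add: has_field_derivative_def)
  qed
  have h'0: "?h' t = 0" if "t < \<delta>" for t
  proof -
    have "(h has_real_derivative 0) (at t)"
      by (rule has_field_derivative_transform_within_open[of "\<lambda>t. 0" _ _ "{..<\<delta>}"])
        (use that Suc.prems in auto)
    then show ?thesis using dh[of t] DERIV_unique by blast
  qed
  have "((\<lambda>t. h t / t) has_real_derivative ?h' t / t + (- 1) * (h t / t / t)) (at t)" for t
  proof (cases "t < \<delta>")
    case True
    have "((\<lambda>t. h t / t) has_real_derivative 0) (at t)"
      by (rule has_field_derivative_transform_within_open[of "\<lambda>t. 0" _ _ "{..<\<delta>}"])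
        (use True Suc.prems in auto)
    then show ?thesis using True h'0 Suc.prems by simp
  next
    case False
    then have "t \<noteq> 0" using assms by auto
    then show ?thesis
      by (auto intro!: derivative_eq_intros dh simp: field_simps)
  qed
  moreover have "Ck k (\<lambda>t. ?h' t / t + (- 1) * (h t / t / t))"
  proof -
    have 1: "Ck k (\<lambda>t. ?h' t / t)"
      by (rule Suc.IH[OF Ck_SucD(2)[OF Suc.prems(1)] h'0])
    have 2: "Ck k (\<lambda>t. h t / t)"
      by (rule Suc.IH[OF Ck_Suc_lower[OF Suc.prems(1)] Suc.prems(2)])
    have 3: "Ck k (\<lambda>t. h t / t / t)"
      by (rule Suc.IH[OF 2]) (simp add: Suc.prems(2))
    show ?thesis by (rule Ck_add[OF 1 Ck_mult[OF Ck_const 3]])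
  qed
  ultimately show ?case by (rule Ck_realI)
qed

text \<open>Derivatives of members of this family are linear combinations of members, so one
  induction proves all of them smooth, without tracking the polynomials in 1/t that repeated
  differentiation of exp(-1/t) produces.\<close>

definition flat :: "nat \<Rightarrow> real \<Rightarrow> real" where
  "flat n t = (if t > 0 then exp (- inverse t) / t ^ n else 0)"

lemma isCont_flat: "isCont (flat n) t"
proof -
  have lim: "((\<lambda>t::real. exp (- inverse t) / t ^ n) \<longlongrightarrow> 0) (at_right 0)"
    by real_asymp
  consider "t < 0" | "t = 0" | "t > 0" by linarith
  then show ?thesis
  proof cases
    case 1
    have "\<forall>\<^sub>F s in nhds t. flat n s = 0"
      using eventually_nhds_in_open[of "{..<0}" t] 1 by (auto elim!: eventually_mono simp: flat_def)
    then show ?thesis using isCont_cong[of "flat n" "\<lambda>t. 0" t] by simp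
  next
    case 3
    have "\<forall>\<^sub>F s in nhds t. flat n s = exp (- inverse s) / s ^ n"
      using eventually_nhds_in_open[of "{0<..}" t] 3 by (auto elim!: eventually_mono simp: flat_def)
    moreover have "isCont (\<lambda>s. exp (- inverse s) / s ^ n) t"
      using 3 by (intro continuous_intros) auto
    ultimately show ?thesis using isCont_cong[of "flat n" "\<lambda>s. exp (- inverse s) / s ^ n" t] by simp
  next
    case 2
    have "\<forall>\<^sub>F s in at_right 0. exp (- inverse s) / s ^ n = flat n s"
      by (rule eventually_mono[OF eventually_at_right_less]) (simp add: flat_def)
    then have "(flat n \<longlongrightarrow> 0) (at_right 0)"
      by (rule Lim_transform_eventually[OF lim])
    moreover have "\<forall>\<^sub>F s in at_left 0. 0 = flat n s"
      unfolding eventually_at_filter by (rule always_eventually) (simp add: flat_def)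
    then have "(flat n \<longlongrightarrow> 0) (at_left 0)"
      by (rule Lim_transform_eventually[OF tendsto_const])
    ultimately show ?thesis unfolding isCont_def 2 by (simp add: filterlim_split_at flat_def)
  qed
qed

lemma DERIV_flat: "(flat n has_real_derivative flat (n + 2) t + (- real n) * flat (n + 1) t) (at t)"
proof -
  consider "t < 0" | "t = 0" | "t > 0" by linarith
  then show ?thesis
  proof cases
    case 1
    have "(flat n has_real_derivative 0) (at t)"
      by (rule has_field_derivative_transform_within_open[of "\<lambda>t. 0" _ _ "{..<0}"])
        (use 1 in \<open>auto simp: flat_def\<close>)
    then show ?thesis using 1 by (simp add: flat_def)
  next
    case 3
    have P: "((\<lambda>t. t ^ n) has_real_derivative real n * t ^ n / t) (at t)"
      by (rule DERIV_cong[OF DERIV_pow]) (use 3 in \<open>cases n; simp\<close>)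
    have E: "((\<lambda>t. exp (- inverse t)) has_real_derivative exp (- inverse t) / (t * t)) (at t)"
      using 3 by (auto intro!: derivative_eq_intros simp: field_simps)
    have "t ^ n \<noteq> 0" using 3 by simp
    define e c where "e = exp (- inverse t)" and "c = t ^ n"
    have "c > 0" using 3 by (simp add: c_def)
    have "(e / (t * t) * c - e * (real n * c / t)) / (c * c) = e / (c * (t * t)) + (- real n) * (e / (c * t))"
      using 3 \<open>c > 0\<close> by (simp add: divide_simps) (simp add: algebra_simps)
    then have eq: "(exp (- inverse t) / (t * t) * t ^ n - exp (- inverse t) * (real n * t ^ n / t)) / (t ^ n * t ^ n)
        = flat (n + 2) t + (- real n) * flat (n + 1) t"
      using 3 unfolding e_def c_def by (simp add: mult_ac flat_def)
    have "((\<lambda>t. exp (- inverse t) / t ^ n) has_real_derivative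
        flat (n + 2) t + (- real n) * flat (n + 1) t) (at t)"
      by (rule DERIV_cong[OF DERIV_divide[OF E P \<open>t ^ n \<noteq> 0\<close>] eq])
    then show ?thesis
      by (rule has_field_derivative_transform_within_open[of _ _ _ "{0<..}"])
        (use 3 in \<open>auto simp: flat_def\<close>)
  next
    case 2
    \<comment> \<open>The difference quotient of \<open>flat n\<close> at 0 is the next member but
      for the index shift, so the derivative at 0 is the continuity of
      \<open>flat (n + 1)\<close>.\<close>
    have "flat n h / h = flat (n + 1) h" for h
      unfolding flat_def by (simp add: mult.commute)
    moreover have zero: "flat m 0 = 0" for m
      by (simp add: flat_def)
    moreover have "(flat (n + 1) \<longlongrightarrow> 0) (at 0)"
      using isCont_flat[where n = "n + 1" and t = 0] unfolding isCont_def zero .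
    ultimately show ?thesis unfolding 2 has_field_derivative_iff by simp
  qed
qed

lemma Ck_flat: "Ck k (flat n)"
proof (induction k arbitrary: n)
  case 0
  then show ?case using isCont_flat by (simp add: continuous_at_imp_continuous_on)
next
  case (Suc k)
  show ?case
    by (rule Ck_realI[OF DERIV_flat]) (intro Ck_add Ck_mult Ck_const Suc.IH)
qed

section \<open>Smooth cutoffs and truncations of the Cauchy kernel\<close>

text \<open>The support is the interval from 1 to 2, away from 0, and the argument will always be a
  squared norm divided by a scale. Both keep the composites smooth at the origin, where the norm is
  not differentiable.\<close>

definition bump :: "real \<Rightarrow> real" where
  "bump t = flat 0 (t - 1) * flat 0 (2 - t)"

definition bump_integral :: "real \<Rightarrow> real" where
  "bump_integral t = integral {0..t} bump"

definition cutoff :: "real \<Rightarrow> real" where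
  "cutoff t = bump_integral t / bump_integral 2"

text \<open>Named because, as the derivative of \<open>cutoff\<close>, it is the radial profile of
  the mollifiers that \<open>dbar\<close> produces from truncated poles.\<close>

definition cutoff' :: "real \<Rightarrow> real" where
  "cutoff' t = bump t / bump_integral 2"

lemma bump_nonneg: "0 \<le> bump t"
  by (simp add: bump_def flat_def)

lemma bump_pos: "1 < t \<Longrightarrow> t < 2 \<Longrightarrow> 0 < bump t"
  by (simp add: bump_def flat_def)

lemma bump_eq_0: "t \<le> 1 \<or> 2 \<le> t \<Longrightarrow> bump t = 0"
  by (auto simp: bump_def flat_def)

lemma Ck_bump: "Ck k bump"
proof -
  have eq: "bump = (\<lambda>t. flat 0 (t - 1) * flat 0 (2 - t))"
    by (auto simp: bump_def)
  have 1: "Ck k (\<lambda>t::real. t + (- 1))"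
    by (rule Ck_add[OF Ck_bounded_linear[OF bounded_linear_ident] Ck_const])
  have 2: "Ck k (\<lambda>t::real. 2 + (- t))"
    by (rule Ck_add[OF Ck_const Ck_bounded_linear]) (intro bounded_linear_minus bounded_linear_ident)
  show ?thesis unfolding eq
    using Ck_mult[OF Ck_compose_real[OF Ck_flat[of k 0] 1] Ck_compose_real[OF Ck_flat[of k 0] 2]]
    by simp
qed

lemma continuous_on_bump: "continuous_on A bump"
  using Ck_bump[of 0] continuous_on_subset by auto

lemma DERIV_bump_integral: "(bump_integral has_real_derivative bump t) (at t)"
proof (cases "t < 1")
  \<comment> \<open>Below 1 the integral is locally zero, so the fact that \<open>{0..t}\<close> is
    empty for negative \<open>t\<close> does no harm. From 1 on, \<open>t\<close> is interior to
    \<open>{0..t + 1}\<close> and the derivative within that interval is the full one.\<close>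
  case True
  have "bump_integral s = 0" if "s < 1" for s
  proof -
    have "integral {0..s} bump = integral {0..s} (\<lambda>_. 0)"
      by (rule integral_cong) (use that in \<open>simp add: bump_eq_0\<close>)
    then show ?thesis by (simp add: bump_integral_def)
  qed
  then have "(bump_integral has_real_derivative 0) (at t)"
    using True by (auto intro: has_field_derivative_transform_within_open[of "\<lambda>t. 0" _ _ "{..<1}"])
  then show ?thesis using True by (simp add: bump_eq_0)
next
  case False
  have "((\<lambda>s. integral {0..s} bump) has_real_derivative bump t) (at t within {0..t + 1})"
    by (rule integral_has_real_derivative) (use False continuous_on_bump in auto)
  moreover have "at t within {0..t + 1} = at t"
    by (rule at_within_interior) (use False in auto)
  ultimately show ?thesis unfolding bump_integral_def[abs_def] by simp
qed

lemma bump_integral_mono: "s \<le> t \<Longrightarrow> bump_integral s \<le> bump_integral t"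
  by (rule DERIV_nonneg_imp_nondecreasing[where f = bump_integral])
    (assumption, rule exI, rule conjI[OF DERIV_bump_integral bump_nonneg])

lemma bump_integral_eq_0: "t \<le> 1 \<Longrightarrow> bump_integral t = 0"
proof -
  assume "t \<le> 1"
  then have "integral {0..t} bump = integral {0..t} (\<lambda>_. 0)"
    by (intro integral_cong) (simp add: bump_eq_0)
  then show ?thesis by (simp add: bump_integral_def)
qed

lemma bump_integral_eq: "2 \<le> t \<Longrightarrow> bump_integral t = bump_integral 2"
proof (cases "t = 2")
  case False
  assume "2 \<le> t"
  show ?thesis
  proof (rule DERIV_isconst_end[where f = bump_integral])
    show "2 < t" using False \<open>2 \<le> t\<close> by simp
    show "continuous_on {2..t} bump_integral"
      by (rule DERIV_continuous_on[OF has_field_derivative_at_within[OF DERIV_bump_integral]])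
    show "(bump_integral has_real_derivative 0) (at x)" if "2 < x" for x
      using DERIV_bump_integral[of x] that by (simp add: bump_eq_0)
  qed
qed simp

lemma bump_integral_pos: "0 < bump_integral 2"
proof -
  have "bump_integral 1 < bump_integral 2"
  proof (rule DERIV_pos_imp_increasing_open[where f = bump_integral])
    show "\<exists>y. (bump_integral has_real_derivative y) (at x) \<and> 0 < y" if "1 < x" "x < 2" for x
      using DERIV_bump_integral bump_pos[OF that] by blast
    show "continuous_on {1..2} bump_integral"
      by (rule DERIV_continuous_on[OF has_field_derivative_at_within[OF DERIV_bump_integral]])
  qed simp
  then show ?thesis by (simp add: bump_integral_eq_0)
qed

lemma DERIV_cutoff: "(cutoff has_real_derivative cutoff' t) (at t)"
  unfolding cutoff_def[abs_def] cutoff'_def by (rule DERIV_cdivide[OF DERIV_bump_integral])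

lemma Ck_cutoff: "Ck k cutoff"
proof -
  have "Ck k cutoff'"
    using Ck_mult[OF Ck_bump Ck_const[of k "inverse (bump_integral 2)"]]
    by (simp add: cutoff'_def[abs_def] divide_inverse)
  then show ?thesis by (rule Ck_Suc_lower[OF Ck_realI[OF DERIV_cutoff]])
qed

lemma cutoff'_nonneg: "0 \<le> cutoff' t"
  using bump_integral_pos by (simp add: cutoff'_def bump_nonneg)

lemma cutoff'_pos: "1 < t \<Longrightarrow> t < 2 \<Longrightarrow> 0 < cutoff' t"
  using bump_integral_pos by (simp add: cutoff'_def bump_pos)

lemma cutoff'_eq_0: "t \<le> 1 \<or> 2 \<le> t \<Longrightarrow> cutoff' t = 0"
  by (auto simp: cutoff'_def bump_eq_0)

lemma continuous_on_cutoff': "continuous_on A cutoff'"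
  unfolding cutoff'_def[abs_def] using bump_integral_pos
  by (intro continuous_intros continuous_on_bump) auto

lemma cutoff'_bounded: obtains M where "M > 0" "\<And>t. cutoff' t \<le> M"
proof -
  have "compact (cutoff' ` {1..2})"
    by (intro compact_continuous_image continuous_on_cutoff') simp
  then have "bounded (cutoff' ` {1..2})" by (rule compact_imp_bounded)
  then obtain M where M: "\<forall>t\<in>{1..2}. \<bar>cutoff' t\<bar> \<le> M"
    by (auto simp: bounded_iff)
  have "cutoff' t \<le> max M 1" for t
  proof (cases "t \<in> {1..2}")
    case True
    then show ?thesis using M by fastforce
  next
    case False
    then have "cutoff' t = 0" by (intro cutoff'_eq_0) auto
    then show ?thesis by simp
  qed
  then show thesis using that[of "max M 1"] by auto
qed

lemma cutoff_mono: "s \<le> t \<Longrightarrow> cutoff s \<le> cutoff t"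
  unfolding cutoff_def using bump_integral_pos
  by (intro divide_right_mono bump_integral_mono) auto

lemma cutoff_eq_0: "t \<le> 1 \<Longrightarrow> cutoff t = 0"
  by (simp add: cutoff_def bump_integral_eq_0)

lemma cutoff_eq_1: "2 \<le> t \<Longrightarrow> cutoff t = 1"
  using bump_integral_pos by (simp add: cutoff_def bump_integral_eq[of t])

lemma cutoff_nonneg: "0 \<le> cutoff t"
  using cutoff_mono[of 1 t] cutoff_eq_0[of 1] cutoff_eq_0[of t] by linarith

lemma cutoff_le_1: "cutoff t \<le> 1"
  using cutoff_mono[of t 2] cutoff_eq_1[of 2] cutoff_eq_1[of t] by linarith

text \<open>Identifying the plane with the complex numbers, \<open>czeta\<close> is the conjugate coordinate and
  \<open>cpole \<mu> z\<close> stands for \<open>\<mu>(|z|\<^sup>2) / z\<close>, written so that it is visibly smooth when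
  \<open>\<mu>\<close> vanishes near \<open>0\<close>; its \<open>\<partial>\<close>-bar derivative is \<open>\<mu>'(|z|\<^sup>2)\<close>.\<close>

definition czeta :: "real \<times> real \<Rightarrow> complex" where
  "czeta z = Complex (fst z) (- snd z)"

definition cpole :: "(real \<Rightarrow> real) \<Rightarrow> real \<times> real \<Rightarrow> complex" where
  "cpole \<mu> z = czeta z * of_real (\<mu> ((norm z)\<^sup>2) / (norm z)\<^sup>2)"

lemma bounded_linear_czeta: "bounded_linear czeta"
proof -
  have "czeta = (\<lambda>z. of_real (fst z) - \<i> * of_real (snd z))"
    by (auto simp: czeta_def complex_eq_iff)
  moreover have "bounded_linear (\<lambda>z::real\<times>real. of_real (fst z) - \<i> * of_real (snd z))"
    by (intro bounded_linear_sub bounded_linear_compose[OF bounded_linear_mult_right]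
       bounded_linear_compose[OF bounded_linear_of_real] bounded_linear_fst bounded_linear_snd)
  ultimately show ?thesis by simp
qed

lemma norm_czeta: "norm (czeta z) = norm z"
  by (cases z) (simp add: czeta_def cmod_def norm_Pair)

lemma Ck_norm_sq: "Ck k (\<lambda>z::real\<times>real. (norm (z - x))\<^sup>2)"
proof -
  have 1: "Ck k (\<lambda>z::real\<times>real. L z + (- L x))" if "bounded_linear L" for L :: "real\<times>real \<Rightarrow> real"
    by (rule Ck_add[OF Ck_bounded_linear[OF that] Ck_const])
  have "(\<lambda>z::real\<times>real. (norm (z - x))\<^sup>2) =
      (\<lambda>z. (fst z + (- fst x)) ^ 2 + (snd z + (- snd x)) ^ 2)"
    by (auto simp: norm_prod_def power2_eq_square)
  then show ?thesis
    by (simp only:) (rule Ck_add[OF Ck_power[OF 1[OF bounded_linear_fst]] Ck_power[OF 1[OF bounded_linear_snd]]])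
qed

lemma Ck_cpole:
  assumes "\<And>k. Ck k \<mu>" "\<delta> > 0" "\<And>t. t < \<delta> \<Longrightarrow> \<mu> t = 0"
  shows "Ck k (\<lambda>z. cpole \<mu> (z - x))"
proof -
  have 1: "Ck k (\<lambda>z. czeta (z - x))"
    using Ck_add[OF Ck_bounded_linear[OF bounded_linear_czeta] Ck_const[of k "- czeta x"]]
    by (simp add: linear_diff[OF bounded_linear.linear[OF bounded_linear_czeta]])
  have 2: "Ck k (\<lambda>t. \<mu> t / t)"
    by (rule Ck_divide_id[OF assms(2,1,3)])
  have 3: "Ck k (\<lambda>z. complex_of_real (\<mu> ((norm (z - x))\<^sup>2) / (norm (z - x))\<^sup>2))"
    by (rule Ck_compose_bounded_linear[OF bounded_linear_of_real Ck_compose_real[OF 2 Ck_norm_sq]])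
  show ?thesis unfolding cpole_def[abs_def] by (rule Ck_mult[OF 1 3])
qed

lemma norm_cpole: "norm (cpole \<mu> z) = \<bar>\<mu> ((norm z)\<^sup>2)\<bar> / norm z"
  by (simp add: cpole_def norm_mult norm_czeta power2_eq_square norm_divide)

section \<open>Algebra of the Cauchy-Riemann operator\<close>

lemma dbar_mult:
  assumes "f differentiable (at z)" "g differentiable (at z)"
  shows "dbar (\<lambda>z. f z * g z) z = dbar f z * g z + f z * dbar g z"
proof -
  have "((\<lambda>z. f z * g z) has_derivative
      (\<lambda>h. f z * frechet_derivative g (at z) h + frechet_derivative f (at z) h * g z)) (at z)"
    using assms by (intro has_derivative_mult) (simp_all add: frechet_derivative_works[symmetric])
  from frechet_derivative_at[OF this, symmetric] show ?thesis
    by (simp add: dbar_def algebra_simps)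
qed

lemma dbar_const: "dbar (\<lambda>z. c) z = 0"
  by (simp add: dbar_def)

lemma dbar_power_eq_0:
  assumes "f differentiable (at z)" "dbar f z = 0"
  shows "dbar (\<lambda>z. f z ^ n) z = 0"
proof (induction n)
  case 0
  show ?case by (simp add: dbar_const)
next
  case (Suc n)
  have "dbar (\<lambda>z. f z * f z ^ n) z = dbar f z * f z ^ n + f z * dbar (\<lambda>z. f z ^ n) z"
    by (rule dbar_mult[OF assms(1) differentiable_power[OF assms(1)]])
  then show ?case using Suc assms(2) by simp
qed

text \<open>Put w = z - x as a complex number and \<mu>(t) = t \<tau>(t), so that the function is
  conj(w) \<tau>(|w|^2). Since \<open>dbar\<close> maps conj(w) to 1 and |w|^2 to w, the product
  rule gives \<tau> + |w|^2 \<tau>', which is the derivative of t \<tau>(t) at |w|^2.\<close>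

lemma dbar_cpole:
  assumes \<mu>: "\<And>t. (\<mu> has_real_derivative \<mu>' t) (at t)" "\<delta> > 0" "\<And>t. t < \<delta> \<Longrightarrow> \<mu> t = 0"
  shows "dbar (\<lambda>z. cpole \<mu> (z - x)) z = of_real (\<mu>' ((norm (z - x))\<^sup>2))"
proof -
  define \<tau> where "\<tau> t = \<mu> t / t" for t
  define r where "r = (norm (z - x))\<^sup>2"
  have \<mu>eq: "\<mu> = (\<lambda>t. t * \<tau> t)"
  proof
    show "\<mu> t = t * \<tau> t" for t
      using assms(2) assms(3)[of 0] by (cases "t = 0") (simp_all add: \<tau>_def)
  qed
  \<comment> \<open>The quotient is differentiable even at \<open>r = 0\<close>: it is identically
    zero below \<open>\<delta>\<close>.\<close>
  obtain \<tau>' where \<tau>': "(\<tau> has_real_derivative \<tau>') (at r)"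
  proof (cases "r < \<delta>")
    case True
    have "(\<tau> has_real_derivative 0) (at r)"
      by (rule has_field_derivative_transform_within_open[of "\<lambda>t. 0" _ _ "{..<\<delta>}"])
        (use True assms in \<open>auto simp: \<tau>_def\<close>)
    then show ?thesis using that by blast
  next
    case False
    then have "r \<noteq> 0" using assms by auto
    then show ?thesis using that DERIV_divide[OF \<mu>(1) DERIV_ident, of r] unfolding \<tau>_def[abs_def] by blast
  qed
  have "(\<mu> has_real_derivative 1 * \<tau> r + \<tau>' * r) (at r)"
    unfolding \<mu>eq by (rule DERIV_mult[OF DERIV_ident \<tau>'])
  then have \<mu>'r: "\<mu>' r = \<tau> r + r * \<tau>'"
    using \<mu>(1)[of r] DERIV_unique by (fastforce simp: mult.commute)
  have D1: "((\<lambda>z. (norm (z - x))\<^sup>2) has_derivative (\<lambda>h. 2 * ((z - x) \<bullet> h))) (at z)"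
    unfolding power2_norm_eq_inner
    by (auto intro!: derivative_eq_intros simp: inner_commute)
  have D2: "((\<lambda>z. \<tau> ((norm (z - x))\<^sup>2)) has_derivative (\<lambda>h. \<tau>' * (2 * ((z - x) \<bullet> h)))) (at z)"
    using diff_chain_at[OF D1, of \<tau> "(*) \<tau>'"] \<tau>' by (simp add: o_def r_def has_field_derivative_def)
  have D3: "((\<lambda>z. czeta (z - x)) has_derivative czeta) (at z)"
  proof -
    have "((\<lambda>z. z - x) has_derivative (\<lambda>h. h)) (at z)"
      by (auto intro!: derivative_eq_intros)
    from bounded_linear.has_derivative[OF bounded_linear_czeta this] show ?thesis .
  qed
  have D: "((\<lambda>z. cpole \<mu> (z - x)) has_derivative
      (\<lambda>h. czeta (z - x) * of_real (\<tau>' * (2 * ((z - x) \<bullet> h))) + czeta h * of_real (\<tau> r))) (at z)"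
    using has_derivative_mult[OF D3 bounded_linear.has_derivative[OF bounded_linear_of_real D2]]
    by (simp add: cpole_def[abs_def] \<tau>_def r_def)
  obtain a b where ab: "z - x = (a, b)" by (cases "z - x")
  have r: "r = a\<^sup>2 + b\<^sup>2" unfolding r_def ab by (simp add: norm_Pair)
  show ?thesis
    unfolding dbar_def frechet_derivative_at[OF D, symmetric] r_def[symmetric] \<mu>'r
    unfolding ab r
    by (simp add: czeta_def complex_eq_iff power2_eq_square algebra_simps)
qed

section \<open>The Hardy--Littlewood--Sobolev inequality\<close>

lemma emeasure_ball_plane: "0 \<le> r \<Longrightarrow> emeasure lborel (ball (x::real \<times> real) r) = ennreal (pi * r\<^sup>2)"
  by (simp add: emeasure_ball unit_ball_vol_2 power2_eq_square)

lemma ennreal_le_suminf: "f j \<le> suminf f" for f :: "nat \<Rightarrow> ennreal"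
  using sum_le_suminf[OF summableI, of "{j}" f] by simp

lemma borel_measurable_cmult_indicator_ball:
  "(\<lambda>y. c * indicator (ball x r) y :: ennreal) \<in> borel_measurable lborel"
proof -
  have [measurable]: "ball x r \<in> sets lborel" by simp
  show ?thesis by measurable
qed

text \<open>Dyadic shells shrinking to \<open>x\<close>: within radius \<open>r / 2 ^ k\<close> but
  outside half of it, the kernel is at most \<open>2 ^ Suc k / r\<close>. Enlarging each shell to
  the full ball leaves a geometric series of ratio 1/2 and loses only a factor 2 against the exact
  value 2 pi r.\<close>

lemma nn_integral_kernel_near:
  fixes x :: "real \<times> real"
  assumes r: "r > 0"
  shows "(\<integral>\<^sup>+ y. ennreal (indicator (ball x r) y / norm (x - y)) \<partial>lborel) \<le> ennreal (4 * pi * r)"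
proof -
  let ?t = "\<lambda>k y. ennreal (2 ^ Suc k / r) * indicator (ball x (r / 2 ^ k)) y"
  have pt: "ennreal (indicator (ball x r) y / norm (x - y)) \<le> (\<Sum>k. ?t k y)" for y
  proof (cases "y \<in> ball x r \<and> y \<noteq> x")
    \<comment> \<open>This case includes \<open>y = x\<close>, where division by zero makes the
      kernel 0.\<close>
    case False
    then show ?thesis by (auto simp: indicator_def)
  next
    case True
    define n where "n = norm (x - y)"
    have n: "0 < n" "n < r" using True by (auto simp: n_def dist_norm)
    have "\<exists>k. r / 2 ^ k \<le> n"
    proof -
      obtain k where "(1 / 2) ^ k < n / r"
        using real_arch_pow_inv[of "n / r" "1 / 2"] n r by auto
      then show ?thesis using r by (intro exI[of _ k]) (simp add: field_simps power_divide)
    qed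
    define k where "k = (LEAST k. r / 2 ^ k \<le> n)"
    have k: "r / 2 ^ k \<le> n" unfolding k_def using \<open>\<exists>k. r / 2 ^ k \<le> n\<close> by (rule LeastI_ex)
    then obtain j where j: "k = Suc j" using n by (cases k) auto
    have j': "n < r / 2 ^ j"
      using not_less_Least[of j "\<lambda>k. r / 2 ^ k \<le> n"] j by (auto simp: k_def[symmetric])
    have "ennreal (indicator (ball x r) y / norm (x - y)) = ennreal (1 / n)"
      using True by (simp add: n_def)
    also have "\<dots> \<le> ennreal (2 ^ Suc j / r)"
      using k j n r by (intro ennreal_leI) (simp add: field_simps)
    also have "\<dots> = ?t j y"
      using j' by (simp add: n_def dist_norm)
    also have "\<dots> \<le> (\<Sum>k. ?t k y)"
      by (rule ennreal_le_suminf)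
    finally show ?thesis .
  qed
  have "(\<integral>\<^sup>+ y. ennreal (indicator (ball x r) y / norm (x - y)) \<partial>lborel)
      \<le> (\<integral>\<^sup>+ y. (\<Sum>k. ?t k y) \<partial>lborel)"
    by (intro nn_integral_mono pt)
  also have "\<dots> = (\<Sum>k. \<integral>\<^sup>+ y. ?t k y \<partial>lborel)"
    by (rule nn_integral_suminf) (rule borel_measurable_cmult_indicator_ball)
  also have "\<dots> = (\<Sum>k. ennreal (2 * pi * r * (1 / 2) ^ k))"
  proof (intro suminf_cong)
    fix k
    have "(\<integral>\<^sup>+ y. ?t k y \<partial>lborel) = ennreal (2 ^ Suc k / r) * emeasure lborel (ball x (r / 2 ^ k))"
      by (rule nn_integral_cmult_indicator) simp
    also have "\<dots> = ennreal (2 ^ Suc k / r) * ennreal (pi * (r / 2 ^ k)\<^sup>2)"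
      using r by (subst emeasure_ball_plane) auto
    also have "\<dots> = ennreal (2 ^ Suc k / r * (pi * (r / 2 ^ k)\<^sup>2))"
      using r by (subst ennreal_mult) auto
    also have "2 ^ Suc k / r * (pi * (r / 2 ^ k)\<^sup>2) = 2 * pi * r * (1 / 2) ^ k"
      using r by (simp add: field_simps power2_eq_square)
    finally show "(\<integral>\<^sup>+ y. ?t k y \<partial>lborel) = ennreal (2 * pi * r * (1 / 2) ^ k)" .
  qed
  also have "\<dots> = ennreal (2 * pi * r * 2)"
    by (intro suminf_ennreal_eq sums_mult) (use r geometric_sums[of "1/2::real"] in auto)
  finally show ?thesis by (simp add: mult_ac)
qed

text \<open>The same with dyadic shells going outwards. From one shell to the next the area grows by
  4 and the power of the kernel shrinks by \<open>2 powr (- \<sigma>)\<close>, so the ratio is below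
  1 precisely when \<open>\<sigma> > 2\<close>.\<close>

lemma nn_integral_kernel_far:
  fixes x :: "real \<times> real"
  assumes r: "r > 0" and \<sigma>: "\<sigma> > 2"
  shows "(\<integral>\<^sup>+ y. ennreal (indicator (- ball x r) y * (1 / norm (x - y)) powr \<sigma>) \<partial>lborel)
    \<le> ennreal (4 * pi / (1 - 2 powr (2 - \<sigma>)) * r powr (2 - \<sigma>))"
proof -
  define c where "c = 2 powr (2 - \<sigma>)"
  have c: "0 < c" "c < 1" using \<sigma> by (auto simp: c_def powr_less_one)
  let ?t = "\<lambda>k y. ennreal ((1 / (r * 2 ^ k)) powr \<sigma>) * indicator (ball x (r * 2 ^ Suc k)) y"
  have pt: "ennreal (indicator (- ball x r) y * (1 / norm (x - y)) powr \<sigma>) \<le> (\<Sum>k. ?t k y)" for y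
  proof (cases "y \<in> ball x r")
    case True
    then show ?thesis by simp
  next
    case False
    define n where "n = norm (x - y)"
    have n: "r \<le> n" "0 < n" using False r by (auto simp: n_def dist_norm)
    have "\<exists>k. n < r * 2 ^ k"
    proof -
      obtain k where "n / r < 2 ^ k"
        using real_arch_pow[of 2 "n / r"] by auto
      then show ?thesis using r by (intro exI[of _ k]) (simp add: field_simps)
    qed
    define k where "k = (LEAST k. n < r * 2 ^ k)"
    have k: "n < r * 2 ^ k" unfolding k_def using \<open>\<exists>k. n < r * 2 ^ k\<close> by (rule LeastI_ex)
    then obtain j where j: "k = Suc j" using n by (cases k) auto
    have j': "r * 2 ^ j \<le> n"
      using not_less_Least[of j "\<lambda>k. n < r * 2 ^ k"] j by (auto simp: k_def[symmetric])
    have "ennreal (indicator (- ball x r) y * (1 / norm (x - y)) powr \<sigma>) = ennreal ((1 / n) powr \<sigma>)"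
      using False by (simp add: n_def)
    also have "\<dots> \<le> ennreal ((1 / (r * 2 ^ j)) powr \<sigma>)"
      using j' n r \<sigma> by (intro ennreal_leI powr_mono2 divide_left_mono) auto
    also have "\<dots> = ?t j y"
      using k unfolding j by (simp add: n_def dist_norm)
    also have "\<dots> \<le> (\<Sum>k. ?t k y)"
      by (rule ennreal_le_suminf)
    finally show ?thesis .
  qed
  have "(\<integral>\<^sup>+ y. ennreal (indicator (- ball x r) y * (1 / norm (x - y)) powr \<sigma>) \<partial>lborel)
      \<le> (\<integral>\<^sup>+ y. (\<Sum>k. ?t k y) \<partial>lborel)"
    by (intro nn_integral_mono pt)
  also have "\<dots> = (\<Sum>k. \<integral>\<^sup>+ y. ?t k y \<partial>lborel)"
    by (rule nn_integral_suminf) (rule borel_measurable_cmult_indicator_ball)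
  also have "\<dots> = (\<Sum>k. ennreal (4 * pi * r powr (2 - \<sigma>) * c ^ k))"
  proof (intro suminf_cong)
    fix k
    have "(\<integral>\<^sup>+ y. ?t k y \<partial>lborel) = ennreal ((1 / (r * 2 ^ k)) powr \<sigma>) * emeasure lborel (ball x (r * 2 ^ Suc k))"
      by (rule nn_integral_cmult_indicator) simp
    also have "\<dots> = ennreal ((1 / (r * 2 ^ k)) powr \<sigma>) * ennreal (pi * (r * 2 ^ Suc k)\<^sup>2)"
      using r by (subst emeasure_ball_plane) auto
    also have "\<dots> = ennreal ((1 / (r * 2 ^ k)) powr \<sigma> * (pi * (r * 2 ^ Suc k)\<^sup>2))"
      using r by (subst ennreal_mult) auto
    also have "(1 / (r * 2 ^ k)) powr \<sigma> * (pi * (r * 2 ^ Suc k)\<^sup>2) = 4 * pi * r powr (2 - \<sigma>) * c ^ k"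
    proof -
      define a where "a = r * 2 ^ k"
      have a: "a > 0" using r by (simp add: a_def)
      have inv: "(1 / a) powr \<sigma> = a powr (- \<sigma>)"
        using a by (simp add: powr_minus_divide powr_divide)
      have sq: "a powr (- \<sigma>) * a\<^sup>2 = a powr (2 - \<sigma>)"
        using a powr_add[of a "- \<sigma>" 2] by simp
      have "(2 ^ k) powr (2 - \<sigma>) = (2 powr real k) powr (2 - \<sigma>)"
        by (simp add: powr_realpow)
      also have "\<dots> = c ^ k"
        unfolding c_def by (simp add: powr_powr powr_power)
      finally have ck: "a powr (2 - \<sigma>) = r powr (2 - \<sigma>) * c ^ k"
        using r unfolding a_def by (simp add: powr_mult)
      have "(1 / a) powr \<sigma> * (pi * (2 * a)\<^sup>2) = 4 * pi * (a powr (- \<sigma>) * a\<^sup>2)"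
        unfolding inv by (simp add: power2_eq_square)
      then have "(1 / a) powr \<sigma> * (pi * (2 * a)\<^sup>2) = 4 * pi * r powr (2 - \<sigma>) * c ^ k"
        unfolding sq ck by simp
      moreover have "r * 2 ^ Suc k = 2 * a" by (simp add: a_def)
      ultimately show ?thesis unfolding a_def[symmetric] by (simp only:)
    qed
    finally show "(\<integral>\<^sup>+ y. ?t k y \<partial>lborel) = ennreal (4 * pi * r powr (2 - \<sigma>) * c ^ k)" .
  qed
  also have "\<dots> = ennreal (4 * pi * r powr (2 - \<sigma>) * (1 / (1 - c)))"
    by (intro suminf_ennreal_eq sums_mult geometric_sums) (use r c in auto)
  finally show ?thesis by (simp add: c_def)
qed

text \<open>A crude form of Young's inequality: one of the two terms alone dominates the product,
  depending on the side of the threshold \<open>a powr (s - 1) = t / l\<close>. The weight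
  \<open>l\<close> stays free so that the terms can be balanced afterwards.\<close>

lemma young_split:
  fixes a t l s :: real
  assumes "0 \<le> a" "0 \<le> t" "0 < l" "1 < s"
  shows "a * t \<le> l * a powr s + l powr (1 - s / (s - 1)) * t powr (s / (s - 1))"
proof (cases "a powr (s - 1) \<le> t / l")
  case True
  define \<sigma> where "\<sigma> = s / (s - 1)"
  have \<sigma>: "(s - 1) * (\<sigma> - 1) = 1" "\<sigma> - 1 > 0"
    using assms by (simp_all add: \<sigma>_def field_simps)
  have "a = (a powr (s - 1)) powr (\<sigma> - 1)"
    using assms \<sigma> by (simp add: powr_powr)
  also have "\<dots> \<le> (t / l) powr (\<sigma> - 1)"
    using True \<sigma> by (intro powr_mono2) auto
  also have "\<dots> = l powr (1 - \<sigma>) * t powr (\<sigma> - 1)"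
    using assms by (simp add: powr_divide powr_diff)
  finally have "a * t \<le> l powr (1 - \<sigma>) * t powr (\<sigma> - 1) * t"
    using assms by (intro mult_right_mono) auto
  also have "\<dots> = l powr (1 - \<sigma>) * t powr \<sigma>"
    using assms by (cases "t = 0") (auto simp: powr_diff)
  finally show ?thesis using assms by (simp add: \<sigma>_def add_increasing)
next
  case False
  then have "t \<le> l * a powr (s - 1)" using assms by (simp add: field_simps)
  then have "a * t \<le> a * (l * a powr (s - 1))"
    using assms by (intro mult_left_mono) auto
  also have "\<dots> = l * a powr s"
    using assms by (cases "a = 0") (auto simp: powr_diff)
  finally show ?thesis using assms by (simp add: add_increasing2)
qed

text \<open>Near \<open>x\<close> the bound \<open>g \<le> A\<close> is used, and away from \<open>x\<close> the splitting of \<open>young_split\<close>;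
  the radius \<open>A\<^sup>-\<^sup>s\<^sup>/\<^sup>2\<close> balances the two contributions.\<close>

lemma kernel_integral_truncated:
  fixes s :: real
  assumes s: "1 < s" "s < 2"
  obtains K where "K > 0"
    "\<And>(g :: real \<times> real \<Rightarrow> real) A x. g \<in> borel_measurable borel \<Longrightarrow> (\<And>y. 0 \<le> g y) \<Longrightarrow>
      (\<integral>\<^sup>+ y. ennreal (g y powr s) \<partial>lborel) \<le> 1 \<Longrightarrow> A > 0 \<Longrightarrow>
      (\<integral>\<^sup>+ y. ennreal (if g y \<le> A then g y / norm (x - y) else 0) \<partial>lborel)
        \<le> ennreal (K * A powr (1 - s / 2))"
proof -
  define \<sigma> where "\<sigma> = s / (s - 1)"
  have \<sigma>: "\<sigma> > 2" "s * \<sigma> = s + \<sigma>" using s by (simp_all add: \<sigma>_def field_simps)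
  define K where "K = 4 * pi / (1 - 2 powr (2 - \<sigma>))"
  have "2 powr (2 - \<sigma>) < 1" using \<sigma> by (simp add: powr_less_one)
  then have K: "K > 0" by (simp add: K_def)
  show thesis
  proof (rule that[of "4 * pi + 1 + K"])
    show "4 * pi + 1 + K > 0" using K by (simp add: add_pos_pos)
    fix g :: "real \<times> real \<Rightarrow> real" and A :: real and x :: "real \<times> real"
    assume g[measurable]: "g \<in> borel_measurable borel" and g0: "\<And>y. 0 \<le> g y"
      and g1: "(\<integral>\<^sup>+ y. ennreal (g y powr s) \<partial>lborel) \<le> 1" and A: "A > 0"
    \<comment> \<open>The weight \<open>l\<close> equals \<open>A * r\<close>, the size of the near
      part. The term with the far kernel then has this size too, because
      \<open>s * \<sigma> = s + \<sigma>\<close>.\<close>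
    define r l where "r = A powr (- s / 2)" and "l = A powr (1 - s / 2)"
    have r: "r > 0" and l: "l > 0" using A by (auto simp: r_def l_def)
    let ?near = "\<lambda>y. ennreal (indicator (ball x r) y / norm (x - y))"
    let ?far = "\<lambda>y. ennreal (indicator (- ball x r) y * (1 / norm (x - y)) powr \<sigma>)"
    have pt: "ennreal (if g y \<le> A then g y / norm (x - y) else 0)
        \<le> ennreal A * ?near y + (ennreal l * ennreal (g y powr s) + ennreal (l powr (1 - \<sigma>)) * ?far y)" for y
    proof (cases "y \<in> ball x r")
      case True
      have "ennreal (if g y \<le> A then g y / norm (x - y) else 0) \<le> ennreal (A * (1 / norm (x - y)))"
        using A g0[of y] by (intro ennreal_leI) (auto intro!: divide_right_mono)
      also have "\<dots> = ennreal A * ?near y" using True A by (subst ennreal_mult) auto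
      finally show ?thesis by (simp add: add_increasing2)
    next
      case False
      have "ennreal (if g y \<le> A then g y / norm (x - y) else 0) \<le> ennreal (g y * (1 / norm (x - y)))"
        using g0[of y] by (intro ennreal_leI) auto
      also have "\<dots> \<le> ennreal (l * g y powr s + l powr (1 - \<sigma>) * (1 / norm (x - y)) powr \<sigma>)"
        unfolding \<sigma>_def using g0[of y] l s by (intro ennreal_leI young_split) auto
      also have "\<dots> = ennreal l * ennreal (g y powr s) + ennreal (l powr (1 - \<sigma>)) * ?far y"
        using False l by (simp add: ennreal_plus ennreal_mult)
      finally show ?thesis using False by (simp add: add_increasing)
    qed
    have [measurable]: "ball x r \<in> sets borel" by simp
    have m: "?near \<in> borel_measurable borel" "?far \<in> borel_measurable borel"
      "(\<lambda>y. ennreal (g y powr s)) \<in> borel_measurable borel"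
      by measurable
    have "(\<integral>\<^sup>+ y. ennreal (if g y \<le> A then g y / norm (x - y) else 0) \<partial>lborel)
      \<le> (\<integral>\<^sup>+ y. (ennreal A * ?near y + (ennreal l * ennreal (g y powr s) + ennreal (l powr (1 - \<sigma>)) * ?far y)) \<partial>lborel)"
      by (intro nn_integral_mono pt)
    also have "\<dots> = ennreal A * (\<integral>\<^sup>+ y. ?near y \<partial>lborel)
        + (ennreal l * (\<integral>\<^sup>+ y. ennreal (g y powr s) \<partial>lborel)
        + ennreal (l powr (1 - \<sigma>)) * (\<integral>\<^sup>+ y. ?far y \<partial>lborel))"
      using m by (simp add: nn_integral_add nn_integral_cmult)
    also have "\<dots> \<le> ennreal A * ennreal (4 * pi * r) + (ennreal l * 1
        + ennreal (l powr (1 - \<sigma>)) * ennreal (K * r powr (2 - \<sigma>)))"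
      unfolding K_def
      by (intro add_mono mult_left_mono nn_integral_kernel_near nn_integral_kernel_far r g1 \<sigma>) auto
    also have "\<dots> = ennreal (A * (4 * pi * r) + (l + l powr (1 - \<sigma>) * (K * r powr (2 - \<sigma>))))"
      using A r l K by (simp add: ennreal_plus ennreal_mult)
    also have "A * (4 * pi * r) + (l + l powr (1 - \<sigma>) * (K * r powr (2 - \<sigma>)))
        = (4 * pi + 1 + K) * A powr (1 - s / 2)"
    proof -
      have 1: "A * r = A powr (1 - s / 2)"
        using A powr_add[of A 1 "- s / 2"] by (simp add: r_def)
      have "l powr (1 - \<sigma>) * r powr (2 - \<sigma>) = A powr ((1 - s / 2) * (1 - \<sigma>) + (- s / 2) * (2 - \<sigma>))"
        by (simp only: l_def r_def powr_powr powr_add)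
      also have "(1 - s / 2) * (1 - \<sigma>) + (- s / 2) * (2 - \<sigma>) = 1 - s / 2"
        using \<sigma>(2) by (simp add: field_simps)
      finally have 2: "l powr (1 - \<sigma>) * r powr (2 - \<sigma>) = A powr (1 - s / 2)" .
      have "A * (4 * pi * r) + (l + l powr (1 - \<sigma>) * (K * r powr (2 - \<sigma>)))
        = 4 * pi * (A * r) + (l + K * (l powr (1 - \<sigma>) * r powr (2 - \<sigma>)))"
        by (simp add: algebra_simps)
      also have "\<dots> = (4 * pi + 1 + K) * A powr (1 - s / 2)"
        unfolding 1 2 unfolding l_def by (simp add: algebra_simps)
      finally show ?thesis .
    qed
    finally show "(\<integral>\<^sup>+ y. ennreal (if g y \<le> A then g y / norm (x - y) else 0) \<partial>lborel)
        \<le> ennreal ((4 * pi + 1 + K) * A powr (1 - s / 2))" .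
  qed
qed

text \<open>Splitting the pairs \<open>(x, y)\<close> according to whether \<open>g(y)\<^sup>s \<le> f(x)\<^sup>p\<close> makes the truncated
  estimate applicable in one of the two variables, and the exponents then add up to \<open>p\<close> or \<open>s\<close>.\<close>

theorem Hardy_Littlewood_Sobolev_bilinear:
  fixes p s :: real
  assumes p: "1 < p" "p < 2" and s: "1 < s" "s < 2" and ps: "1 / p + 1 / s = 3 / 2"
  obtains C where "C > 0"
    "\<And>f g :: real \<times> real \<Rightarrow> real. f \<in> borel_measurable borel \<Longrightarrow> g \<in> borel_measurable borel \<Longrightarrow>
      (\<And>x. 0 \<le> f x) \<Longrightarrow> (\<And>x. 0 \<le> g x) \<Longrightarrow>
      (\<integral>\<^sup>+ x. ennreal (f x powr p) \<partial>lborel) \<le> 1 \<Longrightarrow> (\<integral>\<^sup>+ y. ennreal (g y powr s) \<partial>lborel) \<le> 1 \<Longrightarrow>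
      (\<integral>\<^sup>+ x. \<integral>\<^sup>+ y. ennreal (f x * g y / norm (x - y)) \<partial>lborel \<partial>lborel) \<le> ennreal C"
proof -
  \<comment> \<open>Kept general in the exponents so that it serves both halves, the second with
    \<open>p\<close>, \<open>s\<close> and \<open>f\<close>, \<open>g\<close> exchanged. The
    truncation level \<open>f x powr (p / s)\<close> is such that the relation between the exponents
    turns the bound for fixed \<open>x\<close> into a multiple of \<open>f x powr p\<close>.\<close>
  have half: "\<integral>\<^sup>+ x. \<integral>\<^sup>+ y. ennreal (f x * (if g y \<le> f x powr (p / s) then g y / norm (x - y) else 0)) \<partial>lborel \<partial>lborel \<le> ennreal K"
    if p: "1 < p" and s: "1 < s" and ps: "1 / p + 1 / s = 3 / 2" and "0 < K"
      and K: "\<And>(g :: real \<times> real \<Rightarrow> real) A x. g \<in> borel_measurable borel \<Longrightarrow> (\<And>y. 0 \<le> g y) \<Longrightarrow>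
      (\<integral>\<^sup>+ y. ennreal (g y powr s) \<partial>lborel) \<le> 1 \<Longrightarrow> A > 0 \<Longrightarrow>
      (\<integral>\<^sup>+ y. ennreal (if g y \<le> A then g y / norm (x - y) else 0) \<partial>lborel)
        \<le> ennreal (K * A powr (1 - s / 2))"
      and [measurable]: "f \<in> borel_measurable borel" "g \<in> borel_measurable borel"
      and f0: "\<And>x. 0 \<le> f x" and g0: "\<And>x. 0 \<le> g x"
      and f1: "(\<integral>\<^sup>+ x. ennreal (f x powr p) \<partial>lborel) \<le> 1"
      and g1: "(\<integral>\<^sup>+ y. ennreal (g y powr s) \<partial>lborel) \<le> 1"
    for p s K :: real and f g :: "real \<times> real \<Rightarrow> real"
  proof -
    have "(\<integral>\<^sup>+ y. ennreal (f x * (if g y \<le> f x powr (p / s) then g y / norm (x - y) else 0)) \<partial>lborel)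
        \<le> ennreal K * ennreal (f x powr p)" for x
    proof (cases "f x = 0")
      case True
      then show ?thesis by simp
    next
      case False
      then have fx: "f x > 0" using f0[of x] by simp
      have "(\<integral>\<^sup>+ y. ennreal (f x * (if g y \<le> f x powr (p / s) then g y / norm (x - y) else 0)) \<partial>lborel)
        = (\<integral>\<^sup>+ y. ennreal (f x) * ennreal (if g y \<le> f x powr (p / s) then g y / norm (x - y) else 0) \<partial>lborel)"
        using f0 g0 by (intro nn_integral_cong) (simp add: ennreal_mult)
      also have "\<dots> = ennreal (f x) * (\<integral>\<^sup>+ y. ennreal (if g y \<le> f x powr (p / s) then g y / norm (x - y) else 0) \<partial>lborel)"
        by (rule nn_integral_cmult) measurable
      also have "\<dots> \<le> ennreal (f x) * ennreal (K * (f x powr (p / s)) powr (1 - s / 2))"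
        using fx by (intro mult_left_mono K g0 g1) auto
      also have "\<dots> = ennreal (f x * (K * (f x powr (p / s)) powr (1 - s / 2)))"
        using f0 \<open>0 < K\<close> by (simp add: ennreal_mult)
      also have "f x * (K * (f x powr (p / s)) powr (1 - s / 2)) = K * f x powr p"
      proof -
        have "p / s * (1 - s / 2) = p * (1 / s) - p / 2" using s by (simp add: field_simps)
        also have "1 / s = 3 / 2 - 1 / p" using ps by simp
        also have "p * (3 / 2 - 1 / p) - p / 2 = p - 1" using p by (simp add: field_simps)
        finally have "(f x powr (p / s)) powr (1 - s / 2) = f x powr (p - 1)" by (simp add: powr_powr)
        then show ?thesis using fx by (simp add: powr_diff)
      qed
      finally show ?thesis using \<open>0 < K\<close> by (simp add: ennreal_mult)
    qed
    then have "(\<integral>\<^sup>+ x. \<integral>\<^sup>+ y. ennreal (f x * (if g y \<le> f x powr (p / s) then g y / norm (x - y) else 0)) \<partial>lborel \<partial>lborel)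
      \<le> (\<integral>\<^sup>+ x. ennreal K * ennreal (f x powr p) \<partial>lborel)" by (intro nn_integral_mono)
    also have "\<dots> = ennreal K * (\<integral>\<^sup>+ x. ennreal (f x powr p) \<partial>lborel)"
      by (rule nn_integral_cmult) measurable
    also have "\<dots> \<le> ennreal K * 1" by (intro mult_left_mono f1) auto
    finally show ?thesis by simp
  qed
  obtain K1 where K1: "K1 > 0" "\<And>(g :: real \<times> real \<Rightarrow> real) A x. g \<in> borel_measurable borel \<Longrightarrow> (\<And>y. 0 \<le> g y) \<Longrightarrow>
      (\<integral>\<^sup>+ y. ennreal (g y powr s) \<partial>lborel) \<le> 1 \<Longrightarrow> A > 0 \<Longrightarrow>
      (\<integral>\<^sup>+ y. ennreal (if g y \<le> A then g y / norm (x - y) else 0) \<partial>lborel)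
        \<le> ennreal (K1 * A powr (1 - s / 2))"
    by (rule kernel_integral_truncated[OF s]) blast
  obtain K2 where K2: "K2 > 0" "\<And>(g :: real \<times> real \<Rightarrow> real) A x. g \<in> borel_measurable borel \<Longrightarrow> (\<And>y. 0 \<le> g y) \<Longrightarrow>
      (\<integral>\<^sup>+ y. ennreal (g y powr p) \<partial>lborel) \<le> 1 \<Longrightarrow> A > 0 \<Longrightarrow>
      (\<integral>\<^sup>+ y. ennreal (if g y \<le> A then g y / norm (x - y) else 0) \<partial>lborel)
        \<le> ennreal (K2 * A powr (1 - p / 2))"
    by (rule kernel_integral_truncated[OF p]) blast
  show thesis
  proof (rule that[of "K1 + K2"])
    show "K1 + K2 > 0" using K1 K2 by simp
    fix f g :: "real \<times> real \<Rightarrow> real"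
    assume [measurable]: "f \<in> borel_measurable borel" "g \<in> borel_measurable borel"
      and f0: "\<And>x. 0 \<le> f x" and g0: "\<And>x. 0 \<le> g x"
      and f1: "(\<integral>\<^sup>+ x. ennreal (f x powr p) \<partial>lborel) \<le> 1"
      and g1: "(\<integral>\<^sup>+ y. ennreal (g y powr s) \<partial>lborel) \<le> 1"
    let ?a = "\<lambda>x y. ennreal (f x * (if g y \<le> f x powr (p / s) then g y / norm (x - y) else 0))"
    let ?b = "\<lambda>x y. ennreal (g y * (if f x \<le> g y powr (s / p) then f x / norm (y - x) else 0))"
    have pt: "ennreal (f x * g y / norm (x - y)) \<le> ?a x y + ?b x y" for x y
    proof (cases "g y \<le> f x powr (p / s)")
      case True
      then show ?thesis by (simp add: add_increasing2)
    next
      case False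
      have "f x = (f x powr (p / s)) powr (s / p)" using f0[of x] p s by (simp add: powr_powr)
      also have "\<dots> \<le> g y powr (s / p)" using False p s by (intro powr_mono2) auto
      finally show ?thesis by (simp add: add_increasing mult.commute norm_minus_commute)
    qed
    have "(\<integral>\<^sup>+ x. \<integral>\<^sup>+ y. ennreal (f x * g y / norm (x - y)) \<partial>lborel \<partial>lborel)
        \<le> (\<integral>\<^sup>+ x. \<integral>\<^sup>+ y. (?a x y + ?b x y) \<partial>lborel \<partial>lborel)"
      by (intro nn_integral_mono pt)
    also have "\<dots> = (\<integral>\<^sup>+ x. ((\<integral>\<^sup>+ y. ?a x y \<partial>lborel) + (\<integral>\<^sup>+ y. ?b x y \<partial>lborel)) \<partial>lborel)"
      by (intro nn_integral_cong nn_integral_add) measurable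
    also have "\<dots> = (\<integral>\<^sup>+ x. \<integral>\<^sup>+ y. ?a x y \<partial>lborel \<partial>lborel) + (\<integral>\<^sup>+ x. \<integral>\<^sup>+ y. ?b x y \<partial>lborel \<partial>lborel)"
      by (rule nn_integral_add) measurable
    also have "(\<integral>\<^sup>+ x. \<integral>\<^sup>+ y. ?b x y \<partial>lborel \<partial>lborel) = (\<integral>\<^sup>+ y. \<integral>\<^sup>+ x. ?b x y \<partial>lborel \<partial>lborel)"
      by (rule lborel_pair.Fubini'[symmetric]) measurable
    also have "(\<integral>\<^sup>+ x. \<integral>\<^sup>+ y. ?a x y \<partial>lborel \<partial>lborel) + \<dots> \<le> ennreal K1 + ennreal K2"
    proof (intro add_mono)
      show "(\<integral>\<^sup>+ x. \<integral>\<^sup>+ y. ?a x y \<partial>lborel \<partial>lborel) \<le> ennreal K1"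
        by (rule half[of p s K1 f g, OF p(1) s(1) ps K1]) (use f0 g0 f1 g1 in auto)
      show "(\<integral>\<^sup>+ y. \<integral>\<^sup>+ x. ?b x y \<partial>lborel \<partial>lborel) \<le> ennreal K2"
        by (rule half[of s p K2 g f, OF s(1) p(1) _ K2]) (use f0 g0 f1 g1 ps in auto)
    qed
    also have "\<dots> = ennreal (K1 + K2)" using K1 K2 by simp
    finally show "(\<integral>\<^sup>+ x. \<integral>\<^sup>+ y. ennreal (f x * g y / norm (x - y)) \<partial>lborel \<partial>lborel) \<le> ennreal (K1 + K2)" .
  qed
qed

text \<open>The dual form, obtained by pairing \<open>f\<close> with its own extremal function.
  Assuming that \<open>f\<close> is dominated by the potential, instead of bounding the norm of the
  potential, fits the later use, where \<open>f\<close> is known to lie in L^q and only an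
  inequality almost everywhere is available.\<close>

lemma Hardy_Littlewood_Sobolev:
  fixes p q :: real
  assumes p: "1 < p" "p < 2" and q: "2 < q" and pq: "1 / p - 1 / q = 1 / 2"
  obtains C where "C > 0"
    "\<And>(f :: real \<times> real \<Rightarrow> real) h X b. f \<in> borel_measurable borel \<Longrightarrow> h \<in> borel_measurable borel \<Longrightarrow>
      (\<And>x. 0 \<le> f x) \<Longrightarrow> (\<And>x. 0 \<le> h x) \<Longrightarrow> 0 < b \<Longrightarrow> 0 \<le> X \<Longrightarrow>
      (\<integral>\<^sup>+ x. ennreal (f x powr q) \<partial>lborel) = ennreal (X powr q) \<Longrightarrow>
      (\<integral>\<^sup>+ y. ennreal (h y powr p) \<partial>lborel) \<le> ennreal (b powr p) \<Longrightarrow>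
      AE x in lborel. ennreal (f x) \<le> (\<integral>\<^sup>+ y. ennreal (h y / norm (x - y)) \<partial>lborel) \<Longrightarrow>
      X \<le> C * b"
proof -
  define s where "s = q / (q - 1)"
  have s: "1 < s" "s < 2" "s * (q - 1) = q" using q by (simp_all add: s_def field_simps)
  have "1 / s = 1 - 1 / q" using q by (simp add: s_def field_simps)
  then have ps: "1 / s + 1 / p = 3 / 2" using pq by simp
  obtain C where C: "C > 0"
    "\<And>f g :: real \<times> real \<Rightarrow> real. f \<in> borel_measurable borel \<Longrightarrow> g \<in> borel_measurable borel \<Longrightarrow>
      (\<And>x. 0 \<le> f x) \<Longrightarrow> (\<And>x. 0 \<le> g x) \<Longrightarrow>
      (\<integral>\<^sup>+ x. ennreal (f x powr s) \<partial>lborel) \<le> 1 \<Longrightarrow> (\<integral>\<^sup>+ y. ennreal (g y powr p) \<partial>lborel) \<le> 1 \<Longrightarrow>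
      (\<integral>\<^sup>+ x. \<integral>\<^sup>+ y. ennreal (f x * g y / norm (x - y)) \<partial>lborel \<partial>lborel) \<le> ennreal C"
    by (rule Hardy_Littlewood_Sobolev_bilinear[OF s(1,2) p ps]) blast
  show thesis
  proof (rule that[OF C(1)])
    fix f h :: "real \<times> real \<Rightarrow> real" and X b :: real
    assume [measurable]: "f \<in> borel_measurable borel" "h \<in> borel_measurable borel"
      and f0: "\<And>x. 0 \<le> f x" and h0: "\<And>x. 0 \<le> h x" and b: "0 < b" and X: "0 \<le> X"
      and fX: "(\<integral>\<^sup>+ x. ennreal (f x powr q) \<partial>lborel) = ennreal (X powr q)"
      and hb: "(\<integral>\<^sup>+ y. ennreal (h y powr p) \<partial>lborel) \<le> ennreal (b powr p)"
      and fh: "AE x in lborel. ennreal (f x) \<le> (\<integral>\<^sup>+ y. ennreal (h y / norm (x - y)) \<partial>lborel)"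
    show "X \<le> C * b"
    proof (cases "X = 0")
      case True
      then show ?thesis using b C by simp
    next
      case False
      then have X: "X > 0" using X by simp
      \<comment> \<open>The extremal function of duality: with \<open>s\<close> conjugate to
        \<open>q\<close>, it has norm 1 in L^s and its pairing with \<open>f\<close> equals
        \<open>X\<close>.\<close>
      define g where "g x = (f x / X) powr (q - 1)" for x
      have [measurable]: "g \<in> borel_measurable borel" unfolding g_def[abs_def] by measurable
      have "(\<integral>\<^sup>+ x. ennreal (g x powr s) \<partial>lborel) = (\<integral>\<^sup>+ x. ennreal (1 / X powr q) * ennreal (f x powr q) \<partial>lborel)"
      proof (intro nn_integral_cong)
        fix x
        have "g x powr s = 1 / X powr q * f x powr q"
          using s(3) f0[of x] X by (simp add: g_def powr_powr powr_divide mult.commute)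
        then show "ennreal (g x powr s) = ennreal (1 / X powr q) * ennreal (f x powr q)"
          by (simp only:) (rule ennreal_mult; simp)
      qed
      also have "\<dots> = ennreal (1 / X powr q) * (\<integral>\<^sup>+ x. ennreal (f x powr q) \<partial>lborel)"
        by (rule nn_integral_cmult) measurable
      also have "\<dots> = 1" unfolding fX using X by (simp add: ennreal_mult[symmetric])
      finally have g1: "(\<integral>\<^sup>+ x. ennreal (g x powr s) \<partial>lborel) \<le> 1" by simp
      have "(\<integral>\<^sup>+ x. ennreal ((h x / b) powr p) \<partial>lborel) = (\<integral>\<^sup>+ x. ennreal (1 / b powr p) * ennreal (h x powr p) \<partial>lborel)"
      proof (intro nn_integral_cong)
        fix x
        have "(h x / b) powr p = 1 / b powr p * h x powr p"
          using h0[of x] b by (simp add: powr_divide)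
        then show "ennreal ((h x / b) powr p) = ennreal (1 / b powr p) * ennreal (h x powr p)"
          by (simp only:) (rule ennreal_mult; simp)
      qed
      also have "\<dots> = ennreal (1 / b powr p) * (\<integral>\<^sup>+ x. ennreal (h x powr p) \<partial>lborel)"
        by (rule nn_integral_cmult) measurable
      also have "\<dots> \<le> ennreal (1 / b powr p) * ennreal (b powr p)"
        by (intro mult_left_mono hb) auto
      also have "\<dots> = 1" using b by (simp add: ennreal_mult[symmetric])
      finally have h1: "(\<integral>\<^sup>+ x. ennreal ((h x / b) powr p) \<partial>lborel) \<le> 1" .
      have "ennreal (X / b) = ennreal (1 / (b * X powr (q - 1))) * ennreal (X powr q)"
        using X b by (subst ennreal_mult[symmetric]) (auto simp: powr_diff)
      also have "\<dots> = (\<integral>\<^sup>+ x. ennreal (1 / (b * X powr (q - 1))) * ennreal (f x powr q) \<partial>lborel)"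
        unfolding fX[symmetric] by (rule nn_integral_cmult[symmetric]) measurable
      also have "\<dots> = (\<integral>\<^sup>+ x. ennreal (g x / b) * ennreal (f x) \<partial>lborel)"
      proof (intro nn_integral_cong)
        fix x
        have "1 / (b * X powr (q - 1)) * f x powr q = g x / b * f x"
          using f0[of x] X b by (cases "f x = 0") (auto simp: g_def powr_divide powr_diff mult.commute)
        then show "ennreal (1 / (b * X powr (q - 1))) * ennreal (f x powr q) = ennreal (g x / b) * ennreal (f x)"
          using f0[of x] X b by (simp add: ennreal_mult[symmetric] g_def)
      qed
      also have "\<dots> \<le> (\<integral>\<^sup>+ x. ennreal (g x / b) * (\<integral>\<^sup>+ y. ennreal (h y / norm (x - y)) \<partial>lborel) \<partial>lborel)"
        by (intro nn_integral_mono_AE) (use fh in eventually_elim, auto intro: mult_left_mono)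
      also have "\<dots> = (\<integral>\<^sup>+ x. \<integral>\<^sup>+ y. ennreal (g x / b) * ennreal (h y / norm (x - y)) \<partial>lborel \<partial>lborel)"
        by (intro nn_integral_cong nn_integral_cmult[symmetric]) measurable
      also have "\<dots> = (\<integral>\<^sup>+ x. \<integral>\<^sup>+ y. ennreal (g x * (h y / b) / norm (x - y)) \<partial>lborel \<partial>lborel)"
        using b h0 by (intro nn_integral_cong) (subst ennreal_mult[symmetric]; simp add: g_def)
      also have "\<dots> \<le> ennreal C"
        by (rule C(2)[OF _ _ _ _ g1 h1]) (use b h0 in \<open>auto simp: g_def\<close>)
      finally have "X / b \<le> C" using C(1) by simp
      then show ?thesis using b by (simp add: field_simps)
    qed
  qed
qed

section \<open>Recovering a function from mollifications\<close>

text \<open>The form is dictated by \<open>dbar_pole\<close>: this is the image under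
  \<open>dbar\<close> of a pole truncated at squared radius \<open>\<epsilon>\<close>. The parameter
  scales like an area, so the mass is the same for all \<open>\<epsilon>\<close>. It is pi, but only
  its being positive and finite matters.\<close>

definition moll :: "real \<Rightarrow> real \<times> real \<Rightarrow> real" where
  "moll \<epsilon> z = cutoff' ((norm z)\<^sup>2 / \<epsilon>) / \<epsilon>"

definition moll_mass :: real where
  "moll_mass = enn2real (\<integral>\<^sup>+ z. ennreal (moll 1 z) \<partial>lborel)"

lemma borel_measurable_moll [measurable]: "moll \<epsilon> \<in> borel_measurable borel"
proof -
  have [measurable]: "cutoff' \<in> borel_measurable borel"
    by (rule borel_measurable_continuous_onI[OF continuous_on_cutoff'])
  show ?thesis unfolding moll_def[abs_def] by measurable
qed

lemma moll_nonneg: "\<epsilon> > 0 \<Longrightarrow> 0 \<le> moll \<epsilon> z"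
  by (simp add: moll_def cutoff'_nonneg)

lemma moll_eq_0: "\<epsilon> > 0 \<Longrightarrow> 2 * \<epsilon> \<le> (norm z)\<^sup>2 \<Longrightarrow> moll \<epsilon> z = 0"
  by (simp add: moll_def cutoff'_eq_0 field_simps)

lemma moll_scale: "\<epsilon> > 0 \<Longrightarrow> \<epsilon> * moll \<epsilon> (sqrt \<epsilon> *\<^sub>R z) = moll 1 z"
  by (simp add: moll_def power_mult_distrib)

lemma nn_integral_moll_1: "(\<integral>\<^sup>+ z. ennreal (moll 1 z) \<partial>lborel) = ennreal moll_mass"
proof -
  obtain M where M: "M > 0" "\<And>t. cutoff' t \<le> M" using cutoff'_bounded by blast
  have "ennreal (moll 1 z) \<le> ennreal M * indicator (ball 0 2) z" for z
  proof (cases "norm z < 2")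
    case True
    then show ?thesis using M by (simp add: moll_def ennreal_leI)
  next
    case False
    then have "2\<^sup>2 \<le> (norm z)\<^sup>2" by (intro power_mono) auto
    then have "moll 1 z = 0" by (intro moll_eq_0) auto
    then show ?thesis by simp
  qed
  then have "(\<integral>\<^sup>+ z. ennreal (moll 1 z) \<partial>lborel) \<le> (\<integral>\<^sup>+ z. ennreal M * indicator (ball (0::real\<times>real) 2) z \<partial>lborel)"
    by (rule nn_integral_mono)
  also have "\<dots> = ennreal M * emeasure lborel (ball (0::real\<times>real) 2)"
    by (rule nn_integral_cmult_indicator) simp
  also have "\<dots> < \<infinity>"
    by (simp add: ennreal_mult_less_top emeasure_ball_plane)
  finally show ?thesis by (simp add: moll_mass_def)
qed

lemma moll_mass_pos: "moll_mass > 0"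
proof (rule ccontr)
  assume "\<not> moll_mass > 0"
  then have "(\<integral>\<^sup>+ z. ennreal (moll 1 z) \<partial>lborel) = 0"
    unfolding nn_integral_moll_1 by (simp add: ennreal_neg)
  then have "AE z in lborel. ennreal (moll 1 z) = 0"
    by (subst (asm) nn_integral_0_iff_AE) auto
  then have "AE z::real\<times>real in lborel. \<not> (1 < norm z \<and> norm z < sqrt 2)"
  proof eventually_elim
    case (elim z)
    show ?case
    proof
      assume z: "1 < norm z \<and> norm z < sqrt 2"
      then have "1 < (norm z)\<^sup>2" by (simp add: power2_eq_square less_1_mult)
      moreover have "(norm z)\<^sup>2 < 2" using z real_less_rsqrt real_sqrt_less_iff
        by (metis norm_ge_zero real_sqrt_abs abs_of_nonneg)
      ultimately show False using elim cutoff'_pos[of "(norm z)\<^sup>2"] by (simp add: moll_def ennreal_eq_0_iff)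
    qed
  qed
  then have "AE z in lebesgue. z \<notin> {z::real\<times>real. 1 < norm z \<and> norm z < sqrt 2}"
    by (intro AE_completion) simp
  then have "{z::real\<times>real. 1 < norm z \<and> norm z < sqrt 2} \<in> null_sets lebesgue"
    by (simp add: AE_iff_null_sets borel_open open_Collect_conj open_Collect_less continuous_on_norm)
  then have "negligible {z::real\<times>real. 1 < norm z \<and> norm z < sqrt 2}"
    by (simp add: negligible_iff_null_sets)
  moreover have "open {z::real\<times>real. 1 < norm z \<and> norm z < sqrt 2}"
    by (intro open_Collect_conj open_Collect_less continuous_intros)
  \<comment> \<open>A witness that the annulus is non-empty: 36/25 lies between 1 and 2.\<close>
  moreover have "(6/5, 0) \<in> {z::real\<times>real. 1 < norm z \<and> norm z < sqrt 2}"
    by (auto simp: norm_Pair intro!: real_less_rsqrt simp: power2_eq_square)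
  ultimately show False using open_not_negligible by blast
qed

lemma nn_integral_moll:
  assumes "\<epsilon> > 0"
  shows "(\<integral>\<^sup>+ x. ennreal (moll \<epsilon> (y - x)) \<partial>lborel) = ennreal moll_mass"
proof -
  \<comment> \<open>The sign turns \<open>y - (y + c *\<^sub>R x)\<close> into
    \<open>sqrt \<epsilon> *\<^sub>R x\<close>, and the Jacobian, the square of \<open>c\<close>,
    cancels the normalising factor \<open>1 / \<epsilon>\<close>.\<close>
  define c where "c = - sqrt \<epsilon>"
  have c: "c \<noteq> 0" "\<bar>c\<bar> ^ 2 = \<epsilon>" using assms by (auto simp: c_def)
  have [measurable]: "(\<lambda>x. y + c *\<^sub>R x) \<in> borel_measurable borel" by simp
  have "(\<integral>\<^sup>+ x. ennreal (moll \<epsilon> (y - x)) \<partial>lborel)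
      = (\<integral>\<^sup>+ x. ennreal (moll \<epsilon> (y - x)) \<partial>density (distr lborel borel (\<lambda>x. y + c *\<^sub>R x)) (\<lambda>_. \<bar>c\<bar> ^ 2))"
    by (rule arg_cong[where f = "\<lambda>M. integral\<^sup>N M _"])
      (use lborel_affine[OF c(1), of y] in \<open>simp add: power2_eq_square\<close>)
  also have "\<dots> = (\<integral>\<^sup>+ x. ennreal \<epsilon> * ennreal (moll \<epsilon> (- c *\<^sub>R x)) \<partial>lborel)"
    using c(2) by (simp add: nn_integral_density nn_integral_distr)
  also have "\<dots> = (\<integral>\<^sup>+ x. ennreal (moll 1 x) \<partial>lborel)"
    using assms by (intro nn_integral_cong)
      (simp add: ennreal_mult[symmetric] moll_nonneg c_def moll_scale)
  finally show ?thesis by (simp add: nn_integral_moll_1)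
qed

lemma integrable_moll:
  assumes "\<epsilon> > 0"
  shows "integrable lborel (\<lambda>x. moll \<epsilon> (y - x))" "(\<integral> x. moll \<epsilon> (y - x) \<partial>lborel) = moll_mass"
proof -
  show i: "integrable lborel (\<lambda>x. moll \<epsilon> (y - x))"
    using nn_integral_moll[OF assms, of y] assms
    by (intro integrableI_bounded) (simp_all add: moll_nonneg)
  show "(\<integral> x. moll \<epsilon> (y - x) \<partial>lborel) = moll_mass"
    using nn_integral_moll[OF assms, of y] nn_integral_eq_integral[OF i] assms moll_mass_pos
    by (simp add: moll_nonneg)
qed

text \<open>Integrating the mollifications of a function over \<open>Q\<close> and exchanging the
  integrals moves the mollifier onto the indicator of \<open>Q\<close>; this is the weight that
  results.\<close>

definition moll_ind :: "real \<Rightarrow> (real \<times> real) set \<Rightarrow> real \<times> real \<Rightarrow> real" where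
  "moll_ind \<epsilon> Q y = (\<integral> x. indicator Q x * moll \<epsilon> (y - x) \<partial>lborel)"

lemma moll_ind_bounds:
  assumes "\<epsilon> > 0" and [measurable]: "Q \<in> sets borel"
  shows "0 \<le> moll_ind \<epsilon> Q y" "moll_ind \<epsilon> Q y \<le> moll_mass"
proof -
  show "0 \<le> moll_ind \<epsilon> Q y" unfolding moll_ind_def
    using assms by (intro Bochner_Integration.integral_nonneg) (simp add: moll_nonneg)
  have "moll_ind \<epsilon> Q y \<le> (\<integral> x. moll \<epsilon> (y - x) \<partial>lborel)"
    unfolding moll_ind_def
  proof (rule integral_mono)
    show "integrable lborel (\<lambda>x. indicator Q x * moll \<epsilon> (y - x))"
      by (rule Bochner_Integration.integrable_bound[OF integrable_moll(1)[OF assms(1), of y]])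
        (auto simp: indicator_def)
  qed (use assms integrable_moll(1) in \<open>auto simp: moll_nonneg indicator_def\<close>)
  then show "moll_ind \<epsilon> Q y \<le> moll_mass" using integrable_moll(2)[OF assms(1)] by simp
qed

lemma moll_ind_cong:
  assumes "\<epsilon> > 0" "\<And>x. (norm (y - x))\<^sup>2 < 2 * \<epsilon> \<Longrightarrow> x \<in> Q \<longleftrightarrow> x \<in> Q'"
  shows "moll_ind \<epsilon> Q y = moll_ind \<epsilon> Q' y"
  unfolding moll_ind_def
proof (rule Bochner_Integration.integral_cong[OF refl])
  fix x
  show "indicat_real Q x * moll \<epsilon> (y - x) = indicat_real Q' x * moll \<epsilon> (y - x)"
    using moll_eq_0[OF assms(1), of "y - x"] assms(2)[of x]
    by (cases "(norm (y - x))\<^sup>2 < 2 * \<epsilon>") (auto simp: indicator_def)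
qed

text \<open>The mollifiers have supports shrinking to a point, so off the frontier the limit value
  is attained exactly from some index on.\<close>

lemma moll_ind_tendsto:
  assumes "closed Q" "y \<notin> frontier Q"
  shows "(\<lambda>n. moll_ind (1 / real (Suc n)) Q y) \<longlonglongrightarrow> moll_mass * indicator Q y"
proof -
  have small: "\<forall>\<^sub>F n in sequentially. \<forall>x. (norm (y - x))\<^sup>2 < 2 * (1 / real (Suc n)) \<longrightarrow> x \<in> ball y d" if "d > 0" for d
  proof -
    have "(\<lambda>n. 2 * (1 / real (Suc n))) \<longlonglongrightarrow> 2 * 0"
      by (intro tendsto_mult tendsto_const LIMSEQ_Suc[OF lim_1_over_n])
    then have "\<forall>\<^sub>F n in sequentially. 2 * (1 / real (Suc n)) < d\<^sup>2"
      using that by (intro order_tendstoD(2)) auto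
    then show ?thesis
    proof eventually_elim
      case (elim n)
      have "norm (y - x) < d" if "(norm (y - x))\<^sup>2 < 2 * (1 / real (Suc n))" for x
        using elim that \<open>d > 0\<close> power2_less_imp_less[of "norm (y - x)" d] by linarith
      then show ?case by (simp add: dist_norm)
    qed
  qed
  have "\<forall>\<^sub>F n in sequentially. moll_ind (1 / real (Suc n)) Q y = moll_mass * indicator Q y"
  proof (cases "y \<in> Q")
    case True
    then have "y \<in> interior Q" using assms by (simp add: frontier_def)
    then obtain d where d: "d > 0" "ball y d \<subseteq> Q" by (auto simp: mem_interior)
    have U: "moll_ind \<epsilon> UNIV y = moll_mass" if "\<epsilon> > 0" for \<epsilon>
      using integrable_moll(2)[OF that, of y] by (simp add: moll_ind_def)
    show ?thesis
      using small[OF d(1)]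
    proof eventually_elim
      case (elim n)
      then have "moll_ind (1 / real (Suc n)) Q y = moll_ind (1 / real (Suc n)) UNIV y"
        using d(2) by (intro moll_ind_cong) auto
      then show ?case using True U by simp
    qed
  next
    case False
    then have "\<exists>d>0. ball y d \<subseteq> - Q" using assms(1) open_contains_ball[of "- Q"] by auto
    then obtain d where d: "d > 0" "ball y d \<subseteq> - Q" by blast
    show ?thesis
      using small[OF d(1)]
    proof eventually_elim
      case (elim n)
      then have "x \<notin> Q" if "(norm (y - x))\<^sup>2 < 2 * (1 / real (Suc n))" for x
        using that d(2) by blast
      then have "moll_ind (1 / real (Suc n)) Q y = moll_ind (1 / real (Suc n)) {} y"
        by (intro moll_ind_cong) (simp, blast)
      then show ?case using False by (simp add: moll_ind_def)
    qed
  qed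
  then show ?thesis by (rule tendsto_eventually)
qed

lemma norm_integral_le_nn_integral:
  fixes f :: "'a \<Rightarrow> 'b::{banach, second_countable_topology}"
  shows "ennreal (norm (integral\<^sup>L M f)) \<le> (\<integral>\<^sup>+ x. ennreal (norm (f x)) \<partial>M)"
  by (cases "integrable M f") (simp_all add: integral_norm_bound_ennreal not_integrable_integral_eq)

text \<open>Averages over cubes rather than pointwise limits of the mollifications, because the library
  provides Lebesgue's differentiation theorem for cubes.\<close>

lemma cube_average_bound:
  fixes F :: "real \<times> real \<Rightarrow> complex" and J :: "real \<times> real \<Rightarrow> ennreal"
  assumes [measurable]: "F \<in> borel_measurable borel"
    and F: "\<And>r. integrable lborel (\<lambda>y. indicator (cball 0 r) y *\<^sub>R F y)"
    and [measurable]: "J \<in> borel_measurable borel"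
    and bd: "\<And>x \<epsilon>. \<epsilon> > 0 \<Longrightarrow> ennreal (norm (\<integral> y. F y * of_real (moll \<epsilon> (y - x)) \<partial>lborel)) \<le> J x"
  shows "ennreal (moll_mass * norm (\<integral> y. indicator (cbox a b) y *\<^sub>R F y \<partial>lborel))
    \<le> (\<integral>\<^sup>+ x. indicator (cbox a b) x * J x \<partial>lborel)"
proof -
  let ?Q = "cbox a b"
  have Qm [measurable]: "?Q \<in> sets borel" by simp
  obtain B0 where B0: "\<And>x. x \<in> ?Q \<Longrightarrow> norm x \<le> B0"
    using bounded_cbox[of a b] by (auto simp: bounded_iff)
  \<comment> \<open>For \<open>\<epsilon> \<le> 1\<close> the mollifier lives within distance sqrt 2
    of its centre, so the margin 2 encloses the supports of all the weights at once.\<close>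
  define B where "B = B0 + 2"
  have [measurable]: "cball 0 B \<in> sets (borel :: (real \<times> real) measure)" by simp
  have supp: "moll_ind \<epsilon> ?Q y = moll_ind \<epsilon> ?Q y * indicator (cball 0 B) y" if "0 < \<epsilon>" "\<epsilon> \<le> 1" for \<epsilon> y
  proof (cases "norm y \<le> B")
    case True
    then show ?thesis by simp
  next
    case False
    have "moll_ind \<epsilon> ?Q y = moll_ind \<epsilon> {} y"
    proof (rule moll_ind_cong[OF that(1)])
      fix x assume "(norm (y - x))\<^sup>2 < 2 * \<epsilon>"
      then have "(norm (y - x))\<^sup>2 < 2\<^sup>2" using that by simp
      then have "norm (y - x) < 2" by (rule power2_less_imp_less) simp
      then have "norm x > B0" using False norm_triangle_ineq2[of y x] by (simp add: B_def)
      then show "x \<in> ?Q \<longleftrightarrow> x \<in> {}" using B0[of x] by auto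
    qed
    then show ?thesis by (simp add: moll_ind_def)
  qed
  have meas [measurable]: "moll_ind \<epsilon> ?Q \<in> borel_measurable borel" for \<epsilon>
    unfolding moll_ind_def[abs_def] by measurable
  have step: "ennreal (norm (\<integral> y. F y * of_real (moll_ind \<epsilon> ?Q y) \<partial>lborel))
      \<le> (\<integral>\<^sup>+ x. indicator ?Q x * J x \<partial>lborel)" if "0 < \<epsilon>" "\<epsilon> \<le> 1" for \<epsilon>
  proof -
    let ?f = "\<lambda>(x, y). of_real (indicator ?Q x * moll \<epsilon> (y - x)) * F y"
    have int: "integrable (lborel \<Otimes>\<^sub>M lborel) ?f"
    proof (rule integrableI_bounded)
      show "?f \<in> borel_measurable (lborel \<Otimes>\<^sub>M lborel)" by measurable
      have "(\<integral>\<^sup>+ z. ennreal (norm (?f z)) \<partial>(lborel \<Otimes>\<^sub>M lborel))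
          = (\<integral>\<^sup>+ y. \<integral>\<^sup>+ x. ennreal (norm (?f (x, y))) \<partial>lborel \<partial>lborel)"
        by (rule lborel_pair.nn_integral_snd[symmetric]) measurable
      also have "\<dots> \<le> (\<integral>\<^sup>+ y. ennreal moll_mass * ennreal (norm (indicator (cball 0 B) y *\<^sub>R F y)) \<partial>lborel)"
      proof (rule nn_integral_mono)
        fix y
        have "(\<integral>\<^sup>+ x. ennreal (norm (?f (x, y))) \<partial>lborel)
          = (\<integral>\<^sup>+ x. ennreal (norm (F y)) * ennreal (indicator ?Q x * moll \<epsilon> (y - x)) \<partial>lborel)"
          using that by (intro nn_integral_cong)
            (simp add: norm_mult ennreal_mult[symmetric] moll_nonneg mult.commute abs_mult)
        also have "\<dots> = ennreal (norm (F y)) * (\<integral>\<^sup>+ x. ennreal (indicator ?Q x * moll \<epsilon> (y - x)) \<partial>lborel)"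
          by (rule nn_integral_cmult) measurable
        also have "(\<integral>\<^sup>+ x. ennreal (indicator ?Q x * moll \<epsilon> (y - x)) \<partial>lborel) = ennreal (moll_ind \<epsilon> ?Q y)"
          unfolding moll_ind_def
        proof (rule nn_integral_eq_integral)
          show "integrable lborel (\<lambda>x. indicator ?Q x * moll \<epsilon> (y - x))"
            by (rule Bochner_Integration.integrable_bound[OF integrable_moll(1)[OF that(1), of y]])
              (auto simp: indicator_def)
        qed (use that in \<open>auto simp: moll_nonneg\<close>)
        also have "\<dots> \<le> ennreal (moll_mass * indicator (cball 0 B) y)"
          using moll_ind_bounds[OF that(1) Qm, of y] supp[OF that, of y]
          by (intro ennreal_leI) (auto simp: indicator_def split: if_splits)
        also have "ennreal (norm (F y)) * \<dots> = ennreal moll_mass * ennreal (norm (indicator (cball 0 B) y *\<^sub>R F y))"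
          using moll_mass_pos by (simp add: ennreal_mult[symmetric] mult.commute mult.left_commute)
        finally show "(\<integral>\<^sup>+ x. ennreal (norm (?f (x, y))) \<partial>lborel)
          \<le> ennreal moll_mass * ennreal (norm (indicator (cball 0 B) y *\<^sub>R F y))"
          by (simp add: mult_left_mono)
      qed
      also have "\<dots> = ennreal moll_mass * (\<integral>\<^sup>+ y. ennreal (norm (indicator (cball 0 B) y *\<^sub>R F y)) \<partial>lborel)"
        by (rule nn_integral_cmult) measurable
      also have "\<dots> < \<infinity>"
        using F[of B] by (simp add: integrable_iff_bounded ennreal_mult_less_top)
      finally show "(\<integral>\<^sup>+ z. ennreal (norm (?f z)) \<partial>(lborel \<Otimes>\<^sub>M lborel)) < \<infinity>" .
    qed
    have "(\<integral> y. F y * of_real (moll_ind \<epsilon> ?Q y) \<partial>lborel) = (\<integral> y. \<integral> x. ?f (x, y) \<partial>lborel \<partial>lborel)"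
      by (intro Bochner_Integration.integral_cong refl) (simp add: moll_ind_def mult.commute integral_complex_of_real[symmetric] del: integral_complex_of_real of_real_mult)
    also have "\<dots> = (\<integral> x. \<integral> y. ?f (x, y) \<partial>lborel \<partial>lborel)"
      using lborel_pair.Fubini_integral[of "\<lambda>x y. ?f (x, y)"] int by simp
    finally have eq: "(\<integral> y. F y * of_real (moll_ind \<epsilon> ?Q y) \<partial>lborel) = (\<integral> x. \<integral> y. ?f (x, y) \<partial>lborel \<partial>lborel)" .
    have "ennreal (norm (\<integral> x. \<integral> y. ?f (x, y) \<partial>lborel \<partial>lborel))
        \<le> (\<integral>\<^sup>+ x. ennreal (norm (\<integral> y. ?f (x, y) \<partial>lborel)) \<partial>lborel)"
      by (rule norm_integral_le_nn_integral)
    also have "\<dots> \<le> (\<integral>\<^sup>+ x. indicator ?Q x * J x \<partial>lborel)"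
    proof (rule nn_integral_mono)
      fix x
      show "ennreal (norm (\<integral> y. ?f (x, y) \<partial>lborel)) \<le> indicator ?Q x * J x"
        using bd[OF that(1), of x] by (cases "x \<in> ?Q") (auto simp: mult.commute)
    qed
    finally show ?thesis unfolding eq .
  qed
  \<comment> \<open>Dominated convergence as the scale tends to 0. The weights may fail to converge
    to the indicator only on the frontier of the cube, a null set.\<close>
  have lim: "(\<lambda>n. \<integral> y. F y * of_real (moll_ind (1 / real (Suc n)) ?Q y) \<partial>lborel)
      \<longlonglongrightarrow> (\<integral> y. F y * of_real (moll_mass * indicator ?Q y) \<partial>lborel)"
  proof (rule integral_dominated_convergence[where w = "\<lambda>y. moll_mass * norm (indicator (cball 0 B) y *\<^sub>R F y)"])
    show "integrable lborel (\<lambda>y. moll_mass * norm (indicator (cball 0 B) y *\<^sub>R F y))"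
      by (intro integrable_mult_right integrable_norm F)
    have "negligible (frontier ?Q)" by (simp add: negligible_convex_frontier)
    then have "AE y in lebesgue. y \<notin> frontier ?Q"
      by (simp add: negligible_iff_null_sets AE_not_in)
    then have "AE y in lborel. y \<notin> frontier ?Q"
      by (simp add: AE_completion_iff)
    then show "AE y in lborel. (\<lambda>n. F y * of_real (moll_ind (1 / real (Suc n)) ?Q y))
        \<longlonglongrightarrow> F y * of_real (moll_mass * indicator ?Q y)"
      by eventually_elim (intro tendsto_intros moll_ind_tendsto closed_cbox)
    show "AE y in lborel. norm (F y * of_real (moll_ind (1 / real (Suc n)) ?Q y))
        \<le> moll_mass * norm (indicator (cball 0 B) y *\<^sub>R F y)" for n
    proof (rule AE_I2)
      fix y
      show "norm (F y * of_real (moll_ind (1 / real (Suc n)) ?Q y)) \<le> moll_mass * norm (indicator (cball 0 B) y *\<^sub>R F y)"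
      proof -
        have "norm (F y) * moll_ind (1 / real (Suc n)) ?Q y
            = norm (F y) * (moll_ind (1 / real (Suc n)) ?Q y * indicator (cball 0 B) y)"
          using supp[of "1 / real (Suc n)" y] by simp
        also have "\<dots> \<le> norm (F y) * (moll_mass * indicator (cball 0 B) y)"
          using moll_ind_bounds[of "1 / real (Suc n)" ?Q y] by (intro mult_left_mono mult_right_mono) auto
        finally show ?thesis
          using moll_ind_bounds[of "1 / real (Suc n)" ?Q y]
          by (simp add: norm_mult mult.commute mult.left_commute)
      qed
    qed
  qed measurable
  have "(\<lambda>n. ennreal (norm (\<integral> y. F y * of_real (moll_ind (1 / real (Suc n)) ?Q y) \<partial>lborel)))
      \<longlonglongrightarrow> ennreal (norm (\<integral> y. F y * of_real (moll_mass * indicator ?Q y) \<partial>lborel))"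
    by (intro tendsto_ennrealI tendsto_norm lim)
  then have "ennreal (norm (\<integral> y. F y * of_real (moll_mass * indicator ?Q y) \<partial>lborel))
      \<le> (\<integral>\<^sup>+ x. indicator ?Q x * J x \<partial>lborel)"
    by (rule tendsto_upperbound) (auto intro!: always_eventually step)
  moreover have "(\<integral> y. F y * of_real (moll_mass * indicator ?Q y) \<partial>lborel)
      = (\<integral> y. of_real moll_mass * (indicator ?Q y *\<^sub>R F y) \<partial>lborel)"
    by (intro Bochner_Integration.integral_cong refl) (simp add: scaleR_conv_of_real)
  moreover have "\<dots> = of_real moll_mass * (\<integral> y. indicator ?Q y *\<^sub>R F y \<partial>lborel)"
    by (rule integral_mult_right_zero)
  ultimately show ?thesis using moll_mass_pos by (simp add: norm_mult)
qed

text \<open>A bound that is uniform in the scale of mollification passes to averages over cubes, and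
  differentiating these averages on both sides gives it at almost every point. Since
  \<open>J\<close> may take the value infinity, averages are formed with its real version
  \<open>j\<close>; finiteness of the integrals of \<open>J\<close> over cubes makes the two agree
  almost everywhere.\<close>

lemma AE_le_of_mollified:
  fixes F :: "real \<times> real \<Rightarrow> complex" and J :: "real \<times> real \<Rightarrow> ennreal"
  assumes [measurable]: "F \<in> borel_measurable borel"
    and F: "\<And>r. integrable lborel (\<lambda>y. indicator (cball 0 r) y *\<^sub>R F y)"
    and [measurable]: "J \<in> borel_measurable borel"
    and J: "\<And>a b. (\<integral>\<^sup>+ x. indicator (cbox a b) x * J x \<partial>lborel) < \<infinity>"
    and bd: "\<And>x \<epsilon>. \<epsilon> > 0 \<Longrightarrow> ennreal (norm (\<integral> y. F y * of_real (moll \<epsilon> (y - x)) \<partial>lborel)) \<le> J x"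
  shows "AE x in lborel. ennreal (moll_mass * norm (F x)) \<le> J x"
proof -
  define j where "j x = enn2real (J x)" for x
  have [measurable]: "j \<in> borel_measurable borel" unfolding j_def[abs_def] by measurable
  have j0: "0 \<le> j x" for x by (simp add: j_def)
  have FQ: "integrable lborel (\<lambda>y. indicator (cbox a b) y *\<^sub>R F y)" for a b
  proof -
    obtain r where "\<forall>x\<in>cbox a b. norm x \<le> r"
      using bounded_cbox[of a b] unfolding bounded_iff by (elim exE)
    then have r: "cbox a b \<subseteq> cball 0 r" by auto
    have [measurable]: "cbox a b \<in> sets (borel :: (real \<times> real) measure)" by simp
    show ?thesis
    proof (rule Bochner_Integration.integrable_bound[OF F[of r]])
      show "AE y in lborel. norm (indicator (cbox a b) y *\<^sub>R F y) \<le> norm (indicator (cball 0 r) y *\<^sub>R F y)"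
        using r by (intro AE_I2) (auto simp: indicator_def)
    qed measurable
  qed
  have JQ: "(\<integral>\<^sup>+ x. indicator (cbox a b) x * J x \<partial>lborel) = ennreal (\<integral> x. indicator (cbox a b) x *\<^sub>R j x \<partial>lborel)
      \<and> integrable lborel (\<lambda>x. indicator (cbox a b) x *\<^sub>R j x)" for a b
  proof -
    have [measurable]: "cbox a b \<in> sets (borel :: (real \<times> real) measure)" by simp
    have "AE x in lborel. indicator (cbox a b) x * J x \<noteq> \<infinity>"
      by (rule nn_integral_PInf_AE) (use J[of a b] in auto)
    then have "AE x in lborel. indicator (cbox a b) x * J x = ennreal (indicator (cbox a b) x *\<^sub>R j x)"
      by eventually_elim (auto simp: j_def indicator_def less_top split: if_splits)
    then have eq: "(\<integral>\<^sup>+ x. indicator (cbox a b) x * J x \<partial>lborel) = (\<integral>\<^sup>+ x. ennreal (indicator (cbox a b) x *\<^sub>R j x) \<partial>lborel)"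
      by (rule nn_integral_cong_AE)
    have i: "integrable lborel (\<lambda>x. indicator (cbox a b) x *\<^sub>R j x)"
    proof (rule integrableI_bounded)
      have "(\<integral>\<^sup>+ x. ennreal (norm (indicator (cbox a b) x *\<^sub>R j x)) \<partial>lborel)
          = (\<integral>\<^sup>+ x. ennreal (indicator (cbox a b) x *\<^sub>R j x) \<partial>lborel)"
        by (intro nn_integral_cong) (simp add: j0)
      then show "(\<integral>\<^sup>+ x. ennreal (norm (indicator (cbox a b) x *\<^sub>R j x)) \<partial>lborel) < \<infinity>"
        using J[of a b] eq by simp
    qed measurable
    then show ?thesis unfolding eq using j0 by (subst nn_integral_eq_integral) auto
  qed
  have HI: "(f has_integral (\<integral> x. indicator (cbox a b) x *\<^sub>R f x \<partial>lborel)) (cbox a b)"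
    if "integrable lborel (\<lambda>x. indicator (cbox a b) x *\<^sub>R f x)"
    for f :: "real \<times> real \<Rightarrow> 'c::euclidean_space" and a b
  proof -
    have "(\<lambda>x. indicator (cbox a b) x *\<^sub>R f x) = (\<lambda>x. if x \<in> cbox a b then f x else 0)"
      by (auto simp: indicator_def)
    then show ?thesis using has_integral_integral_lborel[OF that]
      by (simp only: has_integral_restrict_UNIV)
  qed
  have ineq: "moll_mass * norm (integral (cbox a b) F) \<le> integral (cbox a b) j" for a b
  proof -
    have "ennreal (moll_mass * norm (\<integral> y. indicator (cbox a b) y *\<^sub>R F y \<partial>lborel))
        \<le> ennreal (\<integral> x. indicator (cbox a b) x *\<^sub>R j x \<partial>lborel)"
      using cube_average_bound[OF assms(1) F assms(3) bd, of a b] JQ[of a b] by simp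
    moreover have "0 \<le> (\<integral> x. indicator (cbox a b) x *\<^sub>R j x \<partial>lborel)"
      by (rule Bochner_Integration.integral_nonneg) (simp add: j0)
    ultimately show ?thesis
      using integral_unique[OF HI[OF FQ[of a b]]] integral_unique[OF HI[OF conjunct2[OF JQ[of a b]]]]
      by simp
  qed
  have "F integrable_on cbox a b" "j integrable_on cbox a b" for a b
    using HI[OF FQ[of a b]] HI[OF conjunct2[OF JQ[of a b]]] by auto
  note int = this
  obtain N1 where N1: "negligible N1" "\<And>x e. \<lbrakk>x \<notin> N1; 0 < e\<rbrakk> \<Longrightarrow>
       \<exists>d>0. \<forall>h. 0 < h \<and> h < d \<longrightarrow> norm (integral (cbox x (x + h *\<^sub>R One)) F /\<^sub>R h ^ DIM(real \<times> real) - F x) < e"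
    using integrable_ccontinuous_explicit[of F] int(1) by blast
  obtain N2 where N2: "negligible N2" "\<And>x e. \<lbrakk>x \<notin> N2; 0 < e\<rbrakk> \<Longrightarrow>
       \<exists>d>0. \<forall>h. 0 < h \<and> h < d \<longrightarrow> norm (integral (cbox x (x + h *\<^sub>R One)) j /\<^sub>R h ^ DIM(real \<times> real) - j x) < e"
    using integrable_ccontinuous_explicit[of j] int(2) by blast
  have pt: "ennreal (moll_mass * norm (F x)) \<le> J x" if "x \<notin> N1 \<union> N2" for x
  proof -
    have "moll_mass * norm (F x) \<le> j x"
    proof (rule field_le_epsilon)
      fix e :: real assume e: "e > 0"
      \<comment> \<open>Replacing averages by point values costs \<open>e'\<close> for
        \<open>j\<close> and \<open>moll_mass * e'\<close> for \<open>F\<close>; together this is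
        \<open>e\<close>.\<close>
      define e' where "e' = e / (moll_mass + 1)"
      have e': "e' > 0" using e moll_mass_pos by (simp add: e'_def)
      have "x \<notin> N1" using that by simp
      from N1(2)[OF this e'] obtain d1 where d1: "d1 > 0" "\<forall>h. 0 < h \<and> h < d1 \<longrightarrow>
          norm (integral (cbox x (x + h *\<^sub>R One)) F /\<^sub>R h ^ DIM(real \<times> real) - F x) < e'"
        by (elim exE conjE)
      have "x \<notin> N2" using that by simp
      from N2(2)[OF this e'] obtain d2 where d2: "d2 > 0" "\<forall>h. 0 < h \<and> h < d2 \<longrightarrow>
          norm (integral (cbox x (x + h *\<^sub>R One)) j /\<^sub>R h ^ DIM(real \<times> real) - j x) < e'"
        by (elim exE conjE)
      define h where "h = min d1 d2 / 2"
      have h: "0 < h" "h < d1" "h < d2" using d1(1) d2(1) by (auto simp: h_def min_def)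
      define k where "k = h ^ DIM(real \<times> real)"
      have k: "k > 0" using h by (simp add: k_def)
      define IF where "IF = integral (cbox x (x + h *\<^sub>R One)) F"
      define Ij where "Ij = integral (cbox x (x + h *\<^sub>R One)) j"
      have 1: "norm (IF /\<^sub>R k - F x) < e'" using d1(2)[rule_format, OF conjI[OF h(1,2)]] by (simp only: IF_def k_def)
      have 2: "\<bar>Ij / k - j x\<bar> < e'" using d2(2)[rule_format, OF conjI[OF h(1,3)]]
        by (simp add: Ij_def k_def divide_inverse mult.commute)
      have 3: "moll_mass * norm (IF /\<^sub>R k) \<le> Ij / k"
        using ineq[of x "x + h *\<^sub>R One"] k by (simp add: IF_def Ij_def field_simps)
      have "norm (F x) \<le> norm (IF /\<^sub>R k) + e'"
        using 1 norm_triangle_sub[of "F x" "IF /\<^sub>R k"] by (simp add: norm_minus_commute)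
      then have "moll_mass * norm (F x) \<le> moll_mass * (norm (IF /\<^sub>R k) + e')"
        using moll_mass_pos by (intro mult_left_mono) auto
      also have "\<dots> \<le> (j x + e') + moll_mass * e'"
        using 2 3 by (simp add: distrib_left abs_less_iff)
      also have "\<dots> = j x + e"
      proof -
        have "e' * (moll_mass + 1) = e" using moll_mass_pos by (simp add: e'_def)
        then show ?thesis by (simp add: algebra_simps)
      qed
      finally show "moll_mass * norm (F x) \<le> j x + e" .
    qed
    then have "ennreal (moll_mass * norm (F x)) \<le> ennreal (j x)" by (rule ennreal_leI)
    \<comment> \<open>Holds also where \<open>J x\<close> is infinite, since \<open>enn2real\<close>
      gives 0 there.\<close>
    also have "\<dots> \<le> J x" by (cases "J x") (auto simp: j_def)
    finally show ?thesis .
  qed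
  have "negligible (N1 \<union> N2)" using N1 N2 by simp
  then have "AE x in lebesgue. x \<notin> N1 \<union> N2"
    by (intro AE_not_in) (simp add: negligible_iff_null_sets)
  then have "AE x in lborel. x \<notin> N1 \<union> N2"
    by (simp add: AE_completion_iff)
  then show ?thesis by eventually_elim (rule pt)
qed

text \<open>Splits a function in L^q into a bounded and an integrable part. With
  \<open>\<eta> = 1\<close> it gives local integrability; with small \<open>\<eta>\<close> it shows
  that averages over large discs are small.\<close>

lemma le_add_powr:
  fixes t \<eta> q :: real
  assumes "0 \<le> t" "0 < \<eta>" "1 < q"
  shows "t \<le> \<eta> + \<eta> powr (1 - q) * t powr q"
proof (cases "t \<le> \<eta>")
  case True
  then show ?thesis using assms by (simp add: add_increasing2)
next
  case False
  then have "1 \<le> (t / \<eta>) powr (q - 1)" using assms by (intro ge_one_powr_ge_zero) auto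
  then have "t * 1 \<le> t * (t / \<eta>) powr (q - 1)" using assms by (intro mult_left_mono) auto
  also have "\<dots> = \<eta> powr (1 - q) * t powr q"
    using False assms by (simp add: powr_divide powr_diff field_simps)
  finally show ?thesis using assms by simp
qed

lemma Lq_locally_integrable:
  fixes F :: "real \<times> real \<Rightarrow> complex"
  assumes [measurable]: "F \<in> borel_measurable borel" and "1 < q"
    and Fq: "integrable lborel (\<lambda>y. norm (F y) powr q)"
  shows "integrable lborel (\<lambda>y. indicator (cball x r) y *\<^sub>R F y)"
proof (rule Bochner_Integration.integrable_bound)
  have [measurable]: "cball x r \<in> sets borel" by simp
  show "(\<lambda>y. indicator (cball x r) y *\<^sub>R F y) \<in> borel_measurable lborel" by measurable
  show "integrable lborel (\<lambda>y. indicator (cball x r) y + norm (F y) powr q)"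
    by (intro Bochner_Integration.integrable_add Fq integrable_real_indicator)
      (simp_all add: emeasure_lborel_cball_finite[unfolded infinity_ennreal_def])
  show "AE y in lborel. norm (indicator (cball x r) y *\<^sub>R F y) \<le> norm (indicator (cball x r) y + norm (F y) powr q)"
    using le_add_powr[of "norm (F _)" 1 q] assms(2) by (intro AE_I2) (auto simp: indicator_def)
qed

lemma integrable_mult_moll:
  fixes F :: "real \<times> real \<Rightarrow> complex"
  assumes [measurable]: "F \<in> borel_measurable borel"
    and F: "\<And>r. integrable lborel (\<lambda>y. indicator (cball x r) y *\<^sub>R F y)" and "\<epsilon> > 0"
  shows "integrable lborel (\<lambda>y. F y * of_real (moll \<epsilon> (y - x)))"
proof -
  obtain M where M: "M > 0" "\<And>t. cutoff' t \<le> M" using cutoff'_bounded by blast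
  show ?thesis
  proof (rule Bochner_Integration.integrable_bound)
    show "integrable lborel (\<lambda>y. M / \<epsilon> * norm (indicator (cball x (sqrt (2 * \<epsilon>))) y *\<^sub>R F y))"
      by (intro integrable_mult_right integrable_norm F)
    show "AE y in lborel. norm (F y * of_real (moll \<epsilon> (y - x)))
        \<le> norm (M / \<epsilon> * norm (indicator (cball x (sqrt (2 * \<epsilon>))) y *\<^sub>R F y))"
    proof (rule AE_I2)
      fix y
      show "norm (F y * of_real (moll \<epsilon> (y - x)))
        \<le> norm (M / \<epsilon> * norm (indicator (cball x (sqrt (2 * \<epsilon>))) y *\<^sub>R F y))"
      proof (cases "y \<in> cball x (sqrt (2 * \<epsilon>))")
        case True
        have "moll \<epsilon> (y - x) \<le> M / \<epsilon>" using M \<open>\<epsilon> > 0\<close> by (simp add: moll_def divide_right_mono)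
        then have "norm (F y) * moll \<epsilon> (y - x) \<le> norm (F y) * (M / \<epsilon>)" by (intro mult_left_mono) auto
        then show ?thesis using True moll_nonneg[OF \<open>\<epsilon> > 0\<close>, of "y - x"] M \<open>\<epsilon> > 0\<close>
          by (simp add: norm_mult abs_mult mult.commute)
      next
        case False
        then have "sqrt (2 * \<epsilon>) \<le> norm (y - x)" by (simp add: dist_norm norm_minus_commute)
        then have "(sqrt (2 * \<epsilon>))\<^sup>2 \<le> (norm (y - x))\<^sup>2" using \<open>\<epsilon> > 0\<close> by (intro power_mono) auto
        then have "moll \<epsilon> (y - x) = 0" using \<open>\<epsilon> > 0\<close> by (intro moll_eq_0) auto
        then show ?thesis by simp
      qed
    qed
  qed measurable
qed

text \<open>This replaces a cutoff of \<open>F\<close> at infinity. The mollifier at scale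
  \<open>R\<close> is of size 1/R on a disc of area proportional to \<open>R\<close>: the part of
  \<open>F\<close> below \<open>\<eta>\<close> contributes a multiple of \<open>\<eta>\<close>, the
  integrable remainder only O(1/R).\<close>

lemma moll_average_vanishes:
  fixes F :: "real \<times> real \<Rightarrow> complex"
  assumes [measurable]: "F \<in> borel_measurable borel" and q: "1 < q"
    and Fq: "integrable lborel (\<lambda>y. norm (F y) powr q)" and e: "e > 0"
  obtains R where "R \<ge> \<epsilon>" "R > 0" "ennreal (norm (\<integral> y. F y * of_real (moll R (y - x)) \<partial>lborel)) \<le> ennreal e"
proof -
  obtain M where M: "M > 0" "\<And>t. cutoff' t \<le> M" using cutoff'_bounded by blast
  define U where "U = (\<integral> y. norm (F y) powr q \<partial>lborel)"
  have U: "(\<integral>\<^sup>+ y. ennreal (norm (F y) powr q) \<partial>lborel) = ennreal U" "0 \<le> U"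
    unfolding U_def by (auto intro!: nn_integral_eq_integral Fq)
  \<comment> \<open>The bounded part is at most \<open>M / R * \<eta>\<close> on a disc of area
    \<open>2 * pi * R\<close>; this choice makes its share \<open>e / 2\<close>. The last entry in
    the maximum defining \<open>R\<close> does the same for the remainder.\<close>
  define \<eta> where "\<eta> = e / (4 * pi * M)"
  have \<eta>: "\<eta> > 0" using e M by (simp add: \<eta>_def)
  define R where "R = max (max \<epsilon> 1) (2 * M * \<eta> powr (1 - q) * U / e)"
  have R: "R \<ge> \<epsilon>" "R \<ge> 1" "R > 0" "2 * M * \<eta> powr (1 - q) * U / e \<le> R" by (auto simp: R_def)
  have [measurable]: "ball x (sqrt (2 * R)) \<in> sets borel" by simp
  have pt: "ennreal (norm (F y * of_real (moll R (y - x))))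
      \<le> ennreal (M / R * \<eta>) * indicator (ball x (sqrt (2 * R))) y
        + ennreal (M / R * \<eta> powr (1 - q)) * ennreal (norm (F y) powr q)" for y
  proof (cases "y \<in> ball x (sqrt (2 * R))")
    case True
    have "norm (F y * of_real (moll R (y - x))) = norm (F y) * moll R (y - x)"
      using moll_nonneg[OF R(3)] by (simp add: norm_mult)
    also have "\<dots> \<le> (\<eta> + \<eta> powr (1 - q) * norm (F y) powr q) * (M / R)"
      using M R(3) \<eta> q moll_nonneg[OF R(3)]
      by (intro mult_mono le_add_powr) (auto simp: moll_def divide_right_mono)
    finally have "norm (F y * of_real (moll R (y - x))) \<le> M / R * \<eta> + M / R * \<eta> powr (1 - q) * norm (F y) powr q"
      by (simp add: algebra_simps)
    then have "ennreal (norm (F y * of_real (moll R (y - x))))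
        \<le> ennreal (M / R * \<eta> + M / R * \<eta> powr (1 - q) * norm (F y) powr q)"
      by (rule ennreal_leI)
    also have "\<dots> = ennreal (M / R * \<eta>) + ennreal (M / R * \<eta> powr (1 - q)) * ennreal (norm (F y) powr q)"
      using M R(3) \<eta> by (subst ennreal_plus) (auto simp: ennreal_mult[symmetric])
    finally show ?thesis using True by simp
  next
    case False
    then have "sqrt (2 * R) \<le> norm (y - x)" by (simp add: dist_norm norm_minus_commute)
    then have "(sqrt (2 * R))\<^sup>2 \<le> (norm (y - x))\<^sup>2" using R(3) by (intro power_mono) auto
    then have "moll R (y - x) = 0" using R(3) by (intro moll_eq_0) auto
    then show ?thesis by simp
  qed
  have "ennreal (norm (\<integral> y. F y * of_real (moll R (y - x)) \<partial>lborel))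
      \<le> (\<integral>\<^sup>+ y. ennreal (norm (F y * of_real (moll R (y - x)))) \<partial>lborel)"
    by (rule norm_integral_le_nn_integral)
  also have "\<dots> \<le> (\<integral>\<^sup>+ y. (ennreal (M / R * \<eta>) * indicator (ball x (sqrt (2 * R))) y
        + ennreal (M / R * \<eta> powr (1 - q)) * ennreal (norm (F y) powr q)) \<partial>lborel)"
    by (intro nn_integral_mono pt)
  also have "\<dots> = ennreal (M / R * \<eta>) * emeasure lborel (ball x (sqrt (2 * R)))
      + ennreal (M / R * \<eta> powr (1 - q)) * (\<integral>\<^sup>+ y. ennreal (norm (F y) powr q) \<partial>lborel)"
    by (subst nn_integral_add) (auto simp: nn_integral_cmult_indicator nn_integral_cmult)
  also have "\<dots> = ennreal (M / R * \<eta> * (pi * (2 * R)) + M / R * \<eta> powr (1 - q) * U)"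
    using M R(3) \<eta> U by (simp add: emeasure_ball_plane ennreal_mult[symmetric] ennreal_plus[symmetric] del: ennreal_plus)
  also have "\<dots> \<le> ennreal e"
  proof (rule ennreal_leI)
    have 1: "M / R * \<eta> * (pi * (2 * R)) = e / 2" using M R(3) by (simp add: \<eta>_def field_simps)
    have 2: "M / R * \<eta> powr (1 - q) * U \<le> e / 2"
      using R(3,4) e by (simp add: field_simps)
    have "M / R * \<eta> * (pi * (2 * R)) + M / R * \<eta> powr (1 - q) * U \<le> e / 2 + e / 2"
      by (rule add_mono[OF eq_refl[OF 1] 2])
    also have "\<dots> = e" by simp
    finally show "M / R * \<eta> * (pi * (2 * R)) + M / R * \<eta> powr (1 - q) * U \<le> e" .
  qed
  finally show thesis using that R by blast
qed

section \<open>The truncated pole and its size\<close>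

lemma continuous_on_dbar:
  assumes "Ck (Suc 0) f"
  shows "continuous_on UNIV (dbar f)"
proof -
  have "continuous_on UNIV (\<lambda>z. frechet_derivative f (at z) v)" for v
    using Ck_SucD(2)[OF assms] by simp
  then show ?thesis unfolding dbar_def[abs_def] by (intro continuous_intros)
qed

lemma Ck_cutoff_scale: "Ck k (\<lambda>t. cutoff (t / \<delta>))"
proof -
  have "bounded_linear (\<lambda>t::real. t / \<delta>)" by (rule bounded_linear_divide)
  then show ?thesis by (rule Ck_compose_real[OF Ck_cutoff Ck_bounded_linear])
qed

lemma DERIV_cutoff_scale: "((\<lambda>t. cutoff (t / \<delta>)) has_real_derivative cutoff' (t / \<delta>) / \<delta>) (at t)"
  by (rule DERIV_cong[OF DERIV_chain2[OF DERIV_cutoff DERIV_cdivide[OF DERIV_ident]]]) simp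

text \<open>A smooth substitute for 1/z on the complex plane: zero where |z|^2 is at most
  \<open>\<delta>\<close>, exact where it is at least \<open>2 * \<delta>\<close>. If
  \<open>u\<close> vanishes in the disc of squared radius \<open>2 * \<delta>\<close>, its powers
  serve as holomorphic weights on the set where \<open>u\<close> is nonzero.\<close>

definition pole :: "real \<Rightarrow> real \<times> real \<Rightarrow> complex" where
  "pole \<delta> = cpole (\<lambda>t. cutoff (t / \<delta>))"

lemma norm_pole: "norm (pole \<delta> z) = cutoff ((norm z)\<^sup>2 / \<delta>) / norm z"
  by (simp add: pole_def norm_cpole cutoff_nonneg)

lemma norm_pole_le: "norm (pole \<delta> z) \<le> 1 / norm z"
  unfolding norm_pole by (intro divide_right_mono cutoff_le_1) simp

text \<open>Where the cutoff is nonzero, \<open>norm z\<close> exceeds \<open>sqrt \<delta>\<close>.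
  The resulting bound for the \<open>N\<close>-th power deteriorates with \<open>N\<close>; it only
  secures finiteness of norms and never enters the final constants.\<close>

lemma norm_pole_le_const: "\<delta> > 0 \<Longrightarrow> norm (pole \<delta> z) \<le> 1 / sqrt \<delta>"
proof (cases "(norm z)\<^sup>2 \<le> \<delta>")
  case True
  assume "\<delta> > 0"
  then show ?thesis using True by (simp add: norm_pole cutoff_eq_0)
next
  case False
  assume "\<delta> > 0"
  then have "sqrt \<delta> \<le> norm z" using False real_le_lsqrt[of "norm z" \<delta>] by simp
  moreover have "0 < sqrt \<delta>" using \<open>\<delta> > 0\<close> by simp
  ultimately have "1 / norm z \<le> 1 / sqrt \<delta>" by (intro divide_left_mono mult_pos_pos) linarith+
  then show ?thesis using norm_pole_le order_trans by blast
qed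

lemma norm_pole_eq: "\<delta> > 0 \<Longrightarrow> 2 * \<delta> \<le> (norm z)\<^sup>2 \<Longrightarrow> norm (pole \<delta> z) = 1 / norm z"
  unfolding norm_pole by (subst cutoff_eq_1) (auto simp: field_simps)

lemma Ck_pole: "\<delta> > 0 \<Longrightarrow> Ck k (\<lambda>z. pole \<delta> (z - a))"
  unfolding pole_def
  by (rule Ck_cpole[OF Ck_cutoff_scale, of \<delta>]) (auto simp: cutoff_eq_0 field_simps)

lemma borel_measurable_pole: "\<delta> > 0 \<Longrightarrow> (\<lambda>z. pole \<delta> (z - a)) \<in> borel_measurable borel"
  using Ck_pole[of \<delta> 0 a] by (intro borel_measurable_continuous_onI) simp

lemma dbar_pole: "\<delta> > 0 \<Longrightarrow> dbar (\<lambda>z. pole \<delta> (z - a)) z = of_real (cutoff' ((norm (z - a))\<^sup>2 / \<delta>) / \<delta>)"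
  unfolding pole_def
  by (rule dbar_cpole[OF DERIV_cutoff_scale, of \<delta>]) (auto simp: cutoff_eq_0 field_simps)

section \<open>The weighted Cauchy estimate\<close>

text \<open>The test function is a truncation of \<open>1 / ((y - x) (y - a)\<^sup>N)\<close>: where \<open>u \<noteq> 0\<close>, its \<open>\<partial>\<close>-bar
  derivative is the product of \<open>(y - a)\<^sup>-\<^sup>N\<close> with a mollifier at scale \<open>\<epsilon>\<close> minus one at a large
  scale \<open>R\<close>, and the latter contributes nothing in the limit because \<open>u\<close> is in \<open>L\<^sup>q\<close>.\<close>

lemma cauchy_kernel_bound:
  fixes u g :: "real \<times> real \<Rightarrow> complex"
  assumes u [measurable]: "u \<in> borel_measurable borel" and g [measurable]: "g \<in> borel_measurable borel"
    and weak: "\<And>\<phi>. test_function \<phi> \<Longrightarrow> (\<integral> z. g z * \<phi> z \<partial>lborel) = - (\<integral> z. u z * dbar \<phi> z \<partial>lborel)"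
    and q: "1 < q" and uq: "integrable lborel (\<lambda>z. norm (u z) powr q)"
    and \<delta>: "\<delta> > 0" and u0: "AE y in lborel. (norm (y - a))\<^sup>2 < 2 * \<delta> \<longrightarrow> u y = 0"
    and \<epsilon>: "\<epsilon> > 0"
  shows "ennreal (norm (\<integral> y. (u y * pole \<delta> (y - a) ^ N) * of_real (moll \<epsilon> (y - x)) \<partial>lborel))
    \<le> (\<integral>\<^sup>+ y. ennreal (norm (g y * pole \<delta> (y - a) ^ N) / norm (x - y)) \<partial>lborel)"
    (is "_ \<le> ?J")
proof -
  note [measurable] = borel_measurable_pole[OF \<delta>, of a]
  define F where "F y = u y * pole \<delta> (y - a) ^ N" for y
  have Fm [measurable]: "F \<in> borel_measurable borel" unfolding F_def[abs_def] by measurable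
  define D where "D = (1 / sqrt \<delta>) ^ N"
  have D: "D \<ge> 0" using \<delta> by (simp add: D_def)
  have FD: "norm (F y) \<le> D * norm (u y)" for y
  proof -
    have "norm (pole \<delta> (y - a)) ^ N \<le> D"
      unfolding D_def by (intro power_mono norm_pole_le_const \<delta>) simp
    then have "norm (u y) * norm (pole \<delta> (y - a)) ^ N \<le> norm (u y) * D"
      by (intro mult_left_mono) auto
    then show ?thesis by (simp add: F_def norm_mult norm_power mult.commute)
  qed
  have Fq: "integrable lborel (\<lambda>y. norm (F y) powr q)"
  proof (rule Bochner_Integration.integrable_bound)
    show "integrable lborel (\<lambda>y. D powr q * norm (u y) powr q)"
      by (intro integrable_mult_right uq)
    show "AE y in lborel. norm (norm (F y) powr q) \<le> norm (D powr q * norm (u y) powr q)"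
    proof (rule AE_I2)
      fix y
      have "norm (F y) powr q \<le> (D * norm (u y)) powr q"
        using q by (intro powr_mono2 FD) auto
      then show "norm (norm (F y) powr q) \<le> norm (D powr q * norm (u y) powr q)"
        using D by (simp add: powr_mult)
    qed
  qed measurable
  have Floc: "integrable lborel (\<lambda>y. indicator (cball x r) y *\<^sub>R F y)" for r
    by (rule Lq_locally_integrable[OF Fm q Fq])
  have "ennreal (norm (\<integral> y. F y * of_real (moll \<epsilon> (y - x)) \<partial>lborel)) \<le> ?J"
  proof (rule ennreal_le_epsilon)
    fix e :: real assume e: "0 < e"
    obtain R where R: "R \<ge> \<epsilon>" "R > 0"
      "ennreal (norm (\<integral> y. F y * of_real (moll R (y - x)) \<partial>lborel)) \<le> ennreal e"
      using moll_average_vanishes[OF Fm q Fq e, of \<epsilon> x] by blast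
    \<comment> \<open>Cuts the Cauchy kernel off both near \<open>x\<close> and far away, which
      yields compact support. As \<open>R \<ge> \<epsilon>\<close>, it stays between 0 and 1, so the
      truncated kernel remains below \<open>1 / norm (x - y)\<close>.\<close>
    define \<rho> where "\<rho> t = cutoff (t / \<epsilon>) - cutoff (t / R)" for t
    have \<rho>01: "0 \<le> \<rho> t" "\<rho> t \<le> 1" if "0 \<le> t" for t
    proof -
      have "t / R \<le> t / \<epsilon>" using that R \<epsilon> by (intro divide_left_mono) auto
      then show "0 \<le> \<rho> t" "\<rho> t \<le> 1"
        using cutoff_mono[of "t / R" "t / \<epsilon>"] cutoff_le_1[of "t / \<epsilon>"] cutoff_nonneg[of "t / R"]
        by (auto simp: \<rho>_def)
    qed
    have \<rho>0: "\<rho> t = 0" if "t < \<epsilon>" for t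
      using that R \<epsilon> by (simp add: \<rho>_def cutoff_eq_0 field_simps)
    have \<rho>big: "\<rho> t = 0" if "2 * R \<le> t" for t
    proof -
      have "2 \<le> t / \<epsilon>" "2 \<le> t / R" using that R \<epsilon> by (simp_all add: field_simps)
      then show ?thesis by (simp add: \<rho>_def cutoff_eq_1)
    qed
    have Ck\<rho>: "Ck k \<rho>" for k
      using Ck_add[OF Ck_cutoff_scale[of k \<epsilon>] Ck_mult[OF Ck_const[of k "- 1"] Ck_cutoff_scale[of k R]]]
      by (simp add: \<rho>_def[abs_def])
    have D\<rho>: "(\<rho> has_real_derivative cutoff' (t / \<epsilon>) / \<epsilon> - cutoff' (t / R) / R) (at t)" for t
      unfolding \<rho>_def[abs_def] by (rule DERIV_diff[OF DERIV_cutoff_scale DERIV_cutoff_scale])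
    define P where "P y = cpole \<rho> (y - x)" for y
    define W where "W y = pole \<delta> (y - a) ^ N" for y
    define \<psi> where "\<psi> y = P y * W y" for y
    have CkP: "Ck k P" for k
      unfolding P_def[abs_def] by (rule Ck_cpole[OF Ck\<rho> \<epsilon> \<rho>0])
    have CkW: "Ck k W" for k
      unfolding W_def[abs_def] by (rule Ck_power[OF Ck_pole[OF \<delta>]])
    have Ck\<psi>: "Ck k \<psi>" for k
      unfolding \<psi>_def[abs_def] by (rule Ck_mult[OF CkP CkW])
    have "{z. \<psi> z \<noteq> 0} \<subseteq> cball x (sqrt (2 * R))"
    proof
      fix z assume "z \<in> {z. \<psi> z \<noteq> 0}"
      then have "\<rho> ((norm (z - x))\<^sup>2) \<noteq> 0" by (auto simp: \<psi>_def P_def cpole_def)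
      then have "(norm (z - x))\<^sup>2 < 2 * R" using \<rho>big not_le by blast
      then have "norm (z - x) < sqrt (2 * R)" by (rule real_less_rsqrt)
      then show "z \<in> cball x (sqrt (2 * R))" by (simp add: dist_norm norm_minus_commute)
    qed
    then have "bounded {z. \<psi> z \<noteq> 0}" using bounded_cball bounded_subset by blast
    then have test: "test_function \<psi>"
      by (simp add: test_function_def smooth_def Ck\<psi> compact_closure)
    have dP: "dbar P y = of_real (moll \<epsilon> (y - x) - moll R (y - x))" for y
      unfolding P_def[abs_def] moll_def by (rule dbar_cpole[OF D\<rho> \<epsilon> \<rho>0])
    have diff: "P differentiable (at y)" "(\<lambda>y. pole \<delta> (y - a)) differentiable (at y)" "W differentiable (at y)" for y
      using Ck_SucD(1)[OF CkP] Ck_SucD(1)[OF Ck_pole[OF \<delta>]] Ck_SucD(1)[OF CkW]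
      unfolding differentiable_def by blast+
    have ae: "AE y in lborel. u y * dbar \<psi> y = F y * of_real (moll \<epsilon> (y - x)) - F y * of_real (moll R (y - x))"
      using u0
    proof eventually_elim
      case (elim y)
      show ?case
      proof (cases "u y = 0")
        case True
        then show ?thesis by (simp add: F_def)
      next
        \<comment> \<open>Here \<open>y\<close> lies where the cutoff in the weight is already
          constant 1, so \<open>dbar\<close> annihilates the weight and falls on the Cauchy kernel
          alone.\<close>
        case False
        then have "2 \<le> (norm (y - a))\<^sup>2 / \<delta>" using elim \<delta> by (simp add: field_simps not_less)
        then have "dbar (\<lambda>y. pole \<delta> (y - a)) y = 0"
          by (simp add: dbar_pole[OF \<delta>] cutoff'_eq_0)
        then have "dbar W y = 0"
          unfolding W_def[abs_def] by (rule dbar_power_eq_0[OF diff(2)])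
        then have eq: "dbar \<psi> y = of_real (moll \<epsilon> (y - x) - moll R (y - x)) * W y"
          unfolding \<psi>_def[abs_def] by (simp add: dbar_mult[OF diff(1,3)] dP)
        show ?thesis unfolding eq F_def W_def by (simp add: algebra_simps)
      qed
    qed
    have [measurable]: "dbar \<psi> \<in> borel_measurable borel"
      by (rule borel_measurable_continuous_onI[OF continuous_on_dbar[OF Ck\<psi>]])
    have iF: "integrable lborel (\<lambda>y. F y * of_real (moll r (y - x)))" if "r > 0" for r
      by (rule integrable_mult_moll[OF Fm Floc that])
    have "(\<integral> y. u y * dbar \<psi> y \<partial>lborel)
        = (\<integral> y. F y * of_real (moll \<epsilon> (y - x)) - F y * of_real (moll R (y - x)) \<partial>lborel)"
      by (rule integral_cong_AE) (use ae in measurable)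
    also have "\<dots> = (\<integral> y. F y * of_real (moll \<epsilon> (y - x)) \<partial>lborel) - (\<integral> y. F y * of_real (moll R (y - x)) \<partial>lborel)"
      by (rule Bochner_Integration.integral_diff[OF iF[OF \<epsilon>] iF[OF R(2)]])
    finally have "(\<integral> y. F y * of_real (moll \<epsilon> (y - x)) \<partial>lborel)
        = (\<integral> y. F y * of_real (moll R (y - x)) \<partial>lborel) - (\<integral> y. g y * \<psi> y \<partial>lborel)"
      using weak[OF test] by simp
    then have "norm (\<integral> y. F y * of_real (moll \<epsilon> (y - x)) \<partial>lborel)
        = norm ((\<integral> y. F y * of_real (moll R (y - x)) \<partial>lborel) - (\<integral> y. g y * \<psi> y \<partial>lborel))"
      by (rule arg_cong)
    also have "\<dots> \<le> norm (\<integral> y. F y * of_real (moll R (y - x)) \<partial>lborel) + norm (\<integral> y. g y * \<psi> y \<partial>lborel)"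
      by (rule norm_triangle_ineq4)
    finally have "norm (\<integral> y. F y * of_real (moll \<epsilon> (y - x)) \<partial>lborel)
        \<le> norm (\<integral> y. g y * \<psi> y \<partial>lborel) + norm (\<integral> y. F y * of_real (moll R (y - x)) \<partial>lborel)"
      by (simp only: add.commute)
    then have "ennreal (norm (\<integral> y. F y * of_real (moll \<epsilon> (y - x)) \<partial>lborel))
        \<le> ennreal (norm (\<integral> y. g y * \<psi> y \<partial>lborel)) + ennreal (norm (\<integral> y. F y * of_real (moll R (y - x)) \<partial>lborel))"
      by (simp add: ennreal_plus[symmetric] del: ennreal_plus)
    also have "\<dots> \<le> ?J + ennreal e"
    proof (rule add_mono[OF _ R(3)])
      have "ennreal (norm (\<integral> y. g y * \<psi> y \<partial>lborel)) \<le> (\<integral>\<^sup>+ y. ennreal (norm (g y * \<psi> y)) \<partial>lborel)"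
        by (rule norm_integral_le_nn_integral)
      also have "\<dots> \<le> ?J"
      proof (intro nn_integral_mono ennreal_leI)
        fix y
        have "norm (P y) \<le> 1 / norm (x - y)"
          unfolding P_def norm_cpole using \<rho>01[of "(norm (y - x))\<^sup>2"]
          by (simp add: norm_minus_commute divide_right_mono)
        then have "norm (g y * W y) * norm (P y) \<le> norm (g y * W y) * (1 / norm (x - y))"
          by (intro mult_left_mono) auto
        then show "norm (g y * \<psi> y) \<le> norm (g y * pole \<delta> (y - a) ^ N) / norm (x - y)"
          by (simp add: \<psi>_def W_def norm_mult mult_ac)
      qed
      finally show "ennreal (norm (\<integral> y. g y * \<psi> y \<partial>lborel)) \<le> ?J" .
    qed
    finally show "ennreal (norm (\<integral> y. F y * of_real (moll \<epsilon> (y - x)) \<partial>lborel)) \<le> ?J + ennreal e" .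
  qed
  then show ?thesis by (simp add: F_def)
qed

text \<open>The potential of a function in L^p need not be finite everywhere, but differentiating
  its averages requires local integrability. This follows by pairing with the indicator of a cube in
  the bilinear inequality.\<close>

lemma kernel_integral_locally_finite:
  fixes h :: "real \<times> real \<Rightarrow> real"
  assumes [measurable]: "h \<in> borel_measurable borel" and h0: "\<And>y. 0 \<le> h y"
    and p: "1 < p" "p < 2" and hp: "(\<integral>\<^sup>+ y. ennreal (h y powr p) \<partial>lborel) < \<infinity>"
  shows "(\<integral>\<^sup>+ x. indicator (cbox a b) x * (\<integral>\<^sup>+ y. ennreal (h y / norm (x - y)) \<partial>lborel) \<partial>lborel) < \<infinity>"
proof -
  \<comment> \<open>The partner exponent of \<open>p\<close> in the bilinear inequality; it lies
    between 1 and 2 because \<open>p\<close> does.\<close>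
  define s where "s = 1 / (3 / 2 - 1 / p)"
  have "1 / 2 < 1 / p" "1 / p < 1" using p by (auto simp: field_simps)
  then have s: "1 < s" "s < 2" "1 / s + 1 / p = 3 / 2" by (auto simp: s_def field_simps)
  obtain C where C: "C > 0"
    "\<And>f g :: real \<times> real \<Rightarrow> real. f \<in> borel_measurable borel \<Longrightarrow> g \<in> borel_measurable borel \<Longrightarrow>
      (\<And>x. 0 \<le> f x) \<Longrightarrow> (\<And>x. 0 \<le> g x) \<Longrightarrow>
      (\<integral>\<^sup>+ x. ennreal (f x powr s) \<partial>lborel) \<le> 1 \<Longrightarrow> (\<integral>\<^sup>+ y. ennreal (g y powr p) \<partial>lborel) \<le> 1 \<Longrightarrow>
      (\<integral>\<^sup>+ x. \<integral>\<^sup>+ y. ennreal (f x * g y / norm (x - y)) \<partial>lborel \<partial>lborel) \<le> ennreal C"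
    by (rule Hardy_Littlewood_Sobolev_bilinear[OF s(1,2) p s(3)]) blast
  have [measurable]: "cbox a b \<in> sets (borel :: (real \<times> real) measure)" by simp
  have scale: "\<exists>c\<ge>1. (\<integral>\<^sup>+ y. ennreal ((k y / c) powr r) \<partial>lborel) \<le> 1"
    if [measurable]: "k \<in> borel_measurable borel" and k0: "\<And>y. 0 \<le> k y" and r: "1 < r"
      and fin: "(\<integral>\<^sup>+ y. ennreal (k y powr r) \<partial>lborel) < \<infinity>"
    for k :: "real \<times> real \<Rightarrow> real" and r :: real
  proof -
    obtain B where B: "(\<integral>\<^sup>+ y. ennreal (k y powr r) \<partial>lborel) = ennreal B" "B \<ge> 0"
      using fin by (cases "\<integral>\<^sup>+ y. ennreal (k y powr r) \<partial>lborel") auto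
    \<comment> \<open>With \<open>c \<ge> 1\<close> and \<open>r > 1\<close>, dividing by
      \<open>c powr r\<close> is at least as good as dividing by \<open>c\<close>, and
      \<open>B / c \<le> 1\<close>; no root has to be taken.\<close>
    define c where "c = max 1 B"
    have c: "c \<ge> 1" "c \<ge> B" by (auto simp: c_def)
    have "ennreal ((k y / c) powr r) \<le> ennreal (1 / c) * ennreal (k y powr r)" for y
    proof -
      have "c powr 1 \<le> c powr r" using c r by (intro powr_mono) auto
      then have "k y powr r / c powr r \<le> k y powr r / c" using c by (intro divide_left_mono) auto
      then show ?thesis using c k0[of y] by (simp add: powr_divide ennreal_mult[symmetric] ennreal_leI)
    qed
    then have "(\<integral>\<^sup>+ y. ennreal ((k y / c) powr r) \<partial>lborel) \<le> (\<integral>\<^sup>+ y. ennreal (1 / c) * ennreal (k y powr r) \<partial>lborel)"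
      by (rule nn_integral_mono)
    also have "\<dots> = ennreal (1 / c) * ennreal B"
      unfolding B(1)[symmetric] by (rule nn_integral_cmult) measurable
    also have "\<dots> = ennreal (B / c)" using c B by (simp add: ennreal_mult[symmetric])
    also have "\<dots> \<le> 1" using c B by simp
    finally show ?thesis using c by blast
  qed
  have "(\<integral>\<^sup>+ x. ennreal (indicator (cbox a b) x powr s) \<partial>lborel) = emeasure lborel (cbox a b)"
  proof (subst nn_integral_indicator[symmetric])
    have "ennreal (indicator (cbox a b) x powr s) = indicator (cbox a b) x" for x
      using s by (cases "x \<in> cbox a b") auto
    then show "(\<integral>\<^sup>+ x. ennreal (indicator (cbox a b) x powr s) \<partial>lborel) = (\<integral>\<^sup>+ x. indicator (cbox a b) x \<partial>lborel)"
      by simp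
  qed simp
  then have "(\<integral>\<^sup>+ x. ennreal (indicator (cbox a b) x powr s) \<partial>lborel) < \<infinity>"
    by (simp only: emeasure_lborel_cbox_finite)
  then obtain A where A: "A \<ge> 1" "(\<integral>\<^sup>+ x. ennreal ((indicator (cbox a b) x / A) powr s) \<partial>lborel) \<le> 1"
    using scale[of "indicator (cbox a b)" s] s by auto
  obtain B where B: "B \<ge> 1" "(\<integral>\<^sup>+ x. ennreal ((h x / B) powr p) \<partial>lborel) \<le> 1"
    using scale[of h p] p hp h0 by auto
  have "(\<integral>\<^sup>+ x. indicator (cbox a b) x * (\<integral>\<^sup>+ y. ennreal (h y / norm (x - y)) \<partial>lborel) \<partial>lborel)
    = (\<integral>\<^sup>+ x. ennreal (A * B) * (\<integral>\<^sup>+ y. ennreal (indicator (cbox a b) x / A * (h y / B) / norm (x - y)) \<partial>lborel) \<partial>lborel)"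
  proof (rule nn_integral_cong)
    fix x
    show "indicator (cbox a b) x * (\<integral>\<^sup>+ y. ennreal (h y / norm (x - y)) \<partial>lborel)
      = ennreal (A * B) * (\<integral>\<^sup>+ y. ennreal (indicator (cbox a b) x / A * (h y / B) / norm (x - y)) \<partial>lborel)"
    proof (cases "x \<in> cbox a b")
      case True
      have "ennreal (A * B) * (\<integral>\<^sup>+ y. ennreal (1 / A * (h y / B) / norm (x - y)) \<partial>lborel)
        = (\<integral>\<^sup>+ y. ennreal (A * B) * ennreal (1 / A * (h y / B) / norm (x - y)) \<partial>lborel)"
        by (rule nn_integral_cmult[symmetric]) measurable
      also have "\<dots> = (\<integral>\<^sup>+ y. ennreal (h y / norm (x - y)) \<partial>lborel)"
        using A(1) B(1) h0 by (intro nn_integral_cong) (simp add: ennreal_mult[symmetric])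
      finally show ?thesis using True by simp
    qed simp
  qed
  also have "\<dots> = ennreal (A * B) * (\<integral>\<^sup>+ x. \<integral>\<^sup>+ y. ennreal (indicator (cbox a b) x / A * (h y / B) / norm (x - y)) \<partial>lborel \<partial>lborel)"
    by (rule nn_integral_cmult) measurable
  also have "\<dots> \<le> ennreal (A * B) * ennreal C"
    by (intro mult_left_mono C(2) A(2) B(2)) (use A(1) B(1) h0 in auto)
  also have "\<dots> < \<infinity>" by (simp add: ennreal_mult_less_top)
  finally show ?thesis .
qed

text \<open>The potential dominates all mollifications of the weighted function, hence almost
  everywhere the function itself. The factor \<open>moll_mass\<close> depends neither on
  \<open>N\<close> nor on \<open>\<delta>\<close>, and this uniformity is what allows
  \<open>N\<close> to tend to infinity.\<close>

lemma weighted_cauchy_estimate: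
  fixes u g :: "real \<times> real \<Rightarrow> complex"
  assumes u [measurable]: "u \<in> borel_measurable borel" and g [measurable]: "g \<in> borel_measurable borel"
    and weak: "\<And>\<phi>. test_function \<phi> \<Longrightarrow> (\<integral> z. g z * \<phi> z \<partial>lborel) = - (\<integral> z. u z * dbar \<phi> z \<partial>lborel)"
    and q: "1 < q" and uq: "integrable lborel (\<lambda>z. norm (u z) powr q)"
    and p: "1 < p" "p < 2" and gp: "(\<integral>\<^sup>+ z. ennreal (norm (g z) powr p) \<partial>lborel) < \<infinity>"
    and \<delta>: "\<delta> > 0" and u0: "AE y in lborel. (norm (y - a))\<^sup>2 < 2 * \<delta> \<longrightarrow> u y = 0"
  shows "AE x in lborel. ennreal (moll_mass * (norm (u x) * norm (pole \<delta> (x - a)) ^ N))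
    \<le> (\<integral>\<^sup>+ y. ennreal (norm (g y) * norm (pole \<delta> (y - a)) ^ N / norm (x - y)) \<partial>lborel)"
proof -
  note [measurable] = borel_measurable_pole[OF \<delta>, of a]
  define D where "D = (1 / sqrt \<delta>) ^ N"
  have D: "D \<ge> 0" using \<delta> by (simp add: D_def)
  have PD: "norm (pole \<delta> (y - a)) ^ N \<le> D" for y
    unfolding D_def by (intro power_mono norm_pole_le_const \<delta>) simp
  have bound: "norm (v * pole \<delta> (y - a) ^ N) powr r \<le> D powr r * norm v powr r" if "r > 0" for r y v
  proof -
    have "norm v * norm (pole \<delta> (y - a)) ^ N \<le> norm v * D"
      by (intro mult_left_mono PD) auto
    then have "(norm v * norm (pole \<delta> (y - a)) ^ N) powr r \<le> (norm v * D) powr r"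
      using that by (intro powr_mono2) auto
    then show ?thesis using D by (simp add: norm_mult norm_power powr_mult mult.commute)
  qed
  define F where "F y = u y * pole \<delta> (y - a) ^ N" for y
  have Fm [measurable]: "F \<in> borel_measurable borel" unfolding F_def[abs_def] by measurable
  have Fq: "integrable lborel (\<lambda>y. norm (F y) powr q)"
  proof (rule Bochner_Integration.integrable_bound)
    show "integrable lborel (\<lambda>y. D powr q * norm (u y) powr q)"
      by (intro integrable_mult_right uq)
    show "AE y in lborel. norm (norm (F y) powr q) \<le> norm (D powr q * norm (u y) powr q)"
      using bound[of q] q by (intro AE_I2) (simp add: F_def)
  qed measurable
  define h where "h y = norm (g y * pole \<delta> (y - a) ^ N)" for y
  have [measurable]: "h \<in> borel_measurable borel" unfolding h_def[abs_def] by measurable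
  have "(\<integral>\<^sup>+ y. ennreal (h y powr p) \<partial>lborel) \<le> (\<integral>\<^sup>+ y. ennreal (D powr p) * ennreal (norm (g y) powr p) \<partial>lborel)"
    using bound[of p] p by (intro nn_integral_mono) (simp add: h_def ennreal_mult[symmetric] ennreal_leI)
  also have "\<dots> = ennreal (D powr p) * (\<integral>\<^sup>+ y. ennreal (norm (g y) powr p) \<partial>lborel)"
    by (rule nn_integral_cmult) measurable
  also have "\<dots> < \<infinity>" using gp by (simp add: ennreal_mult_less_top)
  finally have hp: "(\<integral>\<^sup>+ y. ennreal (h y powr p) \<partial>lborel) < \<infinity>" .
  have "AE x in lborel. ennreal (moll_mass * norm (F x)) \<le> (\<integral>\<^sup>+ y. ennreal (h y / norm (x - y)) \<partial>lborel)"
  proof (rule AE_le_of_mollified[OF Fm])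
    show "integrable lborel (\<lambda>y. indicator (cball 0 r) y *\<^sub>R F y)" for r
      by (rule Lq_locally_integrable[OF Fm q Fq])
    show "(\<integral>\<^sup>+ x. indicator (cbox c d) x * (\<integral>\<^sup>+ y. ennreal (h y / norm (x - y)) \<partial>lborel) \<partial>lborel) < \<infinity>" for c d
      by (rule kernel_integral_locally_finite[OF _ _ p hp]) (auto simp: h_def)
    show "ennreal (norm (\<integral> y. F y * of_real (moll \<epsilon> (y - x)) \<partial>lborel))
        \<le> (\<integral>\<^sup>+ y. ennreal (h y / norm (x - y)) \<partial>lborel)" if "\<epsilon> > 0" for x \<epsilon>
      unfolding F_def h_def by (rule cauchy_kernel_bound[OF u g weak q uq \<delta> u0 that])
  qed measurable
  then show ?thesis by (simp add: F_def h_def norm_mult norm_power)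
qed

section \<open>Unique continuation\<close>

lemma exponent_sum:
  fixes p q :: real
  assumes "0 < p" and pq: "1 / p - 1 / q = 1 / 2"
  shows "p / 2 + p / q = 1"
proof -
  have "p / 2 + p / q = p * (1 / 2 + 1 / q)" by (simp add: algebra_simps)
  also have "1 / 2 + 1 / q = 1 / p" using pq by simp
  finally show ?thesis using assms by simp
qed

lemma young_powr:
  fixes p q v f :: real
  assumes p: "1 < p" "p < 2" and q: "2 < q" and pq: "1 / p - 1 / q = 1 / 2" and "0 \<le> v" "0 \<le> f"
  shows "(v * f) powr p \<le> p / 2 * v powr 2 + p / q * f powr q"
proof -
  have sum: "1 / (2 / p) + 1 / (q / p) = 1"
    using exponent_sum[OF _ pq] p by simp
  have "v powr p * f powr p \<le> (v powr p) powr (2 / p) / (2 / p) + (f powr p) powr (q / p) / (q / p)"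
    using p q by (intro Youngs_inequality sum) auto
  then show ?thesis using p assms by (simp add: powr_mult powr_powr mult.commute)
qed

text \<open>Young's inequality for \<open>v / \<alpha>\<close> and \<open>f / X\<close>, integrated;
  the weights p/2 and p/q add up to 1. Here \<open>\<alpha>\<close> and \<open>X\<close> are any
  positive upper bounds for the norms, so \<open>v\<close> may vanish identically.\<close>

lemma Hoelder_powr:
  fixes p q \<alpha> X :: real and v f :: "'a \<Rightarrow> real"
  assumes p: "1 < p" "p < 2" and q: "2 < q" and pq: "1 / p - 1 / q = 1 / 2"
    and [measurable]: "v \<in> borel_measurable M" "f \<in> borel_measurable M"
    and v0: "\<And>x. 0 \<le> v x" and f0: "\<And>x. 0 \<le> f x" and \<alpha>: "0 < \<alpha>" and X: "0 < X"
    and v: "(\<integral>\<^sup>+ x. ennreal (v x powr 2) \<partial>M) \<le> ennreal (\<alpha> powr 2)"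
    and f: "(\<integral>\<^sup>+ x. ennreal (f x powr q) \<partial>M) \<le> ennreal (X powr q)"
  shows "(\<integral>\<^sup>+ x. ennreal ((v x * f x) powr p) \<partial>M) \<le> ennreal ((\<alpha> * X) powr p)"
proof -
  define c1 where "c1 = (\<alpha> * X) powr p * (p / 2) / \<alpha> powr 2"
  define c2 where "c2 = (\<alpha> * X) powr p * (p / q) / X powr q"
  have c: "0 \<le> c1" "0 \<le> c2" using p q by (auto simp: c1_def c2_def)
  have "ennreal ((v x * f x) powr p) \<le> ennreal c1 * ennreal (v x powr 2) + ennreal c2 * ennreal (f x powr q)" for x
  proof -
    have "(v x * f x) powr p = (\<alpha> * X * (v x / \<alpha> * (f x / X))) powr p"
      using \<alpha> X by simp
    also have "\<dots> = (\<alpha> * X) powr p * (v x / \<alpha> * (f x / X)) powr p"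
      by (rule powr_mult)
    also have "\<dots> \<le> (\<alpha> * X) powr p * (p / 2 * (v x / \<alpha>) powr 2 + p / q * (f x / X) powr q)"
      using \<alpha> X v0[of x] f0[of x] by (intro mult_left_mono young_powr p q pq) auto
    also have "\<dots> = c1 * v x powr 2 + c2 * f x powr q"
      using \<alpha> X v0[of x] f0[of x] by (simp only: c1_def c2_def powr_divide distrib_left) simp
    finally show ?thesis using c by (simp add: ennreal_mult[symmetric] ennreal_plus[symmetric] ennreal_leI del: ennreal_plus)
  qed
  then have "(\<integral>\<^sup>+ x. ennreal ((v x * f x) powr p) \<partial>M)
      \<le> (\<integral>\<^sup>+ x. (ennreal c1 * ennreal (v x powr 2) + ennreal c2 * ennreal (f x powr q)) \<partial>M)"
    by (rule nn_integral_mono)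
  also have "\<dots> = ennreal c1 * (\<integral>\<^sup>+ x. ennreal (v x powr 2) \<partial>M) + ennreal c2 * (\<integral>\<^sup>+ x. ennreal (f x powr q) \<partial>M)"
    by (subst nn_integral_add) (auto simp: nn_integral_cmult)
  also have "\<dots> \<le> ennreal c1 * ennreal (\<alpha> powr 2) + ennreal c2 * ennreal (X powr q)"
    by (intro add_mono mult_left_mono v f) auto
  also have "\<dots> = ennreal (c1 * \<alpha> powr 2 + c2 * X powr q)"
    using c by (simp add: ennreal_mult[symmetric] ennreal_plus[symmetric] del: ennreal_plus)
  also have "c1 * \<alpha> powr 2 + c2 * X powr q = (\<alpha> * X) powr p * (p / 2 + p / q)"
    unfolding c1_def c2_def using \<alpha> X by (simp add: distrib_left)
  also have "\<dots> = (\<alpha> * X) powr p"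
    using exponent_sum[OF _ pq] p by simp
  finally show ?thesis .
qed

text \<open>With the closed disc removed, the annuli decrease to the empty set, and dominated
  convergence applies. The width obtained depends on \<open>R\<close>.\<close>

lemma small_annulus:
  fixes w :: "real \<times> real \<Rightarrow> real"
  assumes w: "integrable lborel w" and e: "e > 0"
  obtains R1 where "R1 > R" "(\<integral> y. indicator (ball a R1 - cball a R) y * w y \<partial>lborel) < e"
proof -
  have [measurable]: "w \<in> borel_measurable borel" using borel_measurable_integrable[OF w] by simp
  have [measurable]: "ball a r - cball a R \<in> sets borel" for r by simp
  let ?A = "\<lambda>n. ball a (R + 1 / real (Suc n)) - cball a R"
  have "(\<lambda>n. \<integral> y. indicator (?A n) y * w y \<partial>lborel) \<longlonglongrightarrow> (\<integral> y. 0 \<partial>(lborel :: (real \<times> real) measure))"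
  proof (rule integral_dominated_convergence[where w = "\<lambda>y. norm (w y)"])
    show "AE y in lborel. (\<lambda>n. indicator (?A n) y * w y) \<longlonglongrightarrow> 0"
    proof (rule AE_I2)
      fix y
      have "\<forall>\<^sub>F n in sequentially. y \<notin> ?A n"
      proof (cases "dist a y \<le> R")
        case True
        then show ?thesis by simp
      next
        case False
        have "(\<lambda>n. R + 1 / real (Suc n)) \<longlonglongrightarrow> R + 0"
          by (intro tendsto_add tendsto_const LIMSEQ_Suc[OF lim_1_over_n])
        then have "\<forall>\<^sub>F n in sequentially. R + 1 / real (Suc n) < dist a y"
          using False by (intro order_tendstoD(2)) auto
        then show ?thesis by eventually_elim simp
      qed
      then have "\<forall>\<^sub>F n in sequentially. indicator (?A n) y * w y = 0"
        by eventually_elim simp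
      then show "(\<lambda>n. indicator (?A n) y * w y) \<longlonglongrightarrow> 0" by (rule tendsto_eventually)
    qed
    show "integrable lborel (\<lambda>y. norm (w y))" using w by simp
    show "AE y in lborel. norm (indicator (?A n) y * w y) \<le> norm (w y)" for n
      by (intro AE_I2) (simp add: indicator_def)
  qed measurable
  then have "(\<lambda>n. \<integral> y. indicator (?A n) y * w y \<partial>lborel) \<longlonglongrightarrow> 0" by simp
  from order_tendstoD(2)[OF this e] obtain n where "(\<integral> y. indicator (?A n) y * w y \<partial>lborel) < e"
    by (auto simp: eventually_sequentially)
  then show thesis using that[of "R + 1 / real (Suc n)"] by simp
qed

text \<open>Working with \<open>p\<close>-th powers makes the contributions of the annulus and of
  the exterior additive. The annulus gives at most half of the left-hand side; the exterior carries
  the weight at radius \<open>R1\<close>. On a disc of intermediate radius \<open>R2\<close> the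
  weight is at least \<open>(1 / R2) ^ N\<close>, so \<open>u\<close> is there of order
  \<open>(R2 / R1) ^ N\<close> for every \<open>N\<close>.\<close>

lemma unique_continuation_step:
  fixes u g V :: "real \<times> real \<Rightarrow> complex"
  assumes p: "1 < p" "p < 2" and q: "2 < q" and pq: "1 / p - 1 / q = 1 / 2"
    and u [measurable]: "u \<in> borel_measurable borel" and g [measurable]: "g \<in> borel_measurable borel"
    and V [measurable]: "V \<in> borel_measurable borel"
    and weak: "\<And>\<phi>. test_function \<phi> \<Longrightarrow> (\<integral> z. g z * \<phi> z \<partial>lborel) = - (\<integral> z. u z * dbar \<phi> z \<partial>lborel)"
    and uq: "integrable lborel (\<lambda>z. norm (u z) powr q)"
    and V2: "integrable lborel (\<lambda>z. norm (V z) powr 2)"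
    and gV: "AE z in lborel. norm (g z) \<le> norm (V z) * norm (u z)"
    and R: "R > 0" and u0: "AE y in lborel. y \<in> ball a R \<longrightarrow> u y = 0"
  shows "\<exists>R2>R. AE y in lborel. y \<in> ball a R2 \<longrightarrow> u y = 0"
proof -
  define m where "m = moll_mass"
  have m: "m > 0" by (simp add: m_def moll_mass_pos)
  obtain C where C: "C > 0"
    "\<And>(f :: real \<times> real \<Rightarrow> real) h X b. f \<in> borel_measurable borel \<Longrightarrow> h \<in> borel_measurable borel \<Longrightarrow>
      (\<And>x. 0 \<le> f x) \<Longrightarrow> (\<And>x. 0 \<le> h x) \<Longrightarrow> 0 < b \<Longrightarrow> 0 \<le> X \<Longrightarrow>
      (\<integral>\<^sup>+ x. ennreal (f x powr q) \<partial>lborel) = ennreal (X powr q) \<Longrightarrow>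
      (\<integral>\<^sup>+ y. ennreal (h y powr p) \<partial>lborel) \<le> ennreal (b powr p) \<Longrightarrow>
      AE x in lborel. ennreal (f x) \<le> (\<integral>\<^sup>+ y. ennreal (h y / norm (x - y)) \<partial>lborel) \<Longrightarrow>
      X \<le> C * b"
    by (rule Hardy_Littlewood_Sobolev[OF p q pq]) blast
  \<comment> \<open>Makes the constant of the absorbed term, \<open>C * \<eta> / m\<close>, equal to
    1/2.\<close>
  define \<eta> where "\<eta> = m / (2 * C)"
  have \<eta>: "\<eta> > 0" "C * (\<eta> / m) = 1 / 2" using m C by (auto simp: \<eta>_def)
  obtain R1 where R1: "R1 > R"
    "(\<integral> y. indicator (ball a R1 - cball a R) y * norm (V y) powr 2 \<partial>lborel) < \<eta> powr 2"
    using small_annulus[OF V2, of "\<eta> powr 2" R a] \<eta> by auto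
  define v where "v y = indicator (ball a R1 - cball a R) y * norm (V y)" for y
  have [measurable]: "ball a R1 - cball a R \<in> sets borel" "ball a r \<in> sets borel" for r by auto
  have [measurable]: "v \<in> borel_measurable borel" unfolding v_def[abs_def] by measurable
  have v2: "(\<integral>\<^sup>+ y. ennreal (v y powr 2) \<partial>lborel) \<le> ennreal (\<eta> powr 2)"
  proof -
    have "(\<integral>\<^sup>+ y. ennreal (v y powr 2) \<partial>lborel)
        = (\<integral>\<^sup>+ y. ennreal (indicator (ball a R1 - cball a R) y * norm (V y) powr 2) \<partial>lborel)"
      by (intro nn_integral_cong) (simp add: v_def indicator_def)
    also have "\<dots> = ennreal (\<integral> y. indicator (ball a R1 - cball a R) y * norm (V y) powr 2 \<partial>lborel)"
    proof (rule nn_integral_eq_integral)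
      show "integrable lborel (\<lambda>y. indicator (ball a R1 - cball a R) y * norm (V y) powr 2)"
        by (rule Bochner_Integration.integrable_bound[OF V2]) (auto simp: indicator_def)
    qed simp
    finally show ?thesis using R1(2) by (simp add: ennreal_leI)
  qed
  have "(\<integral>\<^sup>+ y. ennreal ((norm (V y) * norm (u y)) powr p) \<partial>lborel)
      \<le> (\<integral>\<^sup>+ y. ennreal (norm (V y) powr 2 + norm (u y) powr q) \<partial>lborel)"
  proof (intro nn_integral_mono ennreal_leI)
    fix y
    have "(norm (V y) * norm (u y)) powr p \<le> p / 2 * norm (V y) powr 2 + p / q * norm (u y) powr q"
      by (intro young_powr p q pq) auto
    also have "\<dots> \<le> 1 * norm (V y) powr 2 + 1 * norm (u y) powr q"
      using p q by (intro add_mono mult_right_mono) auto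
    finally show "(norm (V y) * norm (u y)) powr p \<le> norm (V y) powr 2 + norm (u y) powr q" by simp
  qed
  also have "\<dots> < \<infinity>"
    using Bochner_Integration.integrable_add[OF V2 uq] by (simp add: integrable_iff_bounded)
  finally have Vup: "(\<integral>\<^sup>+ y. ennreal ((norm (V y) * norm (u y)) powr p) \<partial>lborel) < \<infinity>" .
  then obtain T where T: "(\<integral>\<^sup>+ y. ennreal ((norm (V y) * norm (u y)) powr p) \<partial>lborel) = ennreal T" "T \<ge> 0"
    by (cases "\<integral>\<^sup>+ y. ennreal ((norm (V y) * norm (u y)) powr p) \<partial>lborel") auto
  have gp: "(\<integral>\<^sup>+ z. ennreal (norm (g z) powr p) \<partial>lborel) < \<infinity>"
  proof (rule le_less_trans[OF nn_integral_mono_AE Vup])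
    show "AE z in lborel. ennreal (norm (g z) powr p) \<le> ennreal ((norm (V z) * norm (u z)) powr p)"
      using gV by eventually_elim (use p in \<open>auto intro!: ennreal_leI powr_mono2\<close>)
  qed
  \<comment> \<open>Then \<open>2 * \<delta>\<close> is the square of \<open>R\<close>, so the
    truncated pole is exact outside the disc where \<open>u\<close> is known to vanish.\<close>
  define \<delta> where "\<delta> = R\<^sup>2 / 2"
  have \<delta>: "\<delta> > 0" using R by (simp add: \<delta>_def)
  have \<delta>ball: "(norm (y - a))\<^sup>2 < 2 * \<delta> \<longleftrightarrow> y \<in> ball a R" for y
    using R abs_le_square_iff[of R "norm (y - a)"] by (auto simp: \<delta>_def dist_norm norm_minus_commute not_le[symmetric])
  have u0': "AE y in lborel. (norm (y - a))\<^sup>2 < 2 * \<delta> \<longrightarrow> u y = 0"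
    using u0 unfolding \<delta>ball .
  note [measurable] = borel_measurable_pole[OF \<delta>, of a]
  have "negligible (sphere a R)" by (rule negligible_sphere)
  then have "AE y in lebesgue. y \<notin> sphere a R"
    by (intro AE_not_in) (simp add: negligible_iff_null_sets)
  then have sph: "AE y in lborel. y \<notin> sphere a R" by (simp add: AE_completion_iff)
  define R2 where "R2 = (R + R1) / 2"
  have R2: "R < R2" "R2 < R1" using R1(1) by (auto simp: R2_def)
  have R1pos: "R1 > 0" using R R1(1) by simp
  \<comment> \<open>The factor 2 comes from absorbing half of the left-hand side. Using
    \<open>T + 1\<close> instead of \<open>T\<close> keeps the bound on the norm of \<open>h\<close>
    strictly positive, as the potential inequality requires.\<close>
  define K where "K = 2 * (C / m) powr p * (T + 1)"
  have K: "K \<ge> 0" using T by (simp add: K_def)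
  define Y where "Y = (\<integral> x. indicator (ball a R2) x * norm (u x) powr q \<partial>lborel)"
  have iY: "integrable lborel (\<lambda>x. indicator (ball a R2) x * norm (u x) powr q)"
    by (rule Bochner_Integration.integrable_bound[OF uq]) (auto simp: indicator_def)
  have Y0: "0 \<le> Y" unfolding Y_def by (rule Bochner_Integration.integral_nonneg) simp
  have est: "Y powr (1 / q) \<le> K powr (1 / p) * (R2 / R1) ^ N" for N
  proof -
    define P where "P y = norm (pole \<delta> (y - a)) ^ N" for y
    define W where "W y = norm (u y) * P y" for y
    define f where "f y = indicator (ball a R1) y * W y" for y
    define h where "h y = norm (g y) * P y / m" for y
    have [measurable]: "P \<in> borel_measurable borel" unfolding P_def[abs_def] by measurable
    have [measurable]: "W \<in> borel_measurable borel" unfolding W_def[abs_def] by measurable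
    have [measurable]: "f \<in> borel_measurable borel" unfolding f_def[abs_def] by measurable
    have [measurable]: "h \<in> borel_measurable borel" unfolding h_def[abs_def] by measurable
    have P0: "0 \<le> P y" for y by (simp add: P_def)
    have W0: "0 \<le> W y" for y by (simp add: W_def P0)
    have f0: "0 \<le> f y" for y by (simp add: f_def W0)
    have h0: "0 \<le> h y" for y using m by (simp add: h_def P0)
    have PD: "P y \<le> (1 / sqrt \<delta>) ^ N" for y
      unfolding P_def by (intro power_mono norm_pole_le_const \<delta>) simp
    \<comment> \<open>Finiteness of the norm of \<open>f\<close> for this \<open>N\<close>, without
      which nothing could be absorbed below.\<close>
    have fq: "integrable lborel (\<lambda>y. f y powr q)"
    proof (rule Bochner_Integration.integrable_bound)
      show "integrable lborel (\<lambda>y. ((1 / sqrt \<delta>) ^ N) powr q * norm (u y) powr q)"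
        by (intro integrable_mult_right uq)
      show "AE y in lborel. norm (f y powr q) \<le> norm (((1 / sqrt \<delta>) ^ N) powr q * norm (u y) powr q)"
      proof (rule AE_I2)
        fix y
        have "f y \<le> W y" using W0[of y] by (simp add: f_def indicator_def)
        also have "\<dots> \<le> norm (u y) * (1 / sqrt \<delta>) ^ N"
          unfolding W_def by (intro mult_left_mono PD) simp
        finally have "f y powr q \<le> (norm (u y) * (1 / sqrt \<delta>) ^ N) powr q"
          using q f0 by (intro powr_mono2) auto
        then show "norm (f y powr q) \<le> norm (((1 / sqrt \<delta>) ^ N) powr q * norm (u y) powr q)"
          using \<delta> by (simp add: powr_mult mult.commute)
      qed
    qed measurable
    define I where "I = (\<integral> y. f y powr q \<partial>lborel)"
    have I0: "I \<ge> 0" unfolding I_def by (rule Bochner_Integration.integral_nonneg) simp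
    define X where "X = I powr (1 / q)"
    have X0: "X \<ge> 0" by (simp add: X_def)
    have Xq: "X powr q = I" using q I0 by (simp add: X_def powr_powr)
    have fX: "(\<integral>\<^sup>+ y. ennreal (f y powr q) \<partial>lborel) = ennreal (X powr q)"
      unfolding Xq I_def by (rule nn_integral_eq_integral[OF fq]) simp
    define r where "r = (1 / R1) ^ N"
    have r: "r > 0" using R1pos by (simp add: r_def)
    have Xle: "X \<le> K powr (1 / p) * r"
    proof (cases "X = 0")
      case True
      then show ?thesis using r by simp
    next
      case False
      then have X: "X > 0" using X0 by simp
      have fh: "AE x in lborel. ennreal (f x) \<le> (\<integral>\<^sup>+ y. ennreal (h y / norm (x - y)) \<partial>lborel)"
      proof (rule eventually_mono)
        have "1 < q" using q by simp
        show "AE x in lborel. ennreal (moll_mass * (norm (u x) * norm (pole \<delta> (x - a)) ^ N))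
          \<le> (\<integral>\<^sup>+ y. ennreal (norm (g y) * norm (pole \<delta> (y - a)) ^ N / norm (x - y)) \<partial>lborel)"
          by (rule weighted_cauchy_estimate[OF u g weak \<open>1 < q\<close> uq p gp \<delta> u0'])
        fix x
        assume *: "ennreal (moll_mass * (norm (u x) * norm (pole \<delta> (x - a)) ^ N))
          \<le> (\<integral>\<^sup>+ y. ennreal (norm (g y) * norm (pole \<delta> (y - a)) ^ N / norm (x - y)) \<partial>lborel)"
        have "ennreal (f x) \<le> ennreal (W x)"
          using W0[of x] by (intro ennreal_leI) (simp add: f_def indicator_def)
        also have "\<dots> = ennreal (1 / m) * ennreal (m * W x)"
          using m W0[of x] by (simp add: ennreal_mult[symmetric])
        also have "\<dots> \<le> ennreal (1 / m) * (\<integral>\<^sup>+ y. ennreal (norm (g y) * P y / norm (x - y)) \<partial>lborel)"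
          using * by (intro mult_left_mono) (simp_all add: m_def W_def P_def)
        also have "\<dots> = (\<integral>\<^sup>+ y. ennreal (1 / m) * ennreal (norm (g y) * P y / norm (x - y)) \<partial>lborel)"
          by (rule nn_integral_cmult[symmetric]) measurable
        also have "\<dots> = (\<integral>\<^sup>+ y. ennreal (h y / norm (x - y)) \<partial>lborel)"
          using m P0 by (intro nn_integral_cong) (simp add: h_def ennreal_mult[symmetric] mult.commute)
        finally show "ennreal (f x) \<le> (\<integral>\<^sup>+ y. ennreal (h y / norm (x - y)) \<partial>lborel)" .
      qed
      \<comment> \<open>Three regions: in the disc of radius \<open>R\<close> the bound on
        \<open>g\<close> forces \<open>h\<close> to vanish; in the annulus \<open>V\<close> is
        \<open>v\<close> and the weighted \<open>u\<close> is \<open>f\<close>; outside radius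
        \<open>R1\<close> the weight is at most \<open>r\<close>. The sphere of radius
        \<open>R\<close> belongs to none of them and is discarded as a null set.\<close>
      have hpt: "AE y in lborel. h y powr p \<le> (1 / m) powr p * (v y * f y) powr p
          + ((1 / m) powr p * r powr p) * (norm (V y) * norm (u y)) powr p"
        using gV u0 sph
      proof eventually_elim
        case (elim y)
        show ?case
        proof (cases "u y = 0")
          case True
          then have "h y = 0" using elim by (simp add: h_def)
          then show ?thesis by simp
        next
          case False
          then have out: "y \<notin> cball a R" using elim by auto
          have hle: "h y \<le> 1 / m * (norm (V y) * norm (u y) * P y)"
            using elim(1) m P0[of y] unfolding h_def by (simp add: divide_right_mono mult_right_mono)
          show ?thesis
          proof (cases "y \<in> ball a R1")
            case True
            then have "norm (V y) * norm (u y) * P y = v y * f y"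
              using out by (simp add: v_def f_def W_def)
            then have "h y powr p \<le> (1 / m * (v y * f y)) powr p"
              using hle h0[of y] p by (intro powr_mono2) auto
            also have "\<dots> = (1 / m) powr p * (v y * f y) powr p"
              by (rule powr_mult)
            finally show ?thesis by (simp add: add_increasing2)
          next
            case False
            then have far: "R1 \<le> norm (y - a)" by (simp add: dist_norm norm_minus_commute)
            then have "0 < norm (y - a)" using R1pos by linarith
            then have "1 / norm (y - a) \<le> 1 / R1"
              using far R1pos by (intro divide_left_mono mult_pos_pos) auto
            then have "norm (pole \<delta> (y - a)) \<le> 1 / R1"
              by (rule order_trans[OF norm_pole_le])
            then have "P y \<le> r" unfolding P_def r_def by (intro power_mono) auto
            then have "1 / m * (norm (V y) * norm (u y) * P y) \<le> 1 / m * (norm (V y) * norm (u y) * r)"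
              using m by (intro mult_left_mono) auto
            then have "h y powr p \<le> (1 / m * (norm (V y) * norm (u y) * r)) powr p"
              using hle h0[of y] p by (intro powr_mono2) auto
            also have "\<dots> = ((1 / m) powr p * r powr p) * (norm (V y) * norm (u y)) powr p"
              using m r by (simp only: powr_mult mult_nonneg_nonneg norm_ge_zero less_imp_le divide_nonneg_nonneg zero_le_one mult_ac)
            finally show ?thesis by (simp add: add_increasing)
          qed
        qed
      qed
      define c1 c2 where "c1 = (1 / m) powr p" and "c2 = (1 / m) powr p * r powr p"
      have c: "0 < c1" "0 < c2" using m r by (auto simp: c1_def c2_def)
      have "(\<integral>\<^sup>+ y. ennreal (h y powr p) \<partial>lborel)
        \<le> (\<integral>\<^sup>+ y. (ennreal c1 * ennreal ((v y * f y) powr p) + ennreal c2 * ennreal ((norm (V y) * norm (u y)) powr p)) \<partial>lborel)"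
      proof (rule nn_integral_mono_AE)
        show "AE y in lborel. ennreal (h y powr p) \<le> ennreal c1 * ennreal ((v y * f y) powr p)
            + ennreal c2 * ennreal ((norm (V y) * norm (u y)) powr p)"
          using hpt
        proof eventually_elim
          case (elim y)
          then have "ennreal (h y powr p) \<le> ennreal (c1 * (v y * f y) powr p + c2 * (norm (V y) * norm (u y)) powr p)"
            unfolding c1_def c2_def by (rule ennreal_leI)
          also have "\<dots> = ennreal c1 * ennreal ((v y * f y) powr p) + ennreal c2 * ennreal ((norm (V y) * norm (u y)) powr p)"
            using c by (simp add: ennreal_mult)
          finally show ?case .
        qed
      qed
      also have "\<dots> = ennreal c1 * (\<integral>\<^sup>+ y. ennreal ((v y * f y) powr p) \<partial>lborel)
          + ennreal c2 * (\<integral>\<^sup>+ y. ennreal ((norm (V y) * norm (u y)) powr p) \<partial>lborel)"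
        by (subst nn_integral_add) (auto simp: nn_integral_cmult)
      also have "\<dots> \<le> ennreal c1 * ennreal ((\<eta> * X) powr p) + ennreal c2 * ennreal (T + 1)"
      proof (intro add_mono mult_left_mono)
        show "(\<integral>\<^sup>+ y. ennreal ((v y * f y) powr p) \<partial>lborel) \<le> ennreal ((\<eta> * X) powr p)"
          by (rule Hoelder_powr[OF p q pq _ _ _ f0 \<eta>(1) X v2]) (use fX in \<open>auto simp: v_def\<close>)
        show "(\<integral>\<^sup>+ y. ennreal ((norm (V y) * norm (u y)) powr p) \<partial>lborel) \<le> ennreal (T + 1)"
          unfolding T(1) by (rule ennreal_leI) simp
      qed auto
      also have "\<dots> = ennreal (c1 * (\<eta> * X) powr p + c2 * (T + 1))"
        using c T(2) by (simp add: ennreal_mult[symmetric] ennreal_plus[symmetric] del: ennreal_plus)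
      finally have hle: "(\<integral>\<^sup>+ y. ennreal (h y powr p) \<partial>lborel) \<le> ennreal (c1 * (\<eta> * X) powr p + c2 * (T + 1))" .
      define B where "B = c1 * (\<eta> * X) powr p + c2 * (T + 1)"
      have B: "B > 0" unfolding B_def using c T(2) by (intro add_nonneg_pos mult_pos_pos mult_nonneg_nonneg) auto
      define b where "b = B powr (1 / p)"
      have b: "b > 0" "b powr p = B" using B p by (simp_all add: b_def powr_powr)
      have "X \<le> C * b"
        by (rule C(2)[OF _ _ f0 h0 b(1) X0 fX _ fh]) (use hle b(2) B_def in auto)
      then have "X powr p \<le> (C * b) powr p" using X0 p by (intro powr_mono2) auto
      also have "\<dots> = C powr p * B" using C(1) b by (simp add: powr_mult)
      also have "\<dots> = (C * (\<eta> / m)) powr p * X powr p + (C / m) powr p * r powr p * (T + 1)"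
        using C(1) m \<eta>(1) X r
        by (simp add: B_def c1_def c2_def powr_mult powr_divide algebra_simps)
      \<comment> \<open>Since \<open>p > 1\<close>, the \<open>p\<close>-th power of 1/2 is still at
        most 1/2.\<close>
      also have "(C * (\<eta> / m)) powr p * X powr p \<le> 1 / 2 * X powr p"
      proof (rule mult_right_mono)
        have "(1 / 2 :: real) powr p \<le> (1 / 2) powr 1" using p by (intro powr_mono') auto
        then show "(C * (\<eta> / m)) powr p \<le> 1 / 2" unfolding \<eta>(2) by simp
      qed simp
      finally have "X powr p \<le> 1 / 2 * X powr p + (C / m) powr p * r powr p * (T + 1)" by simp
      then have "X powr p \<le> K * r powr p" by (simp add: K_def algebra_simps)
      then have "(X powr p) powr (1 / p) \<le> (K * r powr p) powr (1 / p)"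
        using p by (intro powr_mono2) auto
      then show ?thesis using p X r K by (simp add: powr_powr powr_mult)
    qed
    \<comment> \<open>Removes the weight: inside radius \<open>R2\<close> this costs the factor
      \<open>R2 ^ N\<close>, while the potential estimate has gained
      \<open>(1 / R1) ^ N\<close>.\<close>
    have "AE x in lborel. indicator (ball a R2) x * norm (u x) powr q \<le> (R2 ^ N) powr q * f x powr q"
      using u0
    proof eventually_elim
      case (elim x)
      show ?case
      proof (cases "x \<in> ball a R2 \<and> u x \<noteq> 0")
        case False
        then show ?thesis by (auto simp: indicator_def)
      next
        case True
        then have "x \<notin> ball a R" using elim by auto
        then have "2 * \<delta> \<le> (norm (x - a))\<^sup>2" using \<delta>ball[of x] by simp
        then have pole: "norm (pole \<delta> (x - a)) = 1 / norm (x - a)" by (rule norm_pole_eq[OF \<delta>])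
        have "norm (x - a) < R2" "R \<le> norm (x - a)"
          using True \<open>x \<notin> ball a R\<close> by (auto simp: dist_norm norm_minus_commute)
        moreover from this have "0 < norm (x - a)" using R by linarith
        ultimately have "1 \<le> R2 * (1 / norm (x - a))" by (simp add: field_simps)
        then have "1 \<le> (R2 * (1 / norm (x - a))) ^ N" by (rule one_le_power)
        then have "1 \<le> R2 ^ N * P x" unfolding P_def pole by (simp add: power_mult_distrib[symmetric])
        then have "norm (u x) * 1 \<le> norm (u x) * (R2 ^ N * P x)" by (intro mult_left_mono) auto
        also have "\<dots> = R2 ^ N * f x" using True R2 by (simp add: f_def W_def)
        finally have "norm (u x) powr q \<le> (R2 ^ N * f x) powr q" using q by (intro powr_mono2) auto
        then show ?thesis using True R2 R f0[of x] by (simp add: powr_mult)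
      qed
    qed
    then have "Y \<le> (\<integral> x. (R2 ^ N) powr q * f x powr q \<partial>lborel)"
      unfolding Y_def by (intro integral_mono_AE iY integrable_mult_right fq)
    also have "\<dots> = (R2 ^ N) powr q * X powr q" by (simp add: Xq I_def)
    also have "\<dots> = (R2 ^ N * X) powr q" using R2 R X0 by (simp add: powr_mult)
    finally have "Y powr (1 / q) \<le> ((R2 ^ N * X) powr q) powr (1 / q)"
      using q Y0 by (intro powr_mono2) auto
    also have "\<dots> = R2 ^ N * X" using q R2 R X0 by (simp add: powr_powr)
    also have "\<dots> \<le> R2 ^ N * (K powr (1 / p) * r)"
      using R2 R by (intro mult_left_mono Xle) auto
    also have "\<dots> = K powr (1 / p) * (R2 / R1) ^ N" by (simp add: r_def power_divide)
    finally show ?thesis .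
  qed
  have "(\<lambda>N. K powr (1 / p) * (R2 / R1) ^ N) \<longlonglongrightarrow> K powr (1 / p) * 0"
    using R2 R R1pos by (intro tendsto_mult tendsto_const LIMSEQ_realpow_zero) auto
  then have "Y powr (1 / q) \<le> K powr (1 / p) * 0"
    by (rule LIMSEQ_le_const) (use est in auto)
  then have "Y = 0" using Y0 by simp
  then have "AE x in lborel. indicator (ball a R2) x * norm (u x) powr q = 0"
    using integral_nonneg_eq_0_iff_AE[OF iY] by (simp add: Y_def)
  then have "AE x in lborel. x \<in> ball a R2 \<longrightarrow> u x = 0"
    by eventually_elim auto
  then show ?thesis using R2(1) by blast
qed

text \<open>The steps may shrink, but the supremum of the admissible radii is itself admissible,
  since an open disc is a countable union of smaller concentric ones and null sets are stable under
  countable unions. A further step then contradicts maximality, so the radii are unbounded.\<close>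

lemma AE_eq_0_of_step:
  fixes u :: "real \<times> real \<Rightarrow> complex"
  assumes R0: "R0 > 0" "AE y in lborel. y \<in> ball a R0 \<longrightarrow> u y = 0"
    and step: "\<And>R. R > 0 \<Longrightarrow> AE y in lborel. y \<in> ball a R \<longrightarrow> u y = 0 \<Longrightarrow>
      \<exists>R'>R. AE y in lborel. y \<in> ball a R' \<longrightarrow> u y = 0"
  shows "AE y in lborel. u y = 0"
proof -
  define S where "S = {R. R > 0 \<and> (AE y in lborel. y \<in> ball a R \<longrightarrow> u y = 0)}"
  have R0S: "R0 \<in> S" using R0 by (simp add: S_def)
  have down: "R \<in> S" if "R' \<in> S" "0 < R" "R \<le> R'" for R R'
    using that unfolding S_def by (auto elim!: eventually_mono)
  show ?thesis
  proof (cases "bdd_above S")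
    case True
    define s where "s = Sup S"
    have s: "s > 0" using cSup_upper[OF R0S True] R0(1) by (simp add: s_def)
    \<comment> \<open>The double successor keeps the radii positive; with a single one the first
      radius would be 0, which is not in \<open>S\<close>.\<close>
    have ae: "AE y in lborel. y \<in> ball a (s - s / real (Suc (Suc n))) \<longrightarrow> u y = 0" for n
    proof -
      have pos: "0 < s - s / real (Suc (Suc n))" "s - s / real (Suc (Suc n)) < s"
        using s by (auto simp: field_simps intro!: add_pos_nonneg)
      then obtain R' where "R' \<in> S" "s - s / real (Suc (Suc n)) < R'"
        using less_cSup_iff[OF _ True] R0S unfolding s_def by blast
      then have "s - s / real (Suc (Suc n)) \<in> S" using down pos by simp
      then show ?thesis by (simp add: S_def)
    qed
    have "AE y in lborel. \<forall>n. y \<in> ball a (s - s / real (Suc (Suc n))) \<longrightarrow> u y = 0"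
      by (rule AE_all_countable[THEN iffD2], rule allI, rule ae)
    then have "AE y in lborel. y \<in> ball a s \<longrightarrow> u y = 0"
    proof eventually_elim
      case (elim y)
      show ?case
      proof
        assume y: "y \<in> ball a s"
        have "(\<lambda>n. s - s * (1 / real (Suc n))) \<longlonglongrightarrow> s - s * 0"
          by (intro tendsto_diff tendsto_mult tendsto_const LIMSEQ_Suc[OF lim_1_over_n])
        then have "(\<lambda>n. s - s * (1 / real (Suc (Suc n)))) \<longlonglongrightarrow> s - s * 0"
          by (rule LIMSEQ_Suc)
        then have "\<forall>\<^sub>F n in sequentially. dist a y < s - s * (1 / real (Suc (Suc n)))"
          using y by (intro order_tendstoD(1)) auto
        then obtain n where "dist a y < s - s * (1 / real (Suc (Suc n)))"
          using eventually_happens'[OF sequentially_bot] by blast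
        then show "u y = 0" using elim[rule_format, of n] by simp
      qed
    qed
    from step[OF s this] obtain R' where "R' > s" "R' \<in> S" using s by (auto simp: S_def)
    then show ?thesis using cSup_upper[of R' S] True by (simp add: s_def)
  next
    case False
    have ae: "AE y in lborel. y \<in> ball a (real (Suc n)) \<longrightarrow> u y = 0" for n
    proof -
      obtain R' where "R' \<in> S" "real (Suc n) < R'"
        using False unfolding bdd_above_def by (meson not_le)
      then have "real (Suc n) \<in> S" using down by simp
      then show ?thesis by (simp add: S_def)
    qed
    have "AE y in lborel. \<forall>n. y \<in> ball a (real (Suc n)) \<longrightarrow> u y = 0"
      by (rule AE_all_countable[THEN iffD2], rule allI, rule ae)
    then show ?thesis
    proof eventually_elim
      case (elim y)
      obtain n where "dist a y < real n" using reals_Archimedean2 by blast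
      then have "y \<in> ball a (real (Suc n))" by simp
      then show ?case using elim by blast
    qed
  qed
qed

section \<open>Borel representatives and the passage from \<open>lebesgue\<close> to
  \<open>lborel\<close>\<close>

lemma lebesgue_measurable_ex_borel:
  fixes f :: "'a::euclidean_space \<Rightarrow> complex"
  assumes [measurable]: "f \<in> borel_measurable lebesgue"
  shows "\<exists>f'\<in>borel_measurable borel. AE x in lborel. f x = f' x"
proof -
  have m: "(\<lambda>x. Re (f x)) \<in> borel_measurable lebesgue" "(\<lambda>x. Im (f x)) \<in> borel_measurable lebesgue"
    by measurable
  obtain r where [measurable]: "r \<in> borel_measurable lborel" and r: "AE x in lborel. Re (f x) = r x"
    using completion_ex_borel_measurable_real[OF m(1)] by auto
  obtain i where [measurable]: "i \<in> borel_measurable lborel" and i: "AE x in lborel. Im (f x) = i x"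
    using completion_ex_borel_measurable_real[OF m(2)] by auto
  have m1: "(\<lambda>x. complex_of_real (r x) + \<i> * complex_of_real (i x)) \<in> borel_measurable borel"
    by measurable
  have m2: "AE x in lborel. f x = complex_of_real (r x) + \<i> * complex_of_real (i x)"
    using r i by eventually_elim (simp add: complex_eq_iff)
  show ?thesis
    by (rule bexI[of _ "\<lambda>x. complex_of_real (r x) + \<i> * complex_of_real (i x)"]) (rule m2, rule m1)
qed

text \<open>Discs around 0 exhaust the plane, so \<open>g\<close> is the pointwise limit of its
  truncations, each of them measurable because it is integrable.\<close>

lemma locally_integrable_measurable:
  assumes "locally_integrable g"
  shows "g \<in> borel_measurable lebesgue"
proof (rule borel_measurable_LIMSEQ_metric)
  fix n :: nat
  have "g absolutely_integrable_on (cball 0 (real n))"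
    using assms compact_cball unfolding locally_integrable_def by blast
  then show "(\<lambda>z. indicator (cball 0 (real n)) z *\<^sub>R g z) \<in> borel_measurable lebesgue"
    unfolding set_integrable_def by (rule borel_measurable_integrable)
next
  fix z :: "real \<times> real"
  obtain N where N: "norm z < real N" using reals_Archimedean2 by blast
  have "\<forall>\<^sub>F n in sequentially. indicator (cball 0 (real n)) z *\<^sub>R g z = g z"
    using eventually_ge_at_top[of N] by eventually_elim (use N in \<open>simp add: indicator_def\<close>)
  then show "(\<lambda>n. indicator (cball 0 (real n)) z *\<^sub>R g z) \<longlonglongrightarrow> g z"
    by (rule tendsto_eventually)
qed

text \<open>The estimates use iterated integrals of Borel functions over \<open>lborel\<close>,
  whereas the theorem concerns Lebesgue measurable functions. Changing a function on a null set and
  completing the measure both leave the integral unchanged.\<close>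

lemma lebesgue_integral_eq_lborel:
  fixes f f' :: "'a::euclidean_space \<Rightarrow> 'b::{banach, second_countable_topology}"
  assumes [measurable]: "f \<in> borel_measurable lebesgue" and f': "f' \<in> borel_measurable borel"
    and ae: "AE x in lborel. f x = f' x"
  shows "integral\<^sup>L lebesgue f = integral\<^sup>L lborel f'" "integrable lebesgue f \<longleftrightarrow> integrable lborel f'"
proof -
  have f'l: "f' \<in> borel_measurable lborel" using f' by simp
  then have [measurable]: "f' \<in> borel_measurable lebesgue" by (rule measurable_completion)
  have ae': "AE x in lebesgue. f x = f' x" using ae by (rule AE_completion)
  have "integral\<^sup>L lebesgue f = integral\<^sup>L lebesgue f'"
    by (rule integral_cong_AE) (use ae' in measurable)
  then show "integral\<^sup>L lebesgue f = integral\<^sup>L lborel f'"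
    using integral_completion[OF f'l] by simp
  have "integrable lebesgue f \<longleftrightarrow> integrable lebesgue f'"
    by (rule integrable_cong_AE) (use ae' in measurable)
  then show "integrable lebesgue f \<longleftrightarrow> integrable lborel f'"
    using integrable_completion[OF f'l] by simp
qed

lemma memLp_borel:
  assumes "memLp r f" and f': "f' \<in> borel_measurable borel" and ae: "AE x in lborel. f x = f' x"
  shows "integrable lborel (\<lambda>z. norm (f' z) powr r)"
proof -
  have [measurable]: "f \<in> borel_measurable lebesgue" and i: "integrable lebesgue (\<lambda>z. norm (f z) powr r)"
    using assms(1) by (auto simp: memLp_def)
  note [measurable] = f'
  have "(\<lambda>z. norm (f z) powr r) \<in> borel_measurable lebesgue"
    "(\<lambda>z. norm (f' z) powr r) \<in> borel_measurable borel" by measurable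
  moreover have "AE z in lborel. norm (f z) powr r = norm (f' z) powr r"
    using ae by eventually_elim simp
  ultimately show ?thesis using lebesgue_integral_eq_lborel(2) i by blast
qed

theorem theorem1p1:
  fixes p q :: real and u V :: "real \<times> real \<Rightarrow> complex" and \<Omega> :: "(real \<times> real) set"
  assumes "1 < p" and "p < 2" and "2 < q" and "1 / p - 1 / q = 1 / 2"
    and "memLp 2 V"
    and "memLp p u" and "memLp q u"
    and "\<exists>g. has_distributional_dbar u g \<and>
           (AE z in lebesgue. norm (g z) \<le> norm (V z * u z))"
    and "open \<Omega>" and "\<Omega> \<noteq> {}"
    and "AE z in lebesgue. z \<in> \<Omega> \<longrightarrow> u z = 0"
  shows "AE z in lebesgue. u z = 0"
proof -
  obtain g where g: "has_distributional_dbar u g" "AE z in lebesgue. norm (g z) \<le> norm (V z * u z)"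
    using assms(8) by blast
  have um [measurable]: "u \<in> borel_measurable lebesgue" and Vm [measurable]: "V \<in> borel_measurable lebesgue"
    and gm [measurable]: "g \<in> borel_measurable lebesgue"
    using assms(5,7) g(1) locally_integrable_measurable
    by (auto simp: memLp_def has_distributional_dbar_def)
  obtain u' where u' [measurable]: "u' \<in> borel_measurable borel" and uu': "AE x in lborel. u x = u' x"
    using lebesgue_measurable_ex_borel[OF um] by blast
  obtain V' where V' [measurable]: "V' \<in> borel_measurable borel" and VV': "AE x in lborel. V x = V' x"
    using lebesgue_measurable_ex_borel[OF Vm] by blast
  obtain g' where g' [measurable]: "g' \<in> borel_measurable borel" and gg': "AE x in lborel. g x = g' x"
    using lebesgue_measurable_ex_borel[OF gm] by blast
  \<comment> \<open>A test function and its image under \<open>dbar\<close> are continuous, hence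
    Borel, so replacing \<open>u\<close> and \<open>g\<close> by their representatives alters the
    two pairings only on null sets.\<close>
  have weak: "(\<integral> z. g' z * \<phi> z \<partial>lborel) = - (\<integral> z. u' z * dbar \<phi> z \<partial>lborel)" if \<phi>: "test_function \<phi>" for \<phi>
  proof -
    have Ck: "Ck k \<phi>" for k using \<phi> by (simp add: test_function_def smooth_def)
    have \<phi>m [measurable]: "\<phi> \<in> borel_measurable borel"
      using Ck[of 0] by (intro borel_measurable_continuous_onI) simp
    have dm [measurable]: "dbar \<phi> \<in> borel_measurable borel"
      by (intro borel_measurable_continuous_onI continuous_on_dbar Ck)
    have [measurable]: "\<phi> \<in> borel_measurable lebesgue" "dbar \<phi> \<in> borel_measurable lebesgue"
      using \<phi>m dm by (auto intro!: measurable_completion)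
    have "(LINT z|lebesgue. g z * \<phi> z) = (\<integral> z. g' z * \<phi> z \<partial>lborel)"
    proof (rule lebesgue_integral_eq_lborel(1))
      show "AE z in lborel. g z * \<phi> z = g' z * \<phi> z" using gg' by eventually_elim simp
    qed measurable
    moreover have "(LINT z|lebesgue. u z * dbar \<phi> z) = (\<integral> z. u' z * dbar \<phi> z \<partial>lborel)"
    proof (rule lebesgue_integral_eq_lborel(1))
      show "AE z in lborel. u z * dbar \<phi> z = u' z * dbar \<phi> z" using uu' by eventually_elim simp
    qed measurable
    ultimately show ?thesis using g(1) \<phi> by (simp add: has_distributional_dbar_def)
  qed
  have "AE z in lborel. norm (g z) \<le> norm (V z * u z)"
    using g(2) by (simp add: AE_completion_iff)
  then have gV: "AE z in lborel. norm (g' z) \<le> norm (V' z) * norm (u' z)"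
    using uu' VV' gg' by eventually_elim (simp add: norm_mult)
  obtain a where "a \<in> \<Omega>" using assms(10) by blast
  then obtain r where r: "r > 0" "ball a r \<subseteq> \<Omega>"
    using assms(9) open_contains_ball by blast
  have "AE z in lborel. z \<in> \<Omega> \<longrightarrow> u z = 0"
    using assms(11) by (simp add: AE_completion_iff)
  then have u0: "AE y in lborel. y \<in> ball a r \<longrightarrow> u' y = 0"
    using uu' by eventually_elim (use r in auto)
  have "AE y in lborel. u' y = 0"
    by (rule AE_eq_0_of_step[OF r(1) u0])
      (rule unique_continuation_step[OF assms(1,2,3,4) u' g' V' weak
        memLp_borel[OF assms(7) u' uu'] memLp_borel[OF assms(5) V' VV'] gV])
  then have "AE y in lborel. u y = 0" using uu' by eventually_elim simp
  then show ?thesis by (rule AE_completion)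
qed

end
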